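(* Let $p \ge 29$ be a prime, let $\chi$ be an even Dirichlet character modulo $p$, and let $k \ge 16$ be an even integer. Then there exist two complex sequences $(a_m)_{m \in \mathbb{N}}$, $(b_m)_{m \in \mathbb{N}}$ with $|a_m|,|b_m| = O(m^{\sigma})$ for some $\sigma > 0$ such that, writing $f(z)=\sum_{m \ge 1} a_m e(mz)$ and $g(z)=\sum_{m\ge 1} b_m e(mz)$ on the upper half-plane $\mathbb{H}$: (i) neither $f$ nor $g$ lies in $\bigcup_{l,N} S_l(\Gamma(N))$, i.e. neither $f$ nor $g$ is a classical cusp form of any weight $l$ for any principal congruence subgroup $\Gamma(N)$; (ii) for every primitive Dirichlet character $\psi$ modulo $q$ with $(q,p)=1$, the functions $\Lambda(f,\psi,s)$ and $\Lambda(g,\psi,s)$ admit holomorphic continuation to the whole complex plane and are bounded in every vertical strip, and moreover for every such $\psi$ whose modulus satisfies $q \le \sqrt{\frac{p-24}{3}}$ they satisfy the functional equation $$\Lambda(f,\psi,s)= i^k\chi(q)\psi(p)\frac{\tau(\psi)^2}{q} (pq^2)^{\frac{k}{2}-s} \Lambda(g,\overline{\psi},k-s).$$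
   Context: $e(z)=e^{2\pi i z}$. For a Dirichlet character $\psi$ modulo $q$ and a sequence $(a_m)$ with polynomial growth, $L(f,\psi,s)=\sum_{m\ge1} a_m\psi(m)m^{-s}$ and $\Lambda(f,\psi,s)=(2\pi)^{-s}\Gamma(s)L(f,\psi,s)$ (a priori defined for $\Re s>\sigma+1$), and similarly for $g$ with $(b_m)$. $\tau(\psi)=\sum_{a \bmod q}\psi(a)e(a/q)$ is the Gauss sum. $\Gamma(N)=\{\gamma\in \mathrm{SL}_2(\mathbb{Z}) : \gamma\equiv I \bmod N\}$ and $S_l(\Gamma(N))$ denotes the space of holomorphic cusp forms of weight $l$ for $\Gamma(N)$. *)

theory Defs
  imports
    "HOL-Complex_Analysis.Complex_Analysis"
    "HOL-Number_Theory.Number_Theory"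
    "HOL-Library.Landau_Symbols"
begin

definition e :: "complex \<Rightarrow> complex" where
  "e z = exp (2 * of_real pi * \<i> * z)"

definition upper_half_plane :: "complex set" where
  "upper_half_plane = {z. Im z > 0}"


subsection \<open>Dirichlet characters\<close>

text \<open>
  Characters modulo \<open>q\<close> are extended by zero to all integers; for \<open>q = 1\<close> the only one is the
  constant function \<open>1\<close>.
\<close>

definition dirichlet_character :: "nat \<Rightarrow> (int \<Rightarrow> complex) \<Rightarrow> bool" where
  "dirichlet_character q \<psi> \<longleftrightarrow>
     q > 0 \<and>
     (\<forall>m n. [m = n] (mod int q) \<longrightarrow> \<psi> m = \<psi> n) \<and>
     (\<forall>m n. \<psi> (m * n) = \<psi> m * \<psi> n) \<and>
     (\<forall>n. \<psi> n \<noteq> 0 \<longleftrightarrow> coprime n (int q))"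

definition even_character :: "(int \<Rightarrow> complex) \<Rightarrow> bool" where
  "even_character \<psi> \<longleftrightarrow> \<psi> (-1) = 1"

definition induced_from :: "nat \<Rightarrow> (int \<Rightarrow> complex) \<Rightarrow> nat \<Rightarrow> bool" where
  "induced_from q \<psi> d \<longleftrightarrow>
     d dvd q \<and>
     (\<exists>\<psi>'. dirichlet_character d \<psi>' \<and> (\<forall>n. coprime n (int q) \<longrightarrow> \<psi> n = \<psi>' n))"

definition primitive_character :: "nat \<Rightarrow> (int \<Rightarrow> complex) \<Rightarrow> bool" where
  "primitive_character q \<psi> \<longleftrightarrow>
     dirichlet_character q \<psi> \<and> \<not> (\<exists>d<q. induced_from q \<psi> d)"

definition gauss_sum :: "nat \<Rightarrow> (int \<Rightarrow> complex) \<Rightarrow> complex" where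
  "gauss_sum q \<psi> = (\<Sum>a<q. \<psi> (int a) * e (of_nat a / of_nat q))"


subsection \<open>Fourier series and twisted \<open>L\<close>-series\<close>

text \<open>
  Sequences are indexed by \<open>m \<ge> 1\<close>; the value at \<open>0\<close> is never used.
\<close>

definition fourier_series :: "(nat \<Rightarrow> complex) \<Rightarrow> complex \<Rightarrow> complex" where
  "fourier_series a z = (\<Sum>m. a (Suc m) * e (of_nat (Suc m) * z))"

definition twisted_L :: "(nat \<Rightarrow> complex) \<Rightarrow> (int \<Rightarrow> complex) \<Rightarrow> complex \<Rightarrow> complex" where
  "twisted_L a \<psi> s = (\<Sum>m. a (Suc m) * \<psi> (int (Suc m)) * of_nat (Suc m) powr (- s))"

text \<open>
  This is only meaningful in the half-plane of absolute convergence; elsewhere one has to pass to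
  an analytic continuation.
\<close>

definition completed_L :: "(nat \<Rightarrow> complex) \<Rightarrow> (int \<Rightarrow> complex) \<Rightarrow> complex \<Rightarrow> complex" where
  "completed_L a \<psi> s = of_real (2 * pi) powr (- s) * Gamma s * twisted_L a \<psi> s"

definition entire_continuation ::
    "real \<Rightarrow> (complex \<Rightarrow> complex) \<Rightarrow> (complex \<Rightarrow> complex) \<Rightarrow> bool" where
  "entire_continuation c F\<^sub>0 F \<longleftrightarrow>
     F holomorphic_on UNIV \<and> (\<forall>s. Re s > c \<longrightarrow> F s = F\<^sub>0 s)"

definition bounded_in_vertical_strips :: "(complex \<Rightarrow> complex) \<Rightarrow> bool" where
  "bounded_in_vertical_strips F \<longleftrightarrow>
     (\<forall>x y. bounded (F ` {s. x \<le> Re s \<and> Re s \<le> y}))"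


subsection \<open>Cusp forms for principal congruence subgroups\<close>

definition SL2Z :: "(int^2^2) set" where
  "SL2Z = {\<gamma>. det \<gamma> = 1}"

definition principal_congruence_subgroup :: "nat \<Rightarrow> (int^2^2) set" where
  "principal_congruence_subgroup N =
     {\<gamma> \<in> SL2Z. \<forall>i j. [\<gamma> $ i $ j = mat 1 $ i $ j] (mod int N)}"

definition automorphy_factor :: "int^2^2 \<Rightarrow> complex \<Rightarrow> complex" where
  "automorphy_factor \<gamma> z = of_int (\<gamma> $ 2 $ 1) * z + of_int (\<gamma> $ 2 $ 2)"

definition moebius :: "int^2^2 \<Rightarrow> complex \<Rightarrow> complex" where
  "moebius \<gamma> z = (of_int (\<gamma> $ 1 $ 1) * z + of_int (\<gamma> $ 1 $ 2)) / automorphy_factor \<gamma> z"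

definition slash :: "int \<Rightarrow> (complex \<Rightarrow> complex) \<Rightarrow> int^2^2 \<Rightarrow> complex \<Rightarrow> complex" where
  "slash l h \<gamma> z = automorphy_factor \<gamma> z powi (- l) * h (moebius \<gamma> z)"

text \<open>
  Membership depends only on the values on the upper half-plane. Each slash transform under
  \<open>SL\<^sub>2(\<int>)\<close> is periodic with period \<open>N\<close>; holomorphy and vanishing at all cusps mean that its
  Fourier expansion in \<open>e(z/N)\<close> has only terms of positive index.
\<close>

definition cusp_forms :: "int \<Rightarrow> nat \<Rightarrow> (complex \<Rightarrow> complex) set" where
  "cusp_forms l N =
     {h. h holomorphic_on upper_half_plane \<and>
         (\<forall>\<gamma> \<in> principal_congruence_subgroup N. \<forall>z \<in> upper_half_plane. slash l h \<gamma> z = h z) \<and>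
         (\<forall>\<gamma> \<in> SL2Z. \<exists>c :: nat \<Rightarrow> complex. \<forall>z \<in> upper_half_plane.
            (\<lambda>n. c (Suc n) * e (of_nat (Suc n) * z / of_nat N)) sums slash l h \<gamma> z)}"

end

theory Submission
  imports Defs "HOL-Probability.Sinc_Integral"
begin

text \<open>
  By the usual argument the functional equation for \<open>\<psi>\<close> modulo \<open>q\<close> only uses the behaviour of \<open>f\<close> under
  matrices in \<open>\<Gamma>\<^sub>0(p)\<close> with lower right entry \<open>q\<close>. Homomorphisms \<open>\<Gamma>\<^sub>0(p) \<rightarrow> \<real>\<close> that kill the parabolic elements are
  given by modular symbols, that is, by functions on the projective line over the field with \<open>p\<close> elements
  satisfying the two Manin relations. There are about \<open>p/6\<close> free parameters, while killing all matrices with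
  lower right entry at most \<open>Q\<close> costs at most \<open>Q\<^sup>2/2\<close> conditions, so for \<open>3 Q\<^sup>2 + 24 \<le> p\<close> a nonzero such homomorphism
  \<open>H\<close> exists. Scaled by an irrational number it yields a unitary character of infinite order.

  Let \<open>f\<close> be the product of the Eisenstein series of weight 8 for the cusp infinity, twisted by this character
  and \<open>\<chi>\<close>, and the untwisted Eisenstein series of weight \<open>k - 8\<close> for the cusp 0, and let \<open>g\<close> be its Fricke
  transform. Each factor vanishes at the cusp where the other does not, so \<open>f\<close> and \<open>g\<close> decay at both cusps of
  \<open>\<Gamma>\<^sub>0(p)\<close>; hence they decay at all \<open>u/q\<close> with \<open>q\<close> prime to \<open>p\<close>, which makes all twists entire. Since the character
  has infinite order, it is not trivial on any \<open>\<Gamma>(N)\<close>.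
\<close>

section \<open>Zero sums over orbits\<close>

text \<open>The value on a bottom row with lower right entry d reduces, up to steps of value zero,
  to the continued fraction of a fraction with denominator d. Each of its steps is the value at a
  class (q : d') with 1 <= d' < q <= Q or vanishes; this is where the Q^2/2 conditions come from.
  The count is: p + 1 unknowns; at most (p + 3)/2 equations from the relation of order 2 and (p +
  5)/3 from the one of order 3, each map having at most two fixed points; Q^2/2 for the pairs; 1 for
  the point at infinity.

  A functional equation for the twist requires one multiplier common to all lines over u/q, and this
  is secured only for small q. Decay requires only that the multiplier has modulus 1, so
  continuation is available for every q prime to p.

  The bound k >= 16 splits as 8 + 8: in each factor four powers of |c z + d| pay for convergence
  over the lattice, and four more for decay at the cusp where the factor vanishes. The values of
  \<open>chi\<close> are roots of unity, so \<open>chi\<close> cannot undo the infinite order of the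
  other character.\<close>

lemma homogeneous_system_nontrivial:
  fixes l :: "'i \<Rightarrow> 'x \<Rightarrow> real"
  assumes "finite I" "finite X" "card I < card X"
  shows "\<exists>M. (\<exists>x\<in>X. M x \<noteq> 0) \<and> (\<forall>i\<in>I. (\<Sum>x\<in>X. l i x * M x) = 0)"
  using assms
proof (induction I arbitrary: X l rule: finite_induct)
  case empty
  then obtain x where "x \<in> X" by (metis card_gt_0_iff ex_in_conv card.empty)
  then show ?case by (intro exI[of _ "\<lambda>_. 1"]) auto
next
  case (insert i I)
  show ?case
  proof (cases "\<forall>x\<in>X. l i x = 0")
    case True
    have "card I < card X" using insert by simp
    with insert.IH[of X l] insert.prems obtain M
      where "\<exists>x\<in>X. M x \<noteq> 0" "\<forall>i\<in>I. (\<Sum>x\<in>X. l i x * M x) = 0" by auto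
    with True show ?thesis by (intro exI[of _ M]) auto
  next
    case False
    then obtain x0 where x0: "x0 \<in> X" "l i x0 \<noteq> 0" by auto
    \<comment> \<open>Gaussian elimination: subtracting a multiple of equation \<open>i\<close>
      removes the pivot variable \<open>x0\<close> from the others; its value is chosen afterwards
      so that equation \<open>i\<close> holds.\<close>
    define l' where "l' j x = l j x - l j x0 / l i x0 * l i x" for j x
    have "card I < card (X - {x0})" using insert x0 by simp
    with insert.IH[of "X - {x0}" l'] insert.prems obtain M where
      M: "\<exists>x\<in>X - {x0}. M x \<noteq> 0" "\<forall>j\<in>I. (\<Sum>x\<in>X - {x0}. l' j x * M x) = 0" by auto
    define s where "s = (\<Sum>x\<in>X - {x0}. l i x * M x)"
    define M' where "M' = M(x0 := - s / l i x0)"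
    have split: "(\<Sum>x\<in>X. l j x * M' x) = l j x0 * (- s / l i x0) + (\<Sum>x\<in>X - {x0}. l j x * M x)" for j
      using x0 insert.prems by (subst sum.remove[of _ x0]) (auto simp: M'_def intro!: sum.cong)
    have "(\<Sum>x\<in>X. l i x * M' x) = 0" using split[of i] x0 by (simp add: s_def)
    moreover have "(\<Sum>x\<in>X. l j x * M' x) = 0" if "j \<in> I" for j
    proof -
      have "0 = (\<Sum>x\<in>X - {x0}. l j x * M x - l j x0 / l i x0 * (l i x * M x))"
        using M(2) that by (simp add: l'_def left_diff_distrib mult.assoc)
      also have "\<dots> = (\<Sum>x\<in>X - {x0}. l j x * M x) - l j x0 / l i x0 * s"
        by (simp add: sum_subtractf sum_distrib_left s_def)
      finally show ?thesis using split[of j] by simp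
    qed
    moreover have "\<exists>x\<in>X. M' x \<noteq> 0" using M(1) by (auto simp: M'_def)
    ultimately show ?thesis by (intro exI[of _ M']) auto
  qed
qed

lemma zero_sums_nontrivial:
  assumes "finite X" "F \<subseteq> Pow X" "card F < card X"
  obtains M :: "'x \<Rightarrow> real" where "\<exists>x\<in>X. M x \<noteq> 0" "\<forall>A\<in>F. sum M A = 0"
proof -
  have fF: "finite F" using assms by (meson finite_Pow_iff finite_subset)
  obtain M :: "'x \<Rightarrow> real" where M: "\<exists>x\<in>X. M x \<noteq> 0" "\<forall>A\<in>F. (\<Sum>x\<in>X. indicator A x * M x) = 0"
    using homogeneous_system_nontrivial[OF fF assms(1,3)] by blast
  have "sum M A = 0" if "A \<in> F" for A
  proof -
    have "X \<inter> A = A" using assms that by auto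
    then have "sum M A = (\<Sum>x\<in>X. indicator A x * M x)"
      using assms(1) sum.inter_restrict[of X M A] by (simp add: indicator_def if_distrib cong: if_cong)
    then show ?thesis using M that by simp
  qed
  with M(1) that show ?thesis by blast
qed

text \<open>Each exceptional singleton falls short of the size n by n - 1. Granting n - 1 extra
  units for every point of \<open>Y\<close> makes up for this, so every block accounts for n units
  of the right-hand side, and disjointness prevents double counting.\<close>

lemma card_blocks_le:
  fixes n :: nat
  assumes "finite X" "\<Union>F = X" "\<And>A B. A \<in> F \<Longrightarrow> B \<in> F \<Longrightarrow> A \<noteq> B \<Longrightarrow> A \<inter> B = {}"
    and blocks: "\<And>A. A \<in> F \<Longrightarrow> card A \<ge> n \<or> (\<exists>x\<in>Y. A = {x})" and "finite Y" and n: "n \<ge> 1"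
  shows "n * card F \<le> card X + (n - 1) * card Y"
proof -
  have fF: "finite F" using assms by (metis finite_UnionD)
  define G where "G = {A \<in> F. \<exists>x\<in>Y. A = {x}}"
  have "card G \<le> card ((\<lambda>x. {x}) ` Y)"
    using \<open>finite Y\<close> by (intro card_mono) (auto simp: G_def)
  also have "\<dots> \<le> card Y" using \<open>finite Y\<close> by (rule card_image_le)
  finally have G: "card G \<le> card Y" .
  have GF: "G \<subseteq> F" by (auto simp: G_def)
  have "card (\<Union>F) = sum card F"
  proof (rule card_Union_disjoint)
    show "pairwise disjnt F" using assms(3) by (auto simp: pairwise_def disjnt_def)
    show "finite A" if "A \<in> F" for A using assms(1,2) that by (metis Union_upper finite_subset)
  qed
  then have "card X = sum card F" using assms(2) by simp
  also have "\<dots> = sum card (F - G) + sum card G"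
    by (rule sum.subset_diff[OF GF fF])
  finally have X: "card X = sum card (F - G) + sum card G" .
  have "sum card G = (\<Sum>A\<in>G. 1)" by (intro sum.cong) (auto simp: G_def)
  then have sG: "sum card G = card G" by simp
  have "(\<Sum>A\<in>F - G. n) \<le> sum card (F - G)" 
    using blocks by (intro sum_mono) (auto simp: G_def)
  then have "n * card (F - G) \<le> sum card (F - G)" by (simp add: mult.commute)
  with X sG have "n * card (F - G) + card G \<le> card X" by simp
  moreover have "card (F - G) + card G = card F"
    using fF GF card_mono[OF fF GF] by (simp add: card_Diff_subset finite_subset)
  moreover have "n * card F = n * card (F - G) + card G + (n - 1) * card G"
    using n calculation(2)[symmetric] by (cases n) (auto simp: algebra_simps)
  moreover have "(n - 1) * card G \<le> (n - 1) * card Y" using G by simp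
  ultimately show ?thesis by linarith
qed

lemma card_involution_orbits:
  assumes "finite X" "\<And>x. x \<in> X \<Longrightarrow> f x \<in> X" "\<And>x. x \<in> X \<Longrightarrow> f (f x) = x"
  shows "2 * card ((\<lambda>x. {x, f x}) ` X) \<le> card X + card {x \<in> X. f x = x}"
proof -
  have "2 * card ((\<lambda>x. {x, f x}) ` X) \<le> card X + (2 - 1) * card {x \<in> X. f x = x}"
  proof (rule card_blocks_le)
    fix A B assume "A \<in> (\<lambda>x. {x, f x}) ` X" "B \<in> (\<lambda>x. {x, f x}) ` X" "A \<noteq> B"
    then obtain x y where xy: "x \<in> X" "y \<in> X" "A = {x, f x}" "B = {y, f y}" by blast
    have "A = B" if "z \<in> A" "z \<in> B" for z
    proof -
      \<comment> \<open>Every point of an orbit generates the same orbit, so orbits that meet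
        coincide.\<close>
      have "{v, f v} = {z, f z}" if "v \<in> X" "z \<in> {v, f v}" for v
        using that(2) assms(3)[OF that(1)] by (elim insertE emptyE) (simp_all add: insert_commute)
      from this[OF xy(1)] this[OF xy(2)] show ?thesis using xy(3,4) that by simp
    qed
    then show "A \<inter> B = {}" using \<open>A \<noteq> B\<close> by auto
  next
    fix A assume "A \<in> (\<lambda>x. {x, f x}) ` X"
    then obtain x where "x \<in> X" "A = {x, f x}" by auto
    then show "2 \<le> card A \<or> (\<exists>x\<in>{x \<in> X. f x = x}. A = {x})" by (cases "f x = x") auto
  qed (use assms(1,2) in auto)
  then show ?thesis by simp
qed

lemma card_order_3_orbits:
  assumes "finite X" "\<And>x. x \<in> X \<Longrightarrow> f x \<in> X" "\<And>x. x \<in> X \<Longrightarrow> f (f (f x)) = x"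
  shows "3 * card ((\<lambda>x. {x, f x, f (f x)}) ` X) \<le> card X + 2 * card {x \<in> X. f x = x}"
proof -
  have "3 * card ((\<lambda>x. {x, f x, f (f x)}) ` X) \<le> card X + (3 - 1) * card {x \<in> X. f x = x}"
  proof (rule card_blocks_le)
    fix A B assume "A \<in> (\<lambda>x. {x, f x, f (f x)}) ` X" "B \<in> (\<lambda>x. {x, f x, f (f x)}) ` X" "A \<noteq> B"
    then obtain x y where xy: "x \<in> X" "y \<in> X" "A = {x, f x, f (f x)}" "B = {y, f y, f (f y)}" by blast
    have "A = B" if "z \<in> A" "z \<in> B" for z
    proof -
      have "{v, f v, f (f v)} = {z, f z, f (f z)}" if "v \<in> X" "z \<in> {v, f v, f (f v)}" for v
        using that(2) assms(3)[OF that(1)] by (elim insertE emptyE) (simp_all add: insert_commute)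
      from this[OF xy(1)] this[OF xy(2)] show ?thesis using xy(3,4) that by simp
    qed
    then show "A \<inter> B = {}" using \<open>A \<noteq> B\<close> by auto
  next
    fix A assume "A \<in> (\<lambda>x. {x, f x, f (f x)}) ` X"
    then obtain x where x: "x \<in> X" "A = {x, f x, f (f x)}" by blast
    show "3 \<le> card A \<or> (\<exists>x\<in>{x \<in> X. f x = x}. A = {x})"
    proof (cases "f x = x")
      case False
      \<comment> \<open>Any coincidence among x, f x, f (f x) forces f x = x, so an orbit has one
        point or three.\<close>
      have "f (f (f x)) = x" by (rule assms(3)) (rule x(1))
      with False have "f (f x) \<noteq> x" "f (f x) \<noteq> f x" by auto
      then have "card A = 3" using False x(2) by (simp add: card_insert_if)
      then show ?thesis by simp
    qed (use x in simp)
  qed (use assms(1,2) in auto)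
  then show ?thesis by simp
qed

section \<open>Modular symbols on rows\<close>

lemma det_1_coprime:
  fixes a b c d :: int
  assumes "a * d - b * c = 1"
  shows "coprime a b" "coprime a c" "coprime b d" "coprime c d"
proof -
  have unit: "is_unit g" if "g dvd a * d" "g dvd b * c" for g
    using dvd_diff[OF that] assms by simp
  show "coprime a b" "coprime a c" "coprime b d" "coprime c d"
    by (rule coprimeI, rule unit; simp)+
qed

text \<open>The Farey neighbour of a row; meaningful only for coprime \<open>c > 0\<close> and \<open>d\<close>.\<close>

definition parent_row :: "int \<Rightarrow> int \<Rightarrow> int \<times> int" where
  "parent_row c d = (THE r. c * snd r - d * fst r = 1 \<and> 0 \<le> fst r \<and> fst r < c)"

lemma parent_row_unique:
  assumes "c * d' - d * c' = 1" "0 \<le> c'" "c' < (c::int)"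
  shows "parent_row c d = (c', d')"
  unfolding parent_row_def
proof (rule the_equality)
  fix r assume r: "c * snd r - d * fst r = 1 \<and> 0 \<le> fst r \<and> fst r < c"
  have "c * (snd r - d') = d * (fst r - c')" using r assms(1) by (simp add: algebra_simps)
  moreover have "coprime c d" using assms(1) by (rule det_1_coprime(1))
  ultimately have "c dvd fst r - c'" by (metis coprime_dvd_mult_right_iff dvd_triv_left)
  moreover have "\<bar>fst r - c'\<bar> < c" using r assms by auto
  ultimately have 1: "fst r = c'" by (metis dvd_imp_le_int eq_iff_diff_eq_0 leD abs_of_nonneg assms(2,3) order_le_less_trans order_less_imp_le)
  have "c * snd r = 1 + d * c'" "c * d' = 1 + d * c'" using r assms(1) 1 by auto
  moreover have "c \<noteq> 0" using assms by simp
  ultimately have "snd r = d'" by (metis mult_left_cancel)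
  with 1 show "r = (c', d')" by (simp add: prod_eq_iff)
qed (use assms in auto)

lemma parent_row_exists:
  assumes "coprime c d" "(c::int) > 0"
  obtains c' d' where "c * d' - d * c' = 1" "0 \<le> c'" "c' < c"
proof -
  obtain u v where uv: "u * c + v * d = 1" using bezout_int[of c d] assms(1) by auto
  \<comment> \<open>Bezout gives the row (- v, u). Subtracting a multiple of (c, d) keeps the
    determinant and moves the first entry into the range from 0 to c - 1.\<close>
  define x y where "x = (- v) div c" and "y = (- v) mod c"
  have "c * x + y = - v" by (simp add: x_def y_def)
  moreover have "c * (u - d * x) - d * y = c * u - d * (c * x + y)" by (simp add: algebra_simps)
  ultimately have "c * (u - d * x) - d * y = c * u + d * v" by simp
  then show ?thesis using that[of "u - d * x" y] uv assms(2) by (simp add: y_def mult.commute)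
qed

text \<open>Sums \<open>m\<close> down the chain of Farey parents. The guard ensures termination,
  since \<open>parent_row\<close> is uncontrolled on rows that are not coprime; for c <= 0 it fails,
  which gives the starting value 0.\<close>

function symbol_pos :: "(int \<Rightarrow> int \<Rightarrow> real) \<Rightarrow> int \<Rightarrow> int \<Rightarrow> real" where
  "symbol_pos m c d = (if 0 \<le> fst (parent_row c d) \<and> fst (parent_row c d) < c
     then symbol_pos m (fst (parent_row c d)) (snd (parent_row c d)) + m c (fst (parent_row c d)) else 0)"
  by pat_completeness auto
termination by (relation "Wellfounded.measure (\<lambda>(m, c, d). nat c)") (auto simp: case_prod_beta)

declare symbol_pos.simps [simp del]

definition symbol :: "(int \<Rightarrow> int \<Rightarrow> real) \<Rightarrow> int \<Rightarrow> int \<Rightarrow> real" where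
  "symbol m c d = (if c < 0 then symbol_pos m (- c) (- d) else symbol_pos m c d)"

lemma symbol_pos_0: "symbol_pos m 0 d = 0"
  by (subst symbol_pos.simps) auto

lemma symbol_minus: "symbol m (- c) (- d) = symbol m c d"
  by (cases "c = 0") (auto simp: symbol_def symbol_pos_0)

lemma symbol_0: "symbol m 0 d = 0"
  by (simp add: symbol_def symbol_pos_0)

lemma symbol_parent:
  assumes "c * d' - d * c' = 1" "0 \<le> c'" "c' < (c::int)"
  shows "symbol m c d = symbol m c' d' + m c c'"
proof -
  have "symbol_pos m c d = symbol_pos m c' d' + m c c'"
    using assms parent_row_unique[OF assms] by (subst symbol_pos.simps) simp
  then show ?thesis using assms by (simp add: symbol_def)
qed

text \<open>By definition only the step to the Farey parent has the prescribed value. The Manin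
  relations \<open>S\<close> and \<open>U\<close> are what extends this to every unimodular pair of
  rows, that is, what makes the sum of \<open>m\<close> independent of the path.\<close>

lemma symbol_adjacent:
  fixes m :: "int \<Rightarrow> int \<Rightarrow> real"
  assumes S: "\<And>c d. coprime c d \<Longrightarrow> m c d = - m d (- c)"
    and U: "\<And>c d. coprime c d \<Longrightarrow> m c d + m d (d - c) + m (d - c) (- c) = 0"
    and neg: "\<And>c d. m (- c) (- d) = m c d"
    and m10: "m 1 0 = 0"
    and det: "c * d' - d * c' = 1"
  shows "symbol m c d - symbol m c' d' = m c c'"
proof -
  \<comment> \<open>The zero at (1 : 0) passes through the relations to (0 : 1) and (1 : 1). This
    settles the rows with first entry 0 or 1 or - 1, where the descent ends.\<close>
  have m01: "m 0 (- 1) = 0" "m 0 1 = 0" using S[of 1 0] neg[of 0 1] m10 by auto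
  have m10': "m (- 1) 0 = 0" using neg[of 1 0] m10 by simp
  have m11: "m 1 1 = 0" using U[of 1 1] m01 m10 by simp
  have one: "symbol m 1 d = 0" for d
    using symbol_parent[of 1 1 d 0 m] m10 by (simp add: symbol_0)
  then have one': "symbol m (- 1) d = 0" for d using symbol_minus[of m 1 "-d"] by simp
  have pos: "symbol m c d - symbol m c' d' = m c c'"
    if "c * d' - d * c' = 1" "c > 0" "c' > 0" for c d c' d'
    using that
  proof (induction "nat (c + c')" arbitrary: c d c' d' rule: less_induct)
    case less
    have cop: "coprime c c'" using det_1_coprime(2)[OF less.prems(1)] .
    consider "c' < c" | "c < c'" | "c = c'" by linarith
    then show ?case
    proof cases
      case 1
      with symbol_parent[of c d' d c' m] less.prems show ?thesis by simp
    next
      case 2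
      \<comment> \<open>The two rows and their difference form a Farey triangle. The difference is
        the parent of (c', d'), and its pair with (c, d) has a smaller sum of first entries;
        \<open>U\<close> yields the third side from these two.\<close>
      have "symbol m c' d' = symbol m (c' - c) (d' - d) + m c' (c' - c)"
        using less.prems 2 by (intro symbol_parent) (auto simp: algebra_simps)
      moreover have "symbol m c d - symbol m (c' - c) (d' - d) = m c (c' - c)"
        using less.prems 2 by (intro less.hyps) (auto simp: algebra_simps)
      moreover have "m c (c' - c) = - m (c' - c) (- c)"
        using less.prems(1) by (intro S det_1_coprime(2)[where b = d and d = "d' - d"]) (simp add: algebra_simps)
      moreover have "m c c' + m c' (c' - c) + m (c' - c) (- c) = 0" using U cop by blast
      ultimately show ?thesis by simp
    next
      case 3
      then have "c = 1" using less.prems(1,2) cop by simp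
      with 3 show ?thesis using one m11 by simp
    qed
  qed
  have same: "symbol m c d - symbol m c' d' = m c c'"
    if "c * d' - d * c' = 1" "c > 0 \<and> c' > 0 \<or> c < 0 \<and> c' < 0" for c d c' d'
  proof (cases "c > 0")
    case False
    have "symbol m (- c) (- d) - symbol m (- c') (- d') = m (- c) (- c')"
      using False that by (intro pos) auto
    then show ?thesis by (simp add: symbol_minus neg)
  qed (use that pos in auto)
  consider "c = 0" | "c' = 0" | "c > 0 \<and> c' > 0 \<or> c < 0 \<and> c' < 0" | "c > 0 \<and> c' < 0 \<or> c < 0 \<and> c' > 0"
    by linarith
  then show ?thesis
  proof cases
    case 1
    then have "\<bar>c'\<bar> = 1" using det_1_coprime(2)[OF det] by simp
    then have "c' = 1 \<or> c' = - 1" by arith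
    with 1 show ?thesis using m01 one one' by (auto simp: symbol_0)
  next
    case 2
    then have "\<bar>c\<bar> = 1" using det_1_coprime(2)[OF det] by simp
    then have "c = 1 \<or> c = - 1" by arith
    with 2 show ?thesis using m10 m10' one one' by (auto simp: symbol_0)
  next
    case 3
    with det show ?thesis by (rule same)
  next
    case 4
    \<comment> \<open>The pair (- c', - d'), (c, d) is again unimodular and now has first entries of
      equal sign; \<open>S\<close> undoes the exchange.\<close>
    have "symbol m (- c') (- d') - symbol m c d = m (- c') c"
      using 4 det by (intro same) (auto simp: algebra_simps)
    moreover have "m (- c') c = m c' (- c)" using neg[of "- c'" c] by simp
    ultimately show ?thesis using S[OF det_1_coprime(2)[OF det]] by (simp add: symbol_minus)
  qed
qed

section \<open>The projective line over a prime field\<close>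

context
  fixes p :: nat
  assumes p: "prime p"
begin

abbreviation nondegenerate :: "int \<Rightarrow> int \<Rightarrow> bool" where
  "nondegenerate c d \<equiv> \<not> (int p dvd c \<and> int p dvd d)"

definition inv_mod :: "int \<Rightarrow> int" where
  "inv_mod d = (SOME x. [d * x = 1] (mod int p))"

text \<open>
  The point \<open>(c : d)\<close> is encoded as the residue of \<open>c/d\<close>, or as \<open>p\<close> if it is the point at infinity;
  \<open>S_map\<close> and \<open>U_map\<close> are \<open>(c : d) \<mapsto> (d : - c)\<close> and \<open>(c : d) \<mapsto> (d : d - c)\<close>.
\<close>

definition proj_class :: "int \<Rightarrow> int \<Rightarrow> int" where
  "proj_class c d = (if int p dvd d then int p else (c * inv_mod d) mod int p)"

definition S_map :: "int \<Rightarrow> int" where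
  "S_map x = (if x = int p then proj_class 0 (- 1) else proj_class 1 (- x))"

definition U_map :: "int \<Rightarrow> int" where
  "U_map x = (if x = int p then proj_class 0 (- 1) else proj_class 1 (1 - x))"

lemma prime_int_p: "prime (int p)" and p_pos: "int p > 0" and p_not_dvd_1: "\<not> int p dvd 1"
  using p by (auto simp: prime_gt_0_nat)

lemma inv_mod: "\<not> int p dvd d \<Longrightarrow> [d * inv_mod d = 1] (mod int p)"
  unfolding inv_mod_def
  by (rule someI_ex, rule cong_solve_coprime_int) (metis prime_imp_coprime prime_int_p coprime_commute)

lemma coprime_nondegenerate: "coprime c d \<Longrightarrow> nondegenerate c d"
  using p_not_dvd_1 by (meson coprime_common_divisor)

lemma proj_class_less_iff: "proj_class c d < int p \<longleftrightarrow> \<not> int p dvd d"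
  using p_pos by (simp add: proj_class_def)

lemma proj_class_mem: "proj_class c d \<in> {0..int p}"
  using p_pos by (auto simp: proj_class_def intro: less_imp_le)

text \<open>Cross multiplication is the only access to the encoding in the computations below, so no
  class has to be normalised by hand.\<close>

lemma proj_class_eq_iff:
  assumes "nondegenerate c d" "nondegenerate c' d'"
  shows "proj_class c d = proj_class c' d' \<longleftrightarrow> int p dvd c * d' - c' * d"
proof (cases "int p dvd d \<or> int p dvd d'")
  case True
  then have "proj_class c d = proj_class c' d' \<longleftrightarrow> (int p dvd d \<longleftrightarrow> int p dvd d')"
    using proj_class_less_iff by (metis proj_class_def)
  moreover have "int p dvd c * d' - c' * d \<longleftrightarrow> (int p dvd d \<longleftrightarrow> int p dvd d')"
  proof (cases "int p dvd d")
    case True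
    then have "int p dvd c * d' - c' * d \<longleftrightarrow> int p dvd c * d'"
      using dvd_add_left_iff[of "int p" "- (c' * d)" "c * d'"] by simp
    then show ?thesis using True assms prime_dvd_mult_iff[OF prime_int_p] by simp
  next
    case False
    then have d': "int p dvd d'" using \<open>int p dvd d \<or> int p dvd d'\<close> by simp
    then have "int p dvd c * d' - c' * d \<longleftrightarrow> int p dvd - (c' * d)"
      using dvd_add_right_iff[of "int p" "c * d'" "- (c' * d)"] by simp
    then show ?thesis using False d' assms prime_dvd_mult_iff[OF prime_int_p] by simp
  qed
  ultimately show ?thesis by simp
next
  case False
  then have i: "[d * inv_mod d = 1] (mod int p)" "[d' * inv_mod d' = 1] (mod int p)"
    using inv_mod by auto
  have 1: "proj_class c d = proj_class c' d' \<longleftrightarrow> [c * inv_mod d = c' * inv_mod d'] (mod int p)"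
    using False by (simp add: proj_class_def cong_def)
  have "[c * d' = c' * d] (mod int p)" if "[c * inv_mod d = c' * inv_mod d'] (mod int p)"
  proof -
    have "[c * d' = c * d' * (d * inv_mod d)] (mod int p)"
      using cong_scalar_left[OF i(1), of "c * d'"] by (simp add: cong_sym)
    also have "c * d' * (d * inv_mod d) = d * d' * (c * inv_mod d)" by simp
    also have "[d * d' * (c * inv_mod d) = d * d' * (c' * inv_mod d')] (mod int p)"
      using that by (rule cong_scalar_left)
    also have "d * d' * (c' * inv_mod d') = c' * d * (d' * inv_mod d')" by simp
    also have "[c' * d * (d' * inv_mod d') = c' * d] (mod int p)"
      using cong_scalar_left[OF i(2), of "c' * d"] by simp
    finally show ?thesis .
  qed
  moreover have "[c * inv_mod d = c' * inv_mod d'] (mod int p)" if "[c * d' = c' * d] (mod int p)"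
  proof -
    have "[c * inv_mod d = c * inv_mod d * (d' * inv_mod d')] (mod int p)"
      using cong_scalar_left[OF i(2), of "c * inv_mod d"] by (simp add: cong_sym)
    also have "c * inv_mod d * (d' * inv_mod d') = inv_mod d * inv_mod d' * (c * d')" by simp
    also have "[inv_mod d * inv_mod d' * (c * d') = inv_mod d * inv_mod d' * (c' * d)] (mod int p)"
      using that by (rule cong_scalar_left)
    also have "inv_mod d * inv_mod d' * (c' * d) = c' * inv_mod d' * (d * inv_mod d)" by simp
    also have "[c' * inv_mod d' * (d * inv_mod d) = c' * inv_mod d'] (mod int p)"
      using cong_scalar_left[OF i(1), of "c' * inv_mod d'"] by simp
    finally show ?thesis .
  qed
  ultimately show ?thesis using 1 by (auto simp: cong_iff_dvd_diff)
qed

lemma proj_class_minus: "proj_class (- c) (- d) = proj_class c d"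
proof (cases "int p dvd d")
  case False
  then show ?thesis by (subst proj_class_eq_iff) auto
qed (simp add: proj_class_def)

text \<open>\<open>S_map\<close> and \<open>U_map\<close> are defined through the representatives
  (1, 0) and (x, 1), for which the formulas hold directly; the next two lemmas transfer them to
  arbitrary representatives.\<close>

lemma proj_class_rep:
  assumes "x \<in> {0..int p}"
  obtains c d where "nondegenerate c d" "x = proj_class c d"
    "S_map x = proj_class d (- c)" "U_map x = proj_class d (d - c)"
    "c = (if x = int p then 1 else x)" "d = (if x = int p then 0 else 1)"
proof (cases "x = int p")
  case True
  then show ?thesis using that[of 1 0] p_not_dvd_1 
    by (simp add: proj_class_def[of _ 0] S_map_def U_map_def)
next
  case False
  have "[1 * inv_mod 1 = 1] (mod int p)" by (rule inv_mod) (rule p_not_dvd_1)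
  then have "[x * inv_mod 1 = x] (mod int p)" using cong_scalar_left[of "inv_mod 1" 1 "int p" x] by simp
  then have "x = proj_class x 1"
    using False assms p_not_dvd_1 by (simp add: proj_class_def cong_def)
  then show ?thesis using that[of x 1] p_not_dvd_1 False by (simp add: S_map_def U_map_def)
qed

text \<open>Independence of the representative: the linear map has determinant 1, so it preserves
  the cross product of two rows and hence equality of classes. The same argument serves
  \<open>U_map\<close>.\<close>

lemma S_map_class: 
  assumes "nondegenerate c d" shows "S_map (proj_class c d) = proj_class d (- c)"
proof -
  obtain x y where xy: "nondegenerate x y" "proj_class c d = proj_class x y"
    "S_map (proj_class c d) = proj_class y (- x)"
    using proj_class_rep[OF proj_class_mem, of c d] by metis
  have "int p dvd c * y - x * d" using xy(2) proj_class_eq_iff[OF assms xy(1)] by simp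
  then have "int p dvd y * (- c) - d * (- x)" by (simp add: dvd_diff_commute algebra_simps)
  then show ?thesis using xy(3) proj_class_eq_iff[of y "-x" d "-c"] assms xy(1) by auto
qed

lemma U_map_class: 
  assumes "nondegenerate c d" shows "U_map (proj_class c d) = proj_class d (d - c)"
proof -
  obtain x y where xy: "nondegenerate x y" "proj_class c d = proj_class x y"
    "U_map (proj_class c d) = proj_class y (y - x)"
    using proj_class_rep[OF proj_class_mem, of c d] by metis
  have "int p dvd c * y - x * d" using xy(2) proj_class_eq_iff[OF assms xy(1)] by simp
  then have "int p dvd y * (d - c) - d * (y - x)" by (simp add: dvd_diff_commute algebra_simps)
  moreover have "nondegenerate d (d - c)" "nondegenerate y (y - x)"
    using assms xy(1) dvd_diff[of "int p" d "d - c"] dvd_diff[of "int p" y "y - x"] by auto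
  ultimately show ?thesis using xy(3) proj_class_eq_iff[of y "y - x" d "d - c"] by simp
qed

text \<open>On coordinates the square of S is minus the identity, and so is the cube of U in the
  next lemma; a sign does not change the class.\<close>

lemma S_map_involution: assumes "x \<in> {0..int p}" shows "S_map (S_map x) = x"
proof -
  obtain c d where cd: "nondegenerate c d" "x = proj_class c d" using assms proj_class_rep by metis
  then have "nondegenerate d (- c)" by auto
  then show ?thesis using cd S_map_class[OF cd(1)] S_map_class[of d "- c"] by (simp add: proj_class_minus)
qed

lemma U_map_order_3: assumes "x \<in> {0..int p}" shows "U_map (U_map (U_map x)) = x"
proof -
  obtain c d where cd: "nondegenerate c d" "x = proj_class c d" using assms proj_class_rep by metis
  then have n: "nondegenerate d (d - c)" "nondegenerate (d - c) (- c)"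
    using dvd_diff[of "int p" d "d - c"] dvd_diff[of "int p" "d - c" "- c"] by auto
  show ?thesis using cd U_map_class[OF cd(1)] U_map_class[OF n(1)] U_map_class[OF n(2)] 
    by (simp add: proj_class_minus)
qed

text \<open>Subtracting the equations of two roots leaves the factors x - y and x + y + b, so
  besides y only the residue of - b - y remains.\<close>

lemma card_quadratic_roots: "card {x \<in> {0..<int p}. int p dvd x\<^sup>2 + b * x + 1} \<le> 2" (is "card ?R \<le> 2")
proof (cases "?R = {}")
  case False
  then obtain y where y: "y \<in> ?R" by blast
  have "?R \<subseteq> {y, (- b - y) mod int p}"
  proof
    fix x assume x: "x \<in> ?R"
    have "int p dvd (x\<^sup>2 + b * x + 1) - (y\<^sup>2 + b * y + 1)" using x y by (intro dvd_diff) auto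
    also have "\<dots> = (x - y) * (x + y + b)" by (simp add: algebra_simps power2_eq_square)
    finally consider "int p dvd x - y" | "int p dvd x + y + b"
      using prime_int_p prime_dvd_mult_iff by blast
    then show "x \<in> {y, (- b - y) mod int p}"
    proof cases
      case 1
      then have "x mod int p = y mod int p" by (simp add: mod_eq_dvd_iff)
      then show ?thesis using x y by simp
    next
      case 2
      then have "x mod int p = (- b - y) mod int p" by (simp add: mod_eq_dvd_iff algebra_simps)
      then show ?thesis using x by simp
    qed
  qed
  then have "card ?R \<le> card {y, (- b - y) mod int p}" by (intro card_mono) auto
  also have "\<dots> \<le> 2" by (simp add: card_insert_if)
  finally show ?thesis .
next
  case True
  then show ?thesis by (metis card.empty zero_le)
qed

text \<open>A finite fixed point of S solves x^2 + 1 = 0, one of U solves x^2 - x + 1 = 0. Infinity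
  is fixed by neither, since there the condition reads p dvd 1.\<close>

lemma card_fixpoints: 
  "card {x \<in> {0..int p}. S_map x = x} \<le> 2" "card {x \<in> {0..int p}. U_map x = x} \<le> 2"
proof -
  have 1: "x < int p \<and> int p dvd x\<^sup>2 + 0 * x + 1" if x: "x \<in> {0..int p}" and fx: "S_map x = x" for x
  proof -
    obtain c d where cd: "nondegenerate c d" "x = proj_class c d" "S_map x = proj_class d (- c)"
       "U_map x = proj_class d (d - c)" "c = (if x = int p then 1 else x)" "d = (if x = int p then 0 else 1)"
      using proj_class_rep[OF x] .
    have "int p dvd d * d - c * - c" using proj_class_eq_iff[of d "-c" c d] cd(1-4) fx by auto
    then show ?thesis using cd(5,6) p_not_dvd_1 x by (auto split: if_splits simp: power2_eq_square add.commute)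
  qed
  have 2: "x < int p \<and> int p dvd x\<^sup>2 + (-1) * x + 1" if x: "x \<in> {0..int p}" and fx: "U_map x = x" for x
  proof -
    obtain c d where cd: "nondegenerate c d" "x = proj_class c d" "S_map x = proj_class d (- c)"
       "U_map x = proj_class d (d - c)" "c = (if x = int p then 1 else x)" "d = (if x = int p then 0 else 1)"
      using proj_class_rep[OF x] .
    have "nondegenerate d (d - c)" using cd(1) dvd_diff[of "int p" d "d - c"] by auto
    then have "int p dvd d * d - c * (d - c)" using proj_class_eq_iff[of d "d - c" c d] cd(1-4) fx by auto
    then show ?thesis using cd(5,6) p_not_dvd_1 x by (auto split: if_splits simp: power2_eq_square algebra_simps)
  qed
  have "card {x \<in> {0..int p}. S_map x = x} \<le> card {x \<in> {0..<int p}. int p dvd x\<^sup>2 + 0 * x + 1}"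
    using 1 by (intro card_mono finite_subset[OF _ finite_atLeastLessThan_int[of 0 "int p"]]) auto
  then show "card {x \<in> {0..int p}. S_map x = x} \<le> 2" using card_quadratic_roots[of 0] by linarith
  have "card {x \<in> {0..int p}. U_map x = x} \<le> card {x \<in> {0..<int p}. int p dvd x\<^sup>2 + (-1) * x + 1}"
    using 2 by (intro card_mono finite_subset[OF _ finite_atLeastLessThan_int[of 0 "int p"]]) auto
  then show "card {x \<in> {0..int p}. U_map x = x} \<le> 2" using card_quadratic_roots[of "-1"] by linarith
qed

end

lemma card_pairs_le: "2 * card {(q, d). 1 \<le> d \<and> d < q \<and> q \<le> (Q::nat)} \<le> Q * Q"
proof -
  have "{(q, d). 1 \<le> d \<and> d < q \<and> q \<le> Q} = (SIGMA q:{..Q}. {1..<q})" by auto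
  then have "card {(q, d). 1 \<le> d \<and> d < q \<and> q \<le> Q} = (\<Sum>q\<le>Q. q - 1)" by simp
  moreover have "2 * (\<Sum>q\<le>Q. q - 1) \<le> Q * Q" by (induction Q) (auto simp: algebra_simps)
  ultimately show ?thesis by simp
qed

lemma exists_manin_symbol:
  assumes "prime p" "3 * Q\<^sup>2 + 24 \<le> p"
  obtains M :: "int \<Rightarrow> real" where "\<exists>x\<in>{0..int p}. M x \<noteq> 0"
    "\<forall>x\<in>{0..int p}. M x + M (S_map p x) = 0"
    "\<forall>x\<in>{0..int p}. M x + M (U_map p x) + M (U_map p (U_map p x)) = 0"
    "M (int p) = 0"
    "\<forall>q d. 1 \<le> d \<longrightarrow> d < q \<longrightarrow> q \<le> Q \<longrightarrow> M (proj_class p (int q) (int d)) = 0"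
proof -
  let ?X = "{0..int p}"
  let ?S = "S_map p" and ?U = "U_map p"
  define F\<^sub>S where "F\<^sub>S = (\<lambda>x. {x, ?S x}) ` ?X"
  define F\<^sub>U where "F\<^sub>U = (\<lambda>x. {x, ?U x, ?U (?U x)}) ` ?X"
  define D where "D = {(q, d). 1 \<le> d \<and> d < q \<and> q \<le> Q}"
  define F\<^sub>Q where "F\<^sub>Q = (\<lambda>(q, d). {proj_class p (int q) (int d)}) ` D"
  define F where "F = F\<^sub>S \<union> F\<^sub>U \<union> F\<^sub>Q \<union> {{int p}}"
  have SX: "?S x \<in> ?X" and UX: "?U x \<in> ?X" for x
    using proj_class_mem[OF assms(1)] by (simp_all only: S_map_def[OF assms(1)] U_map_def[OF assms(1)] split: if_split) blast+
  have "2 * card F\<^sub>S \<le> card ?X + card {x \<in> ?X. ?S x = x}"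
    unfolding F\<^sub>S_def by (rule card_involution_orbits) (use SX S_map_involution[OF assms(1)] in auto)
  then have S: "2 * card F\<^sub>S \<le> p + 3" using card_fixpoints(1)[OF assms(1)] by simp
  have "3 * card F\<^sub>U \<le> card ?X + 2 * card {x \<in> ?X. ?U x = x}"
    unfolding F\<^sub>U_def by (rule card_order_3_orbits) (use UX U_map_order_3[OF assms(1)] in auto)
  then have U: "3 * card F\<^sub>U \<le> p + 5" using card_fixpoints(2)[OF assms(1)] by simp
  have fD: "finite D" unfolding D_def by (rule finite_subset[of _ "{..Q} \<times> {..Q}"]) auto
  have "card F\<^sub>Q \<le> card D" unfolding F\<^sub>Q_def by (rule card_image_le[OF fD])
  then have Q: "2 * card F\<^sub>Q \<le> Q * Q" using card_pairs_le[of Q] by (simp add: D_def)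
  have "card F \<le> card F\<^sub>S + card F\<^sub>U + card F\<^sub>Q + card {{int p}}"
    unfolding F_def by (meson add_le_mono card_Un_le le_trans order_refl)
  \<comment> \<open>The orbit counts have common denominator 6; the total 5 p + 25 + 3 Q^2 stays
    below 6 p + 6 because 3 Q^2 + 24 <= p.\<close>
  then have "6 * card F \<le> 3 * (p + 3) + 2 * (p + 5) + 3 * (Q * Q) + 6" using S U Q by simp
  also have "\<dots> < 6 * (p + 1)" using assms(2) by (simp add: power2_eq_square)
  finally have "card F < card ?X" by simp
  moreover have "F \<subseteq> Pow ?X"
    using SX UX proj_class_mem[OF assms(1)] unfolding F_def F\<^sub>S_def F\<^sub>U_def F\<^sub>Q_def by auto
  ultimately obtain M :: "int \<Rightarrow> real" where M: "\<exists>x\<in>?X. M x \<noteq> 0" "\<forall>A\<in>F. sum M A = 0"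
    using zero_sums_nontrivial[of ?X F] finite_atLeastAtMost_int by metis
  \<comment> \<open>At a fixed point the orbit is a singleton and its equation reads M x = 0, which
    still implies the Manin relation with its repeated terms. The same holds for
    \<open>?U\<close>.\<close>
  have 1: "M x + M (?S x) = 0" if "x \<in> ?X" for x
  proof -
    have "sum M {x, ?S x} = 0" using that by (intro M(2)[rule_format]) (simp add: F_def F\<^sub>S_def)
    then show ?thesis by (cases "?S x = x") (simp_all add: insert_absorb2)
  qed
  have 2: "M x + M (?U x) + M (?U (?U x)) = 0" if "x \<in> ?X" for x
  proof -
    have s: "sum M {x, ?U x, ?U (?U x)} = 0" using that by (intro M(2)[rule_format]) (simp add: F_def F\<^sub>U_def)
    have o: "?U (?U (?U x)) = x" using U_map_order_3[OF assms(1) that] .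
    show ?thesis
    proof (cases "?U x = x")
      case False
      then have "?U (?U x) \<noteq> x" "?U (?U x) \<noteq> ?U x" using o by auto
      with False s show ?thesis by simp
    qed (use s in simp)
  qed
  have 3: "sum M {int p} = 0" by (intro M(2)[rule_format]) (simp add: F_def)
  have 4: "M (proj_class p (int q) (int d)) = 0" if "1 \<le> d" "d < q" "q \<le> Q" for q d
  proof -
    have "sum M {proj_class p (int q) (int d)} = 0"
      using that by (intro M(2)[rule_format]) (auto simp: F_def F\<^sub>Q_def D_def)
    then show ?thesis by simp
  qed
  show ?thesis by (rule that[of M]) (use M(1) 1 2 3 4 in auto)
qed

lemma det_mult:
  fixes a b c d x y x' y' :: int
  shows "(x * a + y * c) * (x' * b + y' * d) - (x * b + y * d) * (x' * a + y' * c)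
    = (a * d - b * c) * (x * y' - y * x')"
  by (simp add: algebra_simps)

text \<open>
  Rows \<open>(c, d)\<close> stand for the cusps \<open>- d / c\<close>, and \<open>H c d\<close> is the integral of the modular symbol
  from infinity to that cusp; the second property says that \<open>\<gamma> \<mapsto> H (0, 1)\<gamma>\<close> is a homomorphism on
  \<open>\<Gamma>\<^sub>0(p)\<close>.
\<close>

lemma exists_cusp_integral:
  assumes "prime p" "3 * Q\<^sup>2 + 24 \<le> p" "Q \<ge> 1"
  obtains H :: "int \<Rightarrow> int \<Rightarrow> real" where
    "\<And>c d. H (- c) (- d) = H c d"
    "\<And>a b c d x y. a * d - b * c = 1 \<Longrightarrow> int p dvd c \<Longrightarrow> coprime x y \<Longrightarrow>
       H (x * a + y * c) (x * b + y * d) = H x y + H c d"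
    "\<And>a b c d. a * d - b * c = 1 \<Longrightarrow> int p dvd c \<Longrightarrow> 1 \<le> d \<Longrightarrow> d \<le> int Q \<Longrightarrow> H c d = 0"
    "\<exists>a b c d. a * d - b * c = 1 \<and> int p dvd c \<and> H c d \<noteq> 0"
proof -
  note p = assms(1)
  obtain M :: "int \<Rightarrow> real" where M: "\<exists>x\<in>{0..int p}. M x \<noteq> 0"
    "\<forall>x\<in>{0..int p}. M x + M (S_map p x) = 0"
    "\<forall>x\<in>{0..int p}. M x + M (U_map p x) + M (U_map p (U_map p x)) = 0"
    "M (int p) = 0"
    "\<forall>q d. 1 \<le> d \<longrightarrow> d < q \<longrightarrow> q \<le> Q \<longrightarrow> M (proj_class p (int q) (int d)) = 0"
    using exists_manin_symbol[OF assms(1,2)] by blast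
  define m where "m c d = M (proj_class p c d)" for c d
  have m_p: "m c d = 0" if "int p dvd d" for c d
    using that M(4) by (simp add: m_def proj_class_def[OF p])
  have S: "m c d = - m d (- c)" if "coprime c d" for c d
    using M(2)[rule_format, OF proj_class_mem[OF p], of c d] S_map_class[OF p coprime_nondegenerate[OF p that]]
    by (simp add: m_def)
  have U: "m c d + m d (d - c) + m (d - c) (- c) = 0" if "coprime c d" for c d
  proof -
    have "coprime d (d - c)" using that
      by (simp add: coprime_iff_gcd_eq_1 gcd.commute[of d] gcd_diff2)
    then show ?thesis
      using M(3)[rule_format, OF proj_class_mem[OF p], of c d] U_map_class[OF p coprime_nondegenerate[OF p that]]
        U_map_class[OF p coprime_nondegenerate[OF p], of d "d - c"]
      by (simp add: m_def)
  qed
  have neg: "m (- c) (- d) = m c d" for c d by (simp add: m_def proj_class_minus[OF p])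
  have m10: "m 1 0 = 0" by (rule m_p) simp
  define H where "H = symbol m"
  have adj: "H c d - H c' d' = m c c'" if "c * d' - d * c' = 1" for c d c' d'
    unfolding H_def using S U neg m10 that by (rule symbol_adjacent)
  have H_minus: "H (- c) (- d) = H c d" for c d unfolding H_def by (rule symbol_minus)
  have H_0: "H 0 d = 0" for d unfolding H_def by (rule symbol_0)
  have m_eq: "m c d = m c' d'" if "coprime c d" "coprime c' d'" "int p dvd c * d' - c' * d" for c d c' d'
    using that proj_class_eq_iff[OF p coprime_nondegenerate[OF p] coprime_nondegenerate[OF p], of c d c' d']
    by (simp add: m_def)
  have hom: "H (x * a + y * c) (x * b + y * d) = H x y + H c d"
    if det: "a * d - b * c = 1" and c: "int p dvd c" and "coprime x y" for a b c d x y
    using \<open>coprime x y\<close>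
  proof (induction "nat \<bar>x\<bar>" arbitrary: x y rule: less_induct)
    case less
    \<comment> \<open>The induction hypothesis is carried by a separate \<open>x0\<close>, so that
      one argument serves both x and - x.\<close>
    have pos: "H (x * a + y * c) (x * b + y * d) = H x y + H c d"
      if x: "x > 0" and xy: "coprime x y" and x_le: "\<bar>x\<bar> \<le> \<bar>x0\<bar>" and x0: "\<And>z w. nat \<bar>z\<bar> < nat \<bar>x0\<bar> \<Longrightarrow> coprime z w \<Longrightarrow>
        H (z * a + w * c) (z * b + w * d) = H z w + H c d" for x y x0
    proof -
      obtain x' y' where x': "x * y' - y * x' = 1" "0 \<le> x'" "x' < x"
        using parent_row_exists[OF xy x] by blast
      have det': "(x * a + y * c) * (x' * b + y' * d) - (x * b + y * d) * (x' * a + y' * c) = 1"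
        unfolding det_mult det x'(1) by simp
      \<comment> \<open>Since p divides c, the matrix multiplies first entries by a modulo p. The
        class (x : x') is therefore unchanged, and both Farey chains have equal increments.\<close>
      have "(x * a + y * c) * x' - x * (x' * a + y' * c) = c * (y * x' - x * y')" by (simp add: algebra_simps)
      then have "m (x * a + y * c) (x' * a + y' * c) = m x x'"
        using c by (intro m_eq det_1_coprime(2)[OF det'] det_1_coprime(2)[OF x'(1)]) (simp only: dvd_mult2)
      moreover have "H (x' * a + y' * c) (x' * b + y' * d) = H x' y' + H c d"
        using x' x_le by (intro x0 det_1_coprime(4)[OF x'(1)]) auto
      ultimately show ?thesis using adj[OF det'] adj[OF x'(1)] by linarith
    qed
    consider "x = 0" | "x > 0" | "x < 0" by linarith
    then show ?case
    proof cases
      case 1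
      then have "\<bar>y\<bar> = 1" using less.prems by simp
      then have "y = 1 \<or> y = - 1" by arith
      then show ?thesis using 1 by (elim disjE) (simp_all add: H_minus H_0)
    next
      case 2
      show ?thesis by (rule pos[OF 2 less.prems, of x]) (use less.hyps in auto)
    next
      case 3
      have "H (- x * a + - y * c) (- x * b + - y * d) = H (- x) (- y) + H c d"
        by (rule pos[of "- x" "- y" x]) (use 3 less.prems less.hyps in auto)
      moreover have "- x * a + - y * c = - (x * a + y * c)" "- x * b + - y * d = - (x * b + y * d)"
        by simp_all
      ultimately have "H (- (x * a + y * c)) (- (x * b + y * d)) = H (- x) (- y) + H c d" by (simp only:)
      then show ?thesis unfolding H_minus .
    qed
  qed
  \<comment> \<open>The Farey chain of such a row uses only first entries up to Q, so each increment
    is one of the killed values of \<open>M\<close> or the value at infinity.\<close>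
  have small: "H d b = 0" if "coprime d b" "1 \<le> d" "d \<le> int Q" for d b
    using that
  proof (induction "nat d" arbitrary: d b rule: less_induct)
    case less
    obtain d' b' where d': "d * b' - b * d' = 1" "0 \<le> d'" "d' < d"
      using parent_row_exists[of d b] less.prems by (metis zero_less_one order_less_le_trans)
    have "m d d' = 0"
    proof (cases "d' = 0")
      case False
      then show ?thesis using M(5)[rule_format, of "nat d'" "nat d"] d' less.prems by (simp add: m_def)
    qed (simp add: m_p)
    moreover have "H d' b' = 0"
    proof (cases "d' = 0")
      case False
      then show ?thesis using less.hyps[of d' b'] d' less.prems det_1_coprime(4)[OF d'(1)] by simp
    qed (simp add: H_0)
    ultimately show ?case using adj[OF d'(1)] by simp
  qed
  have zero: "H c d = 0" if det: "a * d - b * c = 1" and c: "int p dvd c" and d: "1 \<le> d" "d \<le> int Q" for a b c d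
  proof -
    \<comment> \<open>(- c, a) is the bottom row of the inverse matrix, so its value is - H c d. Its
      neighbour (d, - b) differs from it by m d (- c) = 0, as p divides c, and has first entry at
      most Q.\<close>
    have "- c * a + a * c = 0" "- c * b + a * d = 1" using det by (simp_all add: mult.commute)
    moreover have "coprime (- c) a" using det_1_coprime(2)[OF det] by (simp add: coprime_commute)
    ultimately have "H 0 1 = H (- c) a + H c d" using hom[OF det c, of "- c" a] by metis
    moreover have "H d (- b) - H (- c) a = m d (- c)" using det by (intro adj) (simp add: algebra_simps)
    moreover have "m d (- c) = 0" using c by (intro m_p) simp
    moreover have "H d (- b) = 0"
      using d det_1_coprime(3)[OF det] by (intro small) (simp_all add: coprime_commute)
    ultimately show ?thesis using H_0 by simp
  qed
  have nonzero: "\<exists>a b c d. a * d - b * c = 1 \<and> int p dvd c \<and> H c d \<noteq> 0"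
  proof -
    obtain x where x: "x \<in> {0..int p}" "M x \<noteq> 0" using M(1) by blast
    obtain c d where cd: "nondegenerate p c d" "x = proj_class p c d" "S_map p x = proj_class p d (- c)"
      "U_map p x = proj_class p d (d - c)" "c = (if x = int p then 1 else x)" "d = (if x = int p then 0 else 1)"
      using proj_class_rep[OF p x(1)] .
    have "x \<noteq> int p" using x(2) M(4) by metis
    then have c: "c = x" and d: "d = 1" using cd(5,6) by simp_all
    have "M (proj_class p c d) \<noteq> 0" using x(2) cd(2) by (rule subst[of x _ "\<lambda>x. M x \<noteq> 0", rotated])
    then have mx: "m x 1 \<noteq> 0" unfolding m_def c d .
    \<comment> \<open>x has to be invertible modulo p; the class 0 is excluded because it is the
      S-image of infinity, where \<open>M\<close> vanishes.\<close>
    have "m 0 1 = - m 1 0" using S[of 0 1] by simp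
    then have "m 0 1 = 0" using m10 by simp
    then have "x \<noteq> 0" using mx by metis
    then have "\<not> int p dvd x" using x(1) \<open>x \<noteq> int p\<close> by (intro zdvd_not_zless) auto
    then have "gcd x (int p) = 1"
      using prime_imp_coprime[OF prime_int_p[OF p]] by (simp add: coprime_iff_gcd_eq_1 gcd.commute)
    then obtain u v where uv: "x * u + int p * v = 1"
      using bezout_int[of x "int p"] by (metis mult.commute)
    \<comment> \<open>Unimodular path (0, 1), (1, 0), (x, - 1), (p v, u): only the middle step
      contributes, namely M x. Its end is the bottom row of a matrix with lower left entry divisible
      by p.\<close>
    have "H 1 0 - H 0 1 = m 1 0" by (rule adj) simp
    moreover have "H x (- 1) - H 1 0 = m x 1" by (rule adj) simp
    moreover have "H x (- 1) - H (int p * v) u = m x (int p * v)" using uv by (intro adj) simp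
    moreover have "m x (int p * v) = 0" by (rule m_p) simp
    ultimately have "H (int p * v) u \<noteq> 0" using m10 H_0 mx by simp
    moreover have "x * u - (- 1) * (int p * v) = 1" using uv by simp
    ultimately show ?thesis by (metis dvd_triv_left)
  qed
  show ?thesis by (rule that[of H, OF H_minus hom zero nonzero])
qed

section \<open>Dirichlet characters and Gauss sums\<close>

lemma e_add: "e (z + w) = e z * e w"
  by (simp add: e_def distrib_left exp_add)

lemma e_of_nat_mult: "e (of_nat n * z) = e z ^ n"
  by (simp add: e_def exp_of_nat_mult[symmetric] mult.left_commute)

lemma e_eq_1_iff: "e z = 1 \<longleftrightarrow> (\<exists>n::int. z = of_int n)"
proof -
  have "e z = 1 \<longleftrightarrow> (\<exists>n::int. Im z = 0 \<and> Re z = of_int n)"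
    by (auto simp: e_def exp_eq_1)
  then show ?thesis by (simp add: complex_eq_iff conj_commute)
qed

lemma e_of_int: "e (of_int n) = 1"
  using e_eq_1_iff by blast

lemma norm_e: "cmod (e z) = exp (- 2 * pi * Im z)"
  by (simp add: e_def norm_exp_eq_Re)

lemma e_nonzero: "e z \<noteq> 0"
  by (simp add: e_def)

lemma e_divide_cong:
  assumes "[x = y] (mod int q)" "q > 0"
  shows "e (of_int x / of_nat q) = e (of_int y / of_nat q)"
proof -
  obtain t where "x - y = int q * t" using assms(1) by (auto simp: cong_iff_dvd_diff elim: dvdE)
  then have t: "x = y + int q * t" by simp
  have "(of_int x / of_nat q :: complex) = of_int y / of_nat q + of_int t"
    using assms(2) unfolding t by (simp add: add_divide_distrib)
  then show ?thesis by (simp add: e_add e_of_int)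
qed

lemma sum_e_eq:
  assumes "q > 0"
  shows "(\<Sum>u<q. e (of_int x * of_nat u / of_nat q)) = (if int q dvd x then of_nat q else 0)"
proof -
  define w where "w = e (of_int x / of_nat q)"
  have pow: "e (of_int x * of_nat u / of_nat q) = w ^ u" for u
    unfolding w_def e_of_nat_mult[symmetric] by (simp add: mult.commute)
  have w1: "w = 1 \<longleftrightarrow> int q dvd x"
  proof
    assume "w = 1"
    then obtain n :: int where "(of_int x / of_nat q :: complex) = of_int n"
      unfolding w_def e_eq_1_iff by blast
    then have "(of_int x :: complex) = of_int n * of_int (int q)" using assms by (simp add: field_simps)
    then have "(of_int x :: complex) = of_int (n * int q)" by (simp only: of_int_mult)
    then have "x = n * int q" by (simp only: of_int_eq_iff)
    then show "int q dvd x" by simp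
  next
    assume "int q dvd x"
    then obtain n where "x = int q * n" by (elim dvdE)
    then show "w = 1" using assms by (simp add: w_def e_of_int)
  qed
  have "w ^ q = 1" using assms by (simp add: w_def e_of_nat_mult[symmetric] e_of_int)
  then show ?thesis using w1 geometric_sum[of w q] by (cases "w = 1") (auto simp: pow)
qed

lemma sum_residues_mult:
  fixes F :: "int \<Rightarrow> 'a::comm_monoid_add"
  assumes "q > 0" "coprime n (int q)" "\<And>x y. [x = y] (mod int q) \<Longrightarrow> F x = F y"
  shows "(\<Sum>u<q. F (n * int u)) = (\<Sum>u<q. F (int u))"
proof -
  define f where "f u = nat ((n * int u) mod int q)" for u
  have f: "int (f u) = (n * int u) mod int q" for u using assms(1) by (simp add: f_def)
  have into: "f ` {..<q} \<subseteq> {..<q}"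
  proof
    fix v assume "v \<in> f ` {..<q}"
    then obtain u where "v = f u" by blast
    then have "int v < int q" using f[of u] assms(1) by simp
    then show "v \<in> {..<q}" by simp
  qed
  have inj: "inj_on f {..<q}"
  proof (rule inj_onI)
    fix u v assume uv: "u \<in> {..<q}" "v \<in> {..<q}" "f u = f v"
    then have "[n * int u = n * int v] (mod int q)" using f by (metis cong_def)
    then have "[int u = int v] (mod int q)"
      using assms(2) by (simp add: cong_mult_lcancel)
    then show "u = v" using uv by (simp add: cong_def zmod_int[symmetric] of_nat_mod[symmetric])
  qed
  have "bij_betw f {..<q} {..<q}" using endo_inj_surj[OF _ into inj] inj by (simp add: bij_betw_def)
  then have "(\<Sum>u<q. F (int (f u))) = (\<Sum>u<q. F (int u))"
    by (rule sum.reindex_bij_betw)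
  moreover have "F (int (f u)) = F (n * int u)" for u
    unfolding f by (rule assms(3)) (simp add: cong_def)
  ultimately show ?thesis by simp
qed

context
  fixes q :: nat and \<psi> :: "int \<Rightarrow> complex"
  assumes psi: "dirichlet_character q \<psi>"
begin

lemma character_pos: "q > 0" and character_cong: "[m = n] (mod int q) \<Longrightarrow> \<psi> m = \<psi> n"
  and character_mult: "\<psi> (m * n) = \<psi> m * \<psi> n"
  and character_nonzero_iff: "\<psi> n \<noteq> 0 \<longleftrightarrow> coprime n (int q)"
  using psi unfolding dirichlet_character_def by blast+

lemma character_1: "\<psi> 1 = 1"
proof -
  have "\<psi> 1 * \<psi> 1 = \<psi> 1" using character_mult[of 1 1] by simp
  moreover have "\<psi> 1 \<noteq> 0" using character_nonzero_iff by simp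
  ultimately show ?thesis by simp
qed

lemma character_power: "\<psi> (n ^ j) = \<psi> n ^ j"
  by (induction j) (simp_all add: character_1 character_mult)

lemma character_power_totient:
  assumes "coprime n (int q)"
  shows "\<psi> n ^ totient q = 1"
proof -
  define m where "m = nat (n mod int q)"
  have m: "int m = n mod int q" using character_pos by (simp add: m_def)
  then have eq: "\<psi> n = \<psi> (int m)" by (intro character_cong) (simp add: cong_def)
  have "coprime (int m) (int q)" using assms character_nonzero_iff eq by metis
  then have "[m ^ totient q = 1] (mod q)" by (intro euler_theorem) simp
  then have "[int (m ^ totient q) = int 1] (mod int q)" by (simp only: cong_int_iff)
  then have "[int m ^ totient q = 1] (mod int q)" by simp
  then show ?thesis unfolding eq
    using character_cong[of "int m ^ totient q" 1] by (simp add: character_power character_1)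
qed

lemma norm_character:
  assumes "coprime n (int q)"
  shows "cmod (\<psi> n) = 1"
proof -
  have "cmod (\<psi> n) ^ totient q = 1" by (metis character_power_totient[OF assms] norm_power norm_one)
  moreover have "totient q > 0" using character_pos by simp
  ultimately show ?thesis
    by (metis norm_ge_zero power_eq_imp_eq_base power_one zero_le_one)
qed

lemma norm_character_le: "cmod (\<psi> n) \<le> 1"
  using norm_character[of n] character_nonzero_iff[of n] by (cases "coprime n (int q)") auto

lemma character_cnj_mult: 
  assumes "coprime n (int q)" shows "\<psi> n * cnj (\<psi> n) = 1"
  using norm_character[OF assms] complex_norm_square[of "\<psi> n"] by simp

lemma character_cnj: "dirichlet_character q (\<lambda>n. cnj (\<psi> n))"
  using psi unfolding dirichlet_character_def by (metis complex_cnj_mult complex_cnj_zero_iff)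

lemma character_minus_1: "\<psi> (- 1) = 1 \<or> \<psi> (- 1) = - 1"
proof -
  have "\<psi> (- 1) * \<psi> (- 1) = 1" using character_mult[of "- 1" "- 1"] by (simp add: character_1)
  then show ?thesis by (simp add: square_eq_1_iff)
qed

end

lemma primitive_cnj:
  assumes "primitive_character q \<psi>" shows "primitive_character q (\<lambda>n. cnj (\<psi> n))"
proof -
  have "induced_from q \<psi> d" if ind: "induced_from q (\<lambda>n. cnj (\<psi> n)) d" for d
  proof -
    obtain \<psi>' where "dirichlet_character d \<psi>'" "\<forall>n. coprime n (int q) \<longrightarrow> cnj (\<psi> n) = \<psi>' n" "d dvd q"
      using ind unfolding induced_from_def by blast
    then show ?thesis unfolding induced_from_def using character_cnj
      by (intro conjI exI[of _ "\<lambda>n. cnj (\<psi>' n)"]) (auto, metis complex_cnj_cnj)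
  qed
  then show ?thesis using assms character_cnj unfolding primitive_character_def by blast
qed

text \<open>Add to n the multiple of d by the product of all primes dividing q but not n. A prime of
  q dividing n divides neither d nor that product; any other prime of q divides the product but not
  n.\<close>

lemma exists_coprime_cong:
  fixes n :: int
  assumes "q > 0" "coprime n (int d)"
  obtains n' where "[n' = n] (mod int d)" "coprime n' (int q)"
proof -
  define R where "R = {r :: int. prime r \<and> r dvd int q \<and> \<not> r dvd n}"
  have "R \<subseteq> {0..int q}" using assms(1) zdvd_imp_le by (auto simp: R_def prime_ge_0_int)
  then have fin: "finite R" by (rule finite_subset) simp
  define n' where "n' = n + int d * \<Prod>R"
  have "\<not> (r dvd n' \<and> r dvd int q)" if r: "prime r" for r
  proof
    assume r': "r dvd n' \<and> r dvd int q"
    show False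
    proof (cases "r dvd n")
      case True
      then have "\<not> r dvd int d" using assms(2) r not_prime_unit coprime_common_divisor by blast
      moreover have "\<not> r dvd \<Prod>R"
      proof
        assume "r dvd \<Prod>R"
        then obtain s where "s \<in> R" "r dvd s" using prime_dvd_prod_iff[OF fin r, of "\<lambda>x. x"] by auto
        then have "s = r" using primes_dvd_imp_eq[OF r] by (auto simp: R_def)
        then show False using \<open>s \<in> R\<close> True by (simp add: R_def)
      qed
      moreover have "r dvd int d * \<Prod>R" using r' True dvd_add_right_iff[OF True] by (simp add: n'_def)
      ultimately show False using prime_dvd_mult_iff[OF r] by blast
    next
      case False
      then have "r \<in> R" using r r' by (simp add: R_def)
      then have "r dvd int d * \<Prod>R" using fin by (intro dvd_mult dvd_prodI) auto
      then have "r dvd n" using r' dvd_add_left_iff[of r "int d * \<Prod>R" n] by (simp add: n'_def)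
      then show False using False by blast
    qed
  qed
  then have "coprime n' (int q)"
  proof (intro coprimeI)
    fix g assume g: "g dvd n'" "g dvd int q"
      and no: "\<And>r. prime r \<Longrightarrow> \<not> (r dvd n' \<and> r dvd int q)"
    show "is_unit g"
    proof (rule ccontr)
      assume "\<not> is_unit g"
      moreover have "g \<noteq> 0" using g(2) assms(1) by auto
      ultimately obtain r where "r dvd g" "prime r" using prime_divisor_exists by blast
      then show False using no g dvd_trans by blast
    qed
  qed
  moreover have "[n' = n] (mod int d)" by (simp add: n'_def cong_def)
  ultimately show ?thesis using that by blast
qed

text \<open>If \<open>\<psi>\<close> were 1 on all units congruent to 1 modulo d, its value would
  depend only on the residue modulo d, and lifting residues modulo d to units modulo q would exhibit
  \<open>\<psi>\<close> as induced from d.\<close>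

lemma primitive_character_nontrivial:
  assumes "primitive_character q \<psi>" "d dvd q" "d < q"
  obtains n where "coprime n (int q)" "[n = 1] (mod int d)" "\<psi> n \<noteq> 1"
proof (rule ccontr)
  note intro = that
  assume no: "\<not> thesis"
  have triv: "\<psi> n = 1" if "coprime n (int q)" "[n = 1] (mod int d)" for n
    using intro[OF that] no by blast
  have psi: "dirichlet_character q \<psi>" using assms(1) by (simp add: primitive_character_def)
  note mult = character_mult[OF psi] and nz = character_nonzero_iff[OF psi]
  have qpos: "q > 0" by (rule character_pos[OF psi])
  then have dpos: "d > 0" using assms(2) by (auto intro!: Nat.gr0I)
  have dq: "int d dvd int q" using assms(2) by simp
  have eq: "\<psi> m = \<psi> n" if m: "coprime m (int q)" and n: "coprime n (int q)" and mn: "[m = n] (mod int d)" for m n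
  proof -
    obtain t where t: "[n * t = 1] (mod int q)" using cong_solve_coprime_int[OF n] by blast
    have "[n * t = 1] (mod int d)" using t dq by (rule cong_dvd_modulus)
    moreover have "[m * t = n * t] (mod int d)" using mn by (rule cong_scalar_right)
    ultimately have mt: "[m * t = 1] (mod int d)" by (rule cong_trans[rotated])
    have "\<psi> (n * t) = 1" using character_cong[OF psi t] character_1[OF psi] by simp
    then have "\<psi> t \<noteq> 0" "\<psi> n * \<psi> t = 1" using mult by auto
    then have "coprime t (int q)" using nz by blast
    then have "\<psi> (m * t) = 1" using mt m by (intro triv) auto
    then have "\<psi> m * \<psi> t = \<psi> n * \<psi> t" using mult \<open>\<psi> n * \<psi> t = 1\<close> by simp
    then show ?thesis using \<open>\<psi> t \<noteq> 0\<close> by simp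
  qed
  define L where "L n = (SOME n'. [n' = n] (mod int d) \<and> coprime n' (int q))" for n
  have L: "[L n = n] (mod int d)" "coprime (L n) (int q)" if "coprime n (int d)" for n
  proof -
    have "\<exists>n'. [n' = n] (mod int d) \<and> coprime n' (int q)" using exists_coprime_cong[OF qpos that] by metis
    then have "[L n = n] (mod int d) \<and> coprime (L n) (int q)" unfolding L_def by (rule someI_ex)
    then show "[L n = n] (mod int d)" "coprime (L n) (int q)" by auto
  qed
  define \<psi>' where "\<psi>' n = (if coprime n (int d) then \<psi> (L n) else 0)" for n
  have psi': "\<psi>' n = \<psi> m" if "[m = n] (mod int d)" "coprime m (int q)" for m n
  proof -
    have "coprime m (int d)" using that(2) dq coprime_divisors[of m m "int d" "int q"] by simp
    then have c: "coprime n (int d)" using that(1) by (metis coprime_cong_cong_left)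
    then have "\<psi> (L n) = \<psi> m" using L[OF c] that by (intro eq) (metis cong_trans cong_sym)+
    then show ?thesis using c by (simp add: \<psi>'_def)
  qed
  have "dirichlet_character d \<psi>'"
    unfolding dirichlet_character_def
  proof (intro conjI allI impI dpos)
    fix m n assume mn: "[m = n] (mod int d)"
    show "\<psi>' m = \<psi>' n"
    proof (cases "coprime n (int d)")
      case True
      have "[L n = m] (mod int d)" using L(1)[OF True] mn by (metis cong_trans cong_sym)
      then show ?thesis using psi'[OF L[OF True]] psi'[OF _ L(2)[OF True]] by simp
    next
      case False
      then have "\<not> coprime m (int d)" using mn by (metis coprime_cong_cong_left)
      then show ?thesis using False by (simp add: \<psi>'_def)
    qed
  next
    fix m n show "\<psi>' (m * n) = \<psi>' m * \<psi>' n"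
    proof (cases "coprime m (int d) \<and> coprime n (int d)")
      case True
      then have "[L m * L n = m * n] (mod int d)" "coprime (L m * L n) (int q)"
        using L by (auto intro: cong_mult)
      then have "\<psi>' (m * n) = \<psi> (L m * L n)" by (rule psi')
      then show ?thesis using True by (simp add: mult \<psi>'_def)
    next
      case False
      then have "\<not> coprime (m * n) (int d)" by simp
      then show ?thesis using False by (auto simp: \<psi>'_def)
    qed
  next
    fix n show "\<psi>' n \<noteq> 0 \<longleftrightarrow> coprime n (int d)" using L(2)[of n] nz by (simp add: \<psi>'_def)
  qed
  moreover have "\<psi> n = \<psi>' n" if "coprime n (int q)" for n using psi'[of n n] that by simp
  ultimately have "induced_from q \<psi> d" using assms(2) unfolding induced_from_def by blast
  then show False using assms(1,3) unfolding primitive_character_def by blast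
qed

text \<open>For m prime to q substitute m u for u. Otherwise put d = q / gcd(m, q) and take a unit n
  congruent to 1 modulo d with \<open>\<psi> n\<close> different from 1: replacing u by n u leaves
  the exponentials alone, so the sum equals itself times a factor other than 1 and vanishes, as does
  \<open>\<psi> m\<close>.\<close>

lemma gauss_sum_twist:
  assumes prim: "primitive_character q \<psi>"
  shows "(\<Sum>u<q. cnj (\<psi> (int u)) * e (of_nat u * of_int m / of_nat q))
    = \<psi> m * gauss_sum q (\<lambda>n. cnj (\<psi> n))"
proof -
  have psi: "dirichlet_character q \<psi>" using prim by (simp add: primitive_character_def)
  note qpos = character_pos[OF psi]
  define F where "F m u = cnj (\<psi> u) * e (of_int (u * m) / of_nat q)" for m u
  have F_cong: "F m x = F m y" if "[x = y] (mod int q)" for x y m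
    unfolding F_def using character_cong[OF psi that] e_divide_cong[OF cong_scalar_right[OF that], of m] qpos by simp
  define G where "G m = (\<Sum>u<q. F m (int u))" for m
  have G: "(\<Sum>u<q. cnj (\<psi> (int u)) * e (of_nat u * of_int m / of_nat q)) = G m" for m
    by (simp add: G_def F_def)
  have G1: "gauss_sum q (\<lambda>n. cnj (\<psi> n)) = G 1" by (simp add: G_def F_def gauss_sum_def)
  show ?thesis
  proof (cases "coprime m (int q)")
    case True
    have "G 1 = (\<Sum>u<q. F 1 (m * int u))" unfolding G_def
      by (rule sum_residues_mult[OF qpos True F_cong, symmetric])
    also have "\<dots> = (\<Sum>u<q. cnj (\<psi> m) * F m (int u))"
      by (simp add: F_def character_mult[OF psi] mult_ac)
    also have "\<dots> = cnj (\<psi> m) * G m" by (simp add: G_def sum_distrib_left)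
    finally have "\<psi> m * G 1 = (\<psi> m * cnj (\<psi> m)) * G m" by (simp only: mult.assoc)
    then show ?thesis unfolding G G1 character_cnj_mult[OF psi True] by simp
  next
    case False
    define g where "g = nat (gcd m (int q))"
    have g: "int g = gcd m (int q)" by (simp add: g_def)
    then have "int g dvd int q" by simp
    then have "g dvd q" by simp
    then obtain d where d: "q = g * d" by (elim dvdE)
    have "g \<noteq> 1" using False g by (metis coprime_iff_gcd_eq_1 of_nat_1)
    moreover have "g \<noteq> 0" "d \<noteq> 0" using d qpos by auto
    ultimately have "d < q" "d dvd q" using d by auto
    then obtain n where n: "coprime n (int q)" "[n = 1] (mod int d)" "\<psi> n \<noteq> 1"
      using primitive_character_nontrivial[OF prim] by metis
    have "int q dvd (n - 1) * m"
    proof -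
      have "int d dvd n - 1" using n(2) by (simp add: cong_iff_dvd_diff)
      moreover have "int g dvd m" using g by simp
      ultimately have "int d * int g dvd (n - 1) * m" by (rule mult_dvd_mono)
      then show ?thesis using d by (simp add: mult.commute)
    qed
    then have "int q dvd u * ((n - 1) * m)" for u by (rule dvd_mult)
    moreover have "n * u * m - u * m = u * ((n - 1) * m)" for u by (simp add: algebra_simps)
    ultimately have "[n * u * m = u * m] (mod int q)" for u
      unfolding cong_iff_dvd_diff by (simp only:)
    then have e_eq: "e (of_int (n * u * m) / of_nat q) = e (of_int (u * m) / of_nat q)" for u
      by (rule e_divide_cong[OF _ qpos])
    have "G m = (\<Sum>u<q. F m (n * int u))" unfolding G_def
      by (rule sum_residues_mult[OF qpos n(1) F_cong, symmetric])
    also have "\<dots> = (\<Sum>u<q. cnj (\<psi> n) * F m (int u))"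
      unfolding F_def e_eq by (simp add: character_mult[OF psi] mult.assoc)
    also have "\<dots> = cnj (\<psi> n) * G m" by (simp add: G_def sum_distrib_left)
    finally have "(1 - cnj (\<psi> n)) * G m = 0" by (simp add: algebra_simps)
    moreover have "cnj (\<psi> n) \<noteq> 1" using n(3) by (metis complex_cnj_cnj complex_cnj_one)
    ultimately have "G m = 0" by simp
    moreover have "\<psi> m = 0" using False character_nonzero_iff[OF psi] by blast
    ultimately show ?thesis unfolding G by simp
  qed
qed

text \<open>Expanding one factor by \<open>gauss_sum_twist\<close> makes the product a double sum;
  orthogonality of the additive characters leaves only u congruent to - 1.\<close>

lemma gauss_sum_mult_cnj:
  assumes prim: "primitive_character q \<psi>"
  shows "gauss_sum q \<psi> * gauss_sum q (\<lambda>n. cnj (\<psi> n)) = \<psi> (- 1) * of_nat q"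
proof -
  have psi: "dirichlet_character q \<psi>" using prim by (simp add: primitive_character_def)
  note qpos = character_pos[OF psi]
  let ?\<tau> = "gauss_sum q (\<lambda>n. cnj (\<psi> n))"
  have "gauss_sum q \<psi> * ?\<tau> = (\<Sum>m<q. e (of_nat m / of_nat q) * (\<psi> (int m) * ?\<tau>))"
    unfolding gauss_sum_def[of q \<psi>] sum_distrib_right by (simp only: mult_ac)
  also have "\<dots> = (\<Sum>m<q. \<Sum>u<q. cnj (\<psi> (int u)) * e (of_int (int u + 1) * of_nat m / of_nat q))"
  proof (rule sum.cong[OF refl])
    fix m
    have "e (of_nat m / of_nat q) * (\<psi> (int m) * ?\<tau>) 
        = (\<Sum>u<q. e (of_nat m / of_nat q) * (cnj (\<psi> (int u)) * e (of_nat u * of_int (int m) / of_nat q)))"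
      unfolding gauss_sum_twist[OF prim, symmetric] by (rule sum_distrib_left)
    also have "\<dots> = (\<Sum>u<q. cnj (\<psi> (int u)) * e (of_nat m / of_nat q + of_nat u * of_int (int m) / of_nat q))"
      by (simp only: e_add mult_ac)
    also have "\<dots> = (\<Sum>u<q. cnj (\<psi> (int u)) * e (of_int (int u + 1) * of_nat m / of_nat q))"
      by (simp add: add_divide_distrib[symmetric] distrib_right add.commute)
    finally show "e (of_nat m / of_nat q) * (\<psi> (int m) * ?\<tau>) = \<dots>" .
  qed
  also have "\<dots> = (\<Sum>u<q. \<Sum>m<q. cnj (\<psi> (int u)) * e (of_int (int u + 1) * of_nat m / of_nat q))"
    by (rule sum.swap)
  also have "\<dots> = (\<Sum>u<q. cnj (\<psi> (int u)) * (if int q dvd int u + 1 then of_nat q else 0))"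
    by (simp only: sum_distrib_left[symmetric] sum_e_eq[OF qpos])
  also have "\<dots> = (\<Sum>u<q. if u = q - 1 then cnj (\<psi> (int u)) * of_nat q else 0)"
  proof (rule sum.cong[OF refl])
    fix u assume "u \<in> {..<q}"
    then have "int q dvd int u + 1 \<longleftrightarrow> u = q - 1"
      using zdvd_imp_le[of "int q" "int u + 1"] qpos by auto
    then show "cnj (\<psi> (int u)) * (if int q dvd int u + 1 then of_nat q else 0)
        = (if u = q - 1 then cnj (\<psi> (int u)) * of_nat q else 0)" by simp
  qed
  also have "\<dots> = cnj (\<psi> (int (q - 1))) * of_nat q" using qpos by (simp add: sum.delta)
  also have "\<psi> (int (q - 1)) = \<psi> (- 1)"
    using qpos by (intro character_cong[OF psi]) (simp add: of_nat_diff cong_iff_dvd_diff)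
  also have "cnj (\<psi> (- 1)) = \<psi> (- 1)" using character_minus_1[OF psi] by (elim disjE) simp_all
  finally show ?thesis .
qed

section \<open>Weighted Eisenstein series\<close>

lemma summable_on_int_inverse_square: "(\<lambda>c::int. 1 / (1 + (real_of_int c)\<^sup>2)) summable_on UNIV"
proof -
  define h where "h c = 1 / (1 + (real_of_int c)\<^sup>2)" for c :: int
  have "summable (\<lambda>n. inverse (real n ^ 2))" by (rule inverse_power_summable) simp
  then have "summable (\<lambda>n. norm (h (int n)))"
  proof (rule summable_comparison_test[rotated], intro exI[of _ 1] allI impI)
    fix n :: nat assume "1 \<le> n"
    then show "norm (norm (h (int n))) \<le> inverse (real n ^ 2)"
      by (auto simp: h_def inverse_eq_divide intro!: divide_left_mono mult_pos_pos add_pos_nonneg)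
  qed
  then have s: "(\<lambda>n. h (int n)) summable_on UNIV" by (rule norm_summable_imp_summable_on)
  then have 1: "h summable_on range int"
    by (subst summable_on_reindex) (auto simp: o_def)
  have "(\<lambda>n. h (- int n)) summable_on UNIV" using s by (simp add: h_def)
  then have "h summable_on range (\<lambda>n. - int n)"
    by (subst summable_on_reindex) (auto simp: o_def inj_on_def)
  then have "h summable_on {..<0}" by (rule summable_on_subset_banach) (auto intro!: image_eqI[of _ _ "nat (- x)" for x])
  moreover have "h summable_on {0..}" using 1
    by (rule summable_on_subset_banach) (auto intro!: image_eqI[of _ _ "nat x" for x])
  ultimately have "h summable_on ({..<0} \<union> {0..})" by (rule summable_on_Un_disjoint) auto
  moreover have "{..<0} \<union> {0..} = (UNIV :: int set)" by auto
  ultimately show ?thesis unfolding h_def by (simp only:)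
qed

text \<open>A product, so that summability reduces to one variable. The 3 comes from (1 + c^2)(1 +
  d^2) <= 3 (c^2 + d^2)^2 for nonzero integer rows.\<close>

definition lattice_majorant :: "int \<times> int \<Rightarrow> real" where
  "lattice_majorant r = 3 / ((1 + (real_of_int (fst r))\<^sup>2) * (1 + (real_of_int (snd r))\<^sup>2))"

lemma lattice_majorant_pos: "lattice_majorant r > 0"
  unfolding lattice_majorant_def by (intro divide_pos_pos mult_pos_pos add_pos_nonneg) auto

lemma summable_on_lattice_majorant: "lattice_majorant summable_on UNIV"
proof -
  let ?h = "\<lambda>c::int. 1 / (1 + (real_of_int c)\<^sup>2)"
  have "(\<lambda>r. ?h (fst r) * ?h (snd r)) summable_on (UNIV \<times> UNIV)"
  proof (rule summable_on_SigmaI[where g = "\<lambda>x. ?h x * infsum ?h UNIV"])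
    fix x :: int
    show "((\<lambda>y. ?h (fst (x, y)) * ?h (snd (x, y))) has_sum ?h x * infsum ?h UNIV) UNIV"
      unfolding fst_conv snd_conv
      by (intro has_sum_cmult_right has_sum_infsum summable_on_int_inverse_square)
  next
    show "(\<lambda>x. ?h x * infsum ?h UNIV) summable_on UNIV"
      by (intro summable_on_cmult_left summable_on_int_inverse_square)
  next
    fix x y :: int
    show "0 \<le> ?h (fst (x, y)) * ?h (snd (x, y))" by simp
  qed
  then have "(\<lambda>r. 3 * (?h (fst r) * ?h (snd r))) summable_on UNIV"
    by (intro summable_on_cmult_right) simp
  then show ?thesis by (simp add: lattice_majorant_def[abs_def])
qed

definition lattice_sum :: real where "lattice_sum = infsum lattice_majorant UNIV"

lemma lattice_sum_nonneg: "lattice_sum \<ge> 0"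
  unfolding lattice_sum_def by (intro infsum_nonneg less_imp_le lattice_majorant_pos)

text \<open>The imaginary part of c z + d controls c; then d is controlled by writing it as (c x +
  d) - c x with x = Re z. The factor (2 X + 2)^2 absorbs the resulting 3 + 2 X^2.\<close>

lemma norm_lattice_point:
  fixes c d :: int
  assumes "\<bar>Re z\<bar> \<le> X" "0 < \<delta>" "\<delta> \<le> 1" "\<delta> \<le> Im z" "X \<ge> 1"
  shows "(\<delta> / (2 * X + 2))\<^sup>2 * (real_of_int c ^ 2 + real_of_int d ^ 2) \<le> (cmod (of_int c * z + of_int d))\<^sup>2"
proof -
  define x y C D n where "x = Re z" and "y = Im z" and "C = real_of_int c" and "D = real_of_int d"
    and "n = (cmod (of_int c * z + of_int d))\<^sup>2"
  have n: "n = (C * x + D)\<^sup>2 + C\<^sup>2 * y\<^sup>2"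
    by (simp add: n_def cmod_power2 C_def D_def x_def y_def power_mult_distrib)
  have \<delta>2: "\<delta>\<^sup>2 \<le> 1" "\<delta>\<^sup>2 \<le> y\<^sup>2"
    using assms(2-4) by (auto simp: y_def abs_le_square_iff[symmetric] power_le_one)
  have 1: "\<delta>\<^sup>2 * C\<^sup>2 \<le> n" unfolding n using \<delta>2(2) mult_right_mono[of "\<delta>\<^sup>2" "y\<^sup>2" "C\<^sup>2"]
    by (simp add: mult.commute add_increasing)
  have "D\<^sup>2 \<le> 2 * (C * x + D)\<^sup>2 + 2 * (C * x)\<^sup>2"
    using zero_le_power2[of "2 * C * x + D"] by (simp add: power2_eq_square algebra_simps)
  moreover have "(C * x)\<^sup>2 \<le> X\<^sup>2 * C\<^sup>2"
    using assms(1) mult_right_mono[of "x\<^sup>2" "X\<^sup>2" "C\<^sup>2"] abs_le_square_iff[of x X] assms(5)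
    by (simp add: power_mult_distrib mult.commute x_def)
  ultimately have "D\<^sup>2 \<le> 2 * (C * x + D)\<^sup>2 + 2 * (X\<^sup>2 * C\<^sup>2)" by linarith
  then have "\<delta>\<^sup>2 * D\<^sup>2 \<le> \<delta>\<^sup>2 * (2 * (C * x + D)\<^sup>2 + 2 * (X\<^sup>2 * C\<^sup>2))"
    by (rule mult_left_mono) simp
  also have "\<dots> = \<delta>\<^sup>2 * (2 * (C * x + D)\<^sup>2) + 2 * X\<^sup>2 * (\<delta>\<^sup>2 * C\<^sup>2)" by (simp add: algebra_simps)
  also have "\<dots> \<le> 2 * n + 2 * X\<^sup>2 * n"
  proof (rule add_mono)
    have "\<delta>\<^sup>2 * (2 * (C * x + D)\<^sup>2) \<le> 1 * (2 * (C * x + D)\<^sup>2)" by (rule mult_right_mono) (use \<delta>2 in auto)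
    also have "\<dots> \<le> 2 * n" unfolding n by simp
    finally show "\<delta>\<^sup>2 * (2 * (C * x + D)\<^sup>2) \<le> 2 * n" .
    show "2 * X\<^sup>2 * (\<delta>\<^sup>2 * C\<^sup>2) \<le> 2 * X\<^sup>2 * n" by (rule mult_left_mono[OF 1]) simp
  qed
  finally have "\<delta>\<^sup>2 * (C\<^sup>2 + D\<^sup>2) \<le> (3 + 2 * X\<^sup>2) * n" using 1 by (simp add: algebra_simps)
  also have "\<dots> \<le> (2 * X + 2)\<^sup>2 * n"
  proof (rule mult_right_mono)
    have "(2 * X + 2)\<^sup>2 = 3 + 2 * X\<^sup>2 + (2 * X\<^sup>2 + 8 * X + 1)" by (simp add: power2_eq_square algebra_simps)
    moreover have "0 \<le> 2 * X\<^sup>2 + 8 * X + 1" using assms(5) by (intro add_nonneg_nonneg) auto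
    ultimately show "3 + 2 * X\<^sup>2 \<le> (2 * X + 2)\<^sup>2" by linarith
  qed (simp add: n_def)
  finally have "\<delta>\<^sup>2 * (C\<^sup>2 + D\<^sup>2) / (2 * X + 2)\<^sup>2 \<le> n"
    using assms(5) by (simp add: pos_divide_le_eq mult.commute)
  then show ?thesis by (simp add: C_def D_def n_def power_divide)
qed

text \<open>The fourth power of the norm already dominates (c^2 + d^2)^2 and hence the inverse
  majorant; the norm divided by \<open>B\<close> is at least 1, so the exponent can be raised from 4
  to \<open>\<kappa>\<close>.\<close>

lemma inverse_norm_lattice_point:
  fixes c d :: int
  assumes z: "\<bar>Re z\<bar> \<le> X" "0 < \<delta>" "\<delta> \<le> 1" "\<delta> \<le> Im z" "X \<ge> 1"
    and cd: "(c, d) \<noteq> (0, 0)" and \<kappa>: "4 \<le> \<kappa>"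
  shows "1 / cmod (of_int c * z + of_int d) ^ \<kappa> \<le> ((2 * X + 2) / \<delta>) ^ \<kappa> * lattice_majorant (c, d)"
proof -
  define B C D n s where "B = \<delta> / (2 * X + 2)" and "C = real_of_int c" and "D = real_of_int d"
    and "n = cmod (of_int c * z + of_int d)" and "s = C\<^sup>2 + D\<^sup>2"
  have B: "B > 0" using z by (simp add: B_def)
  have "B\<^sup>2 * s \<le> n\<^sup>2" using norm_lattice_point[OF z, of c d] by (simp add: B_def C_def D_def n_def s_def)
  then have s_le: "s \<le> (n / B)\<^sup>2" using B by (simp add: power_divide pos_le_divide_eq mult.commute)
  have "c\<^sup>2 + d\<^sup>2 > 0" using cd by (auto simp: sum_power2_gt_zero_iff)
  then have "1 \<le> c\<^sup>2 + d\<^sup>2" by linarith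
  then have "real_of_int 1 \<le> real_of_int (c\<^sup>2 + d\<^sup>2)" by (simp only: of_int_le_iff)
  then have s1: "1 \<le> s" by (simp add: s_def C_def D_def)
  have n0: "n \<ge> 0" by (simp add: n_def)
  have "1 \<le> (n / B)\<^sup>2" using s1 s_le by linarith
  then have nB: "1 \<le> n / B" using n0 B by - (rule power2_le_imp_le, auto)
  have "(1 + C\<^sup>2) * (1 + D\<^sup>2) \<le> 3 * s\<^sup>2"
  proof -
    have "s * 1 \<le> s * s" using s1 by (intro mult_left_mono) auto
    then have "s \<le> s\<^sup>2" by (simp add: power2_eq_square)
    moreover have "1 \<le> s\<^sup>2" using s1 by (rule one_le_power)
    moreover have "C\<^sup>2 * D\<^sup>2 \<le> s\<^sup>2" unfolding power2_eq_square[of s] by (intro mult_mono) (simp_all add: s_def)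
    moreover have "(1 + C\<^sup>2) * (1 + D\<^sup>2) = 1 + s + C\<^sup>2 * D\<^sup>2" by (simp add: s_def algebra_simps)
    ultimately show ?thesis by linarith
  qed
  also have "\<dots> \<le> 3 * ((n / B)\<^sup>2)\<^sup>2" using s_le s1 by (intro mult_left_mono power_mono) auto
  also have "((n / B)\<^sup>2)\<^sup>2 = (n / B) ^ 4" by simp
  also have "3 * (n / B) ^ 4 \<le> 3 * (n / B) ^ \<kappa>" using nB \<kappa> by (simp add: power_increasing)
  finally have le: "(1 + C\<^sup>2) * (1 + D\<^sup>2) \<le> 3 * (n / B) ^ \<kappa>" .
  have pos: "(1 + C\<^sup>2) * (1 + D\<^sup>2) > 0" by (intro mult_pos_pos add_pos_nonneg) auto
  have npos: "n > 0" using nB n0 B by (cases "n = 0") auto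
  have "1 / (n / B) ^ \<kappa> \<le> 3 / ((1 + C\<^sup>2) * (1 + D\<^sup>2))"
    using le pos npos B by (simp add: pos_divide_le_eq pos_le_divide_eq mult.commute)
  then have "(1 / B) ^ \<kappa> * (1 / (n / B) ^ \<kappa>) \<le> (1 / B) ^ \<kappa> * (3 / ((1 + C\<^sup>2) * (1 + D\<^sup>2)))"
    using B by (intro mult_left_mono) auto
  moreover have "(1 / B) ^ \<kappa> * (1 / (n / B) ^ \<kappa>) = 1 / n ^ \<kappa>"
    using B npos by (simp add: field_simps)
  ultimately show ?thesis using z by (simp add: B_def C_def D_def n_def lattice_majorant_def)
qed

text \<open>Arbitrary weights on rows turn every transformation law needed below into an identity
  between weights.\<close>

definition eis :: "(int \<Rightarrow> int \<Rightarrow> complex) \<Rightarrow> nat \<Rightarrow> complex \<Rightarrow> complex" where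
  "eis w \<kappa> z = (\<Sum>\<^sub>\<infinity>r. w (fst r) (snd r) / (of_int (fst r) * z + of_int (snd r)) ^ \<kappa>)"

definition admissible_weight :: "(int \<Rightarrow> int \<Rightarrow> complex) \<Rightarrow> bool" where
  "admissible_weight w \<longleftrightarrow> w 0 0 = 0 \<and> (\<forall>c d. cmod (w c d) \<le> 1)"

lemma norm_eis_term:
  assumes w: "admissible_weight w" and z: "\<bar>Re z\<bar> \<le> X" "0 < \<delta>" "\<delta> \<le> 1" "\<delta> \<le> Im z" "X \<ge> 1" and \<kappa>: "4 \<le> \<kappa>"
  shows "cmod (w (fst r) (snd r) / (of_int (fst r) * z + of_int (snd r)) ^ \<kappa>)
    \<le> ((2 * X + 2) / \<delta>) ^ \<kappa> * lattice_majorant r"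
proof (cases "r = (0, 0)")
  case True
  then show ?thesis using w z lattice_majorant_pos[of r] by (simp add: admissible_weight_def)
next
  case False
  have "cmod (w (fst r) (snd r) / (of_int (fst r) * z + of_int (snd r)) ^ \<kappa>)
      \<le> 1 / cmod (of_int (fst r) * z + of_int (snd r)) ^ \<kappa>"
    using w by (simp add: admissible_weight_def norm_divide norm_power divide_right_mono)
  also have "\<dots> \<le> ((2 * X + 2) / \<delta>) ^ \<kappa> * lattice_majorant (fst r, snd r)"
    using False by (intro inverse_norm_lattice_point z \<kappa>) (simp add: prod_eq_iff)
  finally show ?thesis by simp
qed

lemma summable_on_bound:
  fixes f :: "'a \<Rightarrow> 'b::banach"
  assumes "g summable_on A" "\<And>x. x \<in> A \<Longrightarrow> norm (f x) \<le> g x"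
  shows "f summable_on A" "norm (infsum f A) \<le> infsum g A"
proof -
  have "(\<lambda>x. norm (f x)) summable_on A"
  proof (rule Infinite_Sum.abs_summable_on_comparison_test)
    show "(\<lambda>x. norm (g x)) summable_on A" using assms(1) summable_on_iff_abs_summable_on_real by blast
    show "norm (f x) \<le> norm (g x)" if "x \<in> A" for x using assms(2)[OF that] by simp
  qed
  then show 2: "f summable_on A" by (rule Infinite_Sum.abs_summable_summable)
  show "norm (infsum f A) \<le> infsum g A"
    using has_sum_infsum[OF 2] has_sum_infsum[OF assms(1)] assms(2) by (rule norm_infsum_le)
qed

context
  fixes w :: "int \<Rightarrow> int \<Rightarrow> complex" and \<kappa> :: nat
  assumes w: "admissible_weight w" and \<kappa>: "4 \<le> \<kappa>"
begin

lemma
  assumes z: "\<bar>Re z\<bar> \<le> X" "0 < \<delta>" "\<delta> \<le> 1" "\<delta> \<le> Im z" "X \<ge> 1"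
  shows eis_summable_strip: "(\<lambda>r. w (fst r) (snd r) / (of_int (fst r) * z + of_int (snd r)) ^ \<kappa>) summable_on UNIV"
    and norm_eis_strip: "cmod (eis w \<kappa> z) \<le> ((2 * X + 2) / \<delta>) ^ \<kappa> * lattice_sum"
proof -
  have s: "(\<lambda>r. ((2 * X + 2) / \<delta>) ^ \<kappa> * lattice_majorant r) summable_on UNIV"
    by (intro summable_on_cmult_right summable_on_lattice_majorant)
  note b = summable_on_bound[OF s norm_eis_term[OF w z \<kappa>]]
  show "(\<lambda>r. w (fst r) (snd r) / (of_int (fst r) * z + of_int (snd r)) ^ \<kappa>) summable_on UNIV"
    by (rule b(1))
  show "cmod (eis w \<kappa> z) \<le> ((2 * X + 2) / \<delta>) ^ \<kappa> * lattice_sum"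
    using b(2) unfolding eis_def lattice_sum_def infsum_cmult_right' .
qed

lemma eis_summable:
  assumes "Im z > 0"
  shows "(\<lambda>r. w (fst r) (snd r) / (of_int (fst r) * z + of_int (snd r)) ^ \<kappa>) summable_on UNIV"
  by (rule eis_summable_strip[of z "max 1 \<bar>Re z\<bar>" "min 1 (Im z)"]) (use assms in auto)

lemma norm_eis_le:
  assumes "0 < Im z" "Im z \<le> 1" "\<bar>Re z\<bar> \<le> 1"
  shows "cmod (eis w \<kappa> z) \<le> 4 ^ \<kappa> * lattice_sum / Im z ^ \<kappa>"
  using norm_eis_strip[of z 1 "Im z"] assms by (simp add: power_divide)

lemma norm_eis_le_top:
  assumes "1 \<le> Im z" "\<bar>Re z\<bar> \<le> 1"
  shows "cmod (eis w \<kappa> z) \<le> 4 ^ \<kappa> * lattice_sum"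
  using norm_eis_strip[of z 1 1] assms by simp

lemma eis_holomorphic: "eis w \<kappa> holomorphic_on upper_half_plane"
proof -
  have "\<exists>r>0. eis w \<kappa> holomorphic_on ball z r" if z: "Im z > 0" for z
  proof -
    \<comment> \<open>r is both the radius of the disc and the lower bound for the imaginary part on
      it.\<close>
    define r where "r = min 1 (Im z / 2)"
    define X where "X = \<bar>Re z\<bar> + 1"
    have r: "r > 0" "r \<le> 1" "r \<le> Im z / 2" using z by (auto simp: r_def)
    have u: "\<bar>Re u\<bar> \<le> X" "0 < r" "r \<le> 1" "r \<le> Im u" "X \<ge> 1" if "u \<in> cball z r" for u
    proof -
      have "cmod (u - z) \<le> r" using that by (simp add: dist_norm norm_minus_commute)
      then have "\<bar>Re u - Re z\<bar> \<le> r" "\<bar>Im u - Im z\<bar> \<le> r"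
        using abs_Re_le_cmod[of "u - z"] abs_Im_le_cmod[of "u - z"] by auto
      then show "\<bar>Re u\<bar> \<le> X" "0 < r" "r \<le> 1" "r \<le> Im u" "X \<ge> 1" using r by (auto simp: X_def)
    qed
    let ?t = "\<lambda>s u. w (fst s) (snd s) / (of_int (fst s) * u + of_int (snd s)) ^ \<kappa>"
    have "uniform_limit (cball z r) (\<lambda>S u. \<Sum>s\<in>S. ?t s u) (\<lambda>u. \<Sum>\<^sub>\<infinity>s. ?t s u) (finite_subsets_at_top UNIV)"
    proof (rule Weierstrass_m_test_general)
      show "norm (?t s u) \<le> ((2 * X + 2) / r) ^ \<kappa> * lattice_majorant s" if "u \<in> cball z r" for s u
        by (rule norm_eis_term[OF w u[OF that] \<kappa>])
    qed (intro summable_on_cmult_right summable_on_lattice_majorant)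
    then have ulim: "uniform_limit (cball z r) (\<lambda>S u. \<Sum>s\<in>S. ?t s u) (eis w \<kappa>) (finite_subsets_at_top UNIV)"
      by (simp add: eis_def[abs_def])
    have hol: "?t s holomorphic_on cball z r" for s
    proof (cases "s = (0, 0)")
      case True
      then show ?thesis using w by (simp add: admissible_weight_def)
    next
      case False
      have "of_int (fst s) * u + of_int (snd s) \<noteq> (0::complex)" if "u \<in> cball z r" for u
      proof
        assume 0: "of_int (fst s) * u + of_int (snd s) = (0::complex)"
        then have "real_of_int (fst s) * Im u = 0" by (simp add: complex_eq_iff)
        then have "fst s = 0" using u(2,4)[OF that] by simp
        then have "snd s = 0" using 0 by simp
        then show False using \<open>fst s = 0\<close> False by (simp add: prod_eq_iff)
      qed
      then show ?thesis by (intro holomorphic_intros) auto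
    qed
    have "eventually (\<lambda>S. continuous_on (cball z r) (\<lambda>u. \<Sum>s\<in>S. ?t s u) \<and>
        (\<lambda>u. \<Sum>s\<in>S. ?t s u) holomorphic_on ball z r) (finite_subsets_at_top UNIV)"
    proof (intro always_eventually allI)
      fix S
      have "(\<lambda>u. \<Sum>s\<in>S. ?t s u) holomorphic_on cball z r" by (intro holomorphic_on_sum hol)
      then show "continuous_on (cball z r) (\<lambda>u. \<Sum>s\<in>S. ?t s u) \<and> (\<lambda>u. \<Sum>s\<in>S. ?t s u) holomorphic_on ball z r"
        using holomorphic_on_imp_continuous_on holomorphic_on_subset ball_subset_cball by blast
    qed
    then have "eis w \<kappa> holomorphic_on ball z r"
      using holomorphic_uniform_limit[OF _ ulim] finite_subsets_at_top_neq_bot by metis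
    then show ?thesis using r(1) by blast
  qed
  then have "eis w \<kappa> field_differentiable (at z)" if "Im z > 0" for z
    using that by (meson centre_in_ball holomorphic_on_imp_differentiable_at open_ball)
  then show ?thesis
    unfolding holomorphic_on_def upper_half_plane_def
    using field_differentiable_at_within by blast
qed

text \<open>Without the rows (0, d), every |c z + d| is at least Im z. Four of the
  \<open>\<kappa>\<close> powers are spent on the majorant, giving 256 = 4^4, and at least four
  remain for the decay; hence 8 <= \<open>\<kappa>\<close>.\<close>

lemma eis_limit_aux:
  assumes z: "1 \<le> Im z" "\<bar>Re z\<bar> \<le> 1" and "8 \<le> \<kappa>" and zero: "\<And>d. w 0 d = 0"
  shows "cmod (eis w \<kappa> z) \<le> 256 * lattice_sum / Im z ^ 4"
proof -
  have "norm (w (fst r) (snd r) / (of_int (fst r) * z + of_int (snd r)) ^ \<kappa>)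
    \<le> (256 / Im z ^ 4) * lattice_majorant r" for r
  proof (cases "fst r = 0")
    case True
    then show ?thesis using zero z lattice_majorant_pos[of r] by simp
  next
    case False
    define n where "n = cmod (of_int (fst r) * z + of_int (snd r))"
    have "1 \<le> \<bar>real_of_int (fst r)\<bar>" using False by linarith
    then have "Im z \<le> \<bar>real_of_int (fst r)\<bar> * Im z" using z mult_right_mono[of 1 "\<bar>real_of_int (fst r)\<bar>" "Im z"] by simp
    also have "\<dots> = \<bar>Im (of_int (fst r) * z + of_int (snd r))\<bar>" using z by (simp add: abs_mult)
    also have "\<dots> \<le> n" unfolding n_def by (rule abs_Im_le_cmod)
    finally have n: "Im z \<le> n" .
    have "1 / n ^ 4 \<le> ((2 * 1 + 2) / 1) ^ 4 * lattice_majorant (fst r, snd r)"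
      unfolding n_def using False z by (intro inverse_norm_lattice_point) auto
    then have n4: "1 / n ^ 4 \<le> 256 * lattice_majorant r" by simp
    have "Im z ^ 4 \<le> n ^ 4" using n z by (intro power_mono) auto
    also have "\<dots> \<le> n ^ (\<kappa> - 4)" using n z assms(3) by (intro power_increasing) auto
    finally have k4: "Im z ^ 4 \<le> n ^ (\<kappa> - 4)" .
    have "norm (w (fst r) (snd r) / (of_int (fst r) * z + of_int (snd r)) ^ \<kappa>) \<le> 1 / n ^ \<kappa>"
      using w by (simp add: admissible_weight_def norm_divide norm_power divide_right_mono n_def)
    also have "n ^ \<kappa> = n ^ 4 * n ^ (\<kappa> - 4)" using \<kappa> by (simp add: power_add[symmetric])
    also have "1 / (n ^ 4 * n ^ (\<kappa> - 4)) \<le> 1 / (n ^ 4 * Im z ^ 4)"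
      using k4 n z by (intro divide_left_mono mult_left_mono mult_pos_pos) auto
    also have "\<dots> = (1 / n ^ 4) / Im z ^ 4" by simp
    also have "\<dots> \<le> 256 * lattice_majorant r / Im z ^ 4"
      using n4 z by (intro divide_right_mono) auto
    finally show ?thesis by simp
  qed
  then have "norm (eis w \<kappa> z) \<le> infsum (\<lambda>r. (256 / Im z ^ 4) * lattice_majorant r) UNIV"
    unfolding eis_def
    by (intro summable_on_bound(2) summable_on_cmult_right summable_on_lattice_majorant) auto
  then show ?thesis unfolding infsum_cmult_right' lattice_sum_def by simp
qed

text \<open>Right multiplication by the matrix permutes all rows, and the substitution divides the
  image row's linear form by c z + d.\<close>

lemma eis_moebius:
  fixes a b c d :: int
  assumes det: "a * d - b * c = 1" and z: "Im z > 0"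
    and trans: "\<And>u v. w u v = \<omega> * w (u * a + v * c) (u * b + v * d)"
  shows "eis w \<kappa> ((of_int a * z + of_int b) / (of_int c * z + of_int d)) = \<omega> * (of_int c * z + of_int d) ^ \<kappa> * eis w \<kappa> z"
proof -
  define j where "j = of_int c * z + of_int d"
  have j: "j \<noteq> 0"
  proof
    assume j0: "j = 0"
    then have "real_of_int c * Im z = 0" by (simp add: j_def complex_eq_iff)
    then have "c = 0" using z by simp
    then have "d = 0" using j0 by (simp add: j_def)
    then show False using \<open>c = 0\<close> det by simp
  qed
  define \<pi> where "\<pi> r = (fst r * a + snd r * c, fst r * b + snd r * d)" for r :: "int \<times> int"
  define \<pi>' where "\<pi>' r = (fst r * d - snd r * c, snd r * a - fst r * b)" for r :: "int \<times> int"
  have ad: "a * d = 1 + b * c" using det by simp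
  have "\<pi>' (\<pi> r) = (fst r * (a * d - b * c), snd r * (a * d - b * c))"
    "\<pi> (\<pi>' r) = (fst r * (a * d - b * c), snd r * (a * d - b * c))" for r
    by (simp_all add: \<pi>_def \<pi>'_def algebra_simps)
  then have inv: "\<pi>' (\<pi> r) = r" "\<pi> (\<pi>' r) = r" for r unfolding det by simp_all
  have bij: "bij_betw \<pi> UNIV UNIV"
    by (rule bij_betw_byWitness[where f' = \<pi>']) (auto simp: inv)
  let ?t = "\<lambda>r. w (fst r) (snd r) / (of_int (fst r) * z + of_int (snd r)) ^ \<kappa>"
  have "w (fst r) (snd r) / (of_int (fst r) * ((of_int a * z + of_int b) / j) + of_int (snd r)) ^ \<kappa>
      = \<omega> * j ^ \<kappa> * ?t (\<pi> r)" for r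
  proof -
    have "of_int (fst r) * ((of_int a * z + of_int b) / j) + of_int (snd r)
      = (of_int (fst (\<pi> r)) * z + of_int (snd (\<pi> r))) / j"
      using j by (simp add: \<pi>_def field_simps) (simp add: j_def algebra_simps)
    moreover have "w (fst r) (snd r) = \<omega> * w (fst (\<pi> r)) (snd (\<pi> r))"
      using trans[of "fst r" "snd r"] by (simp add: \<pi>_def)
    ultimately show ?thesis by (simp add: power_divide)
  qed
  then have "eis w \<kappa> ((of_int a * z + of_int b) / j) = (\<Sum>\<^sub>\<infinity>r. \<omega> * j ^ \<kappa> * ?t (\<pi> r))"
    by (simp add: eis_def)
  also have "\<dots> = \<omega> * j ^ \<kappa> * (\<Sum>\<^sub>\<infinity>r. ?t (\<pi> r))" by (rule infsum_cmult_right')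
  also have "(\<Sum>\<^sub>\<infinity>r. ?t (\<pi> r)) = eis w \<kappa> z"
    unfolding eis_def by (rule infsum_reindex_bij_betw[OF bij])
  finally show ?thesis by (simp add: j_def)
qed

end

text \<open>Putting - 1/(p z) for z turns the row (c, d) into (p d, - c), up to the factor 1/(p z).
  Rows whose first entry is not a multiple of p are not hit.\<close>

definition fricke_weight :: "nat \<Rightarrow> (int \<Rightarrow> int \<Rightarrow> complex) \<Rightarrow> int \<Rightarrow> int \<Rightarrow> complex" where
  "fricke_weight p w u v = (if int p dvd u then w (- v) (u div int p) else 0)"

lemma admissible_fricke_weight: "admissible_weight w \<Longrightarrow> admissible_weight (fricke_weight p w)"
  by (auto simp: admissible_weight_def fricke_weight_def)

lemma eis_fricke:
  assumes p: "p > 0" and z: "Im z > 0"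
  shows "eis w \<kappa> (- 1 / (of_nat p * z)) = (of_nat p * z) ^ \<kappa> * eis (fricke_weight p w) \<kappa> z"
proof -
  define \<pi> where "\<pi> r = (int p * snd r, - fst r)" for r :: "int \<times> int"
  have inj: "inj \<pi>" using p by (auto simp: inj_on_def \<pi>_def prod_eq_iff)
  have z0: "z \<noteq> 0" using z by auto
  let ?t = "\<lambda>r. fricke_weight p w (fst r) (snd r) / (of_int (fst r) * z + of_int (snd r)) ^ \<kappa>"
  have "w (fst r) (snd r) / (of_int (fst r) * (- 1 / (of_nat p * z)) + of_int (snd r)) ^ \<kappa>
      = (of_nat p * z) ^ \<kappa> * ?t (\<pi> r)" for r
  proof -
    have "of_int (fst r) * (- 1 / (of_nat p * z)) + of_int (snd r)
      = (of_int (fst (\<pi> r)) * z + of_int (snd (\<pi> r))) / (of_nat p * z)"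
      using p z0 by (simp add: \<pi>_def field_simps)
    moreover have "fricke_weight p w (fst (\<pi> r)) (snd (\<pi> r)) = w (fst r) (snd r)"
      using p by (simp add: \<pi>_def fricke_weight_def)
    ultimately show ?thesis by (simp add: power_divide)
  qed
  then have "eis w \<kappa> (- 1 / (of_nat p * z)) = (\<Sum>\<^sub>\<infinity>r. (of_nat p * z) ^ \<kappa> * ?t (\<pi> r))"
    by (simp add: eis_def)
  also have "\<dots> = (of_nat p * z) ^ \<kappa> * (\<Sum>\<^sub>\<infinity>r. ?t (\<pi> r))" by (rule infsum_cmult_right')
  also have "(\<Sum>\<^sub>\<infinity>r. ?t (\<pi> r)) = infsum ?t (range \<pi>)"
    using infsum_reindex[OF inj, of ?t] by (simp add: o_def)
  also have "\<dots> = infsum ?t UNIV"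
  proof (rule infsum_cong_neutral)
    fix r assume r: "r \<in> UNIV - range \<pi>"
    have "\<not> int p dvd fst r"
    proof
      assume "int p dvd fst r"
      then obtain t where "fst r = int p * t" by (elim dvdE)
      then have "r = \<pi> (- snd r, t)" by (simp add: \<pi>_def prod_eq_iff)
      then show False using r by blast
    qed
    then show "?t r = 0" by (simp add: fricke_weight_def)
  qed auto
  finally show ?thesis by (simp add: eis_def)
qed

text \<open>Among the rows (0, d) only (0, 1) and (0, - 1) carry weight, and an even exponent makes
  both denominators 1. The rest is covered by \<open>eis_limit_aux\<close>.\<close>

lemma eis_constant_term:
  assumes w: "admissible_weight w" and \<kappa>: "8 \<le> \<kappa>" "even \<kappa>"
    and z: "1 \<le> Im z" "\<bar>Re z\<bar> \<le> 1"
    and supp: "\<And>d. \<bar>d\<bar> \<noteq> 1 \<Longrightarrow> w 0 d = 0"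
  shows "cmod (eis w \<kappa> z - (w 0 1 + w 0 (- 1))) \<le> 256 * lattice_sum / Im z ^ 4"
proof -
  define w' where "w' c d = (if c = 0 then 0 else w c d)" for c d
  have w': "admissible_weight w'" using w by (auto simp: w'_def admissible_weight_def)
  let ?t = "\<lambda>w r. w (fst r) (snd r) / (of_int (fst r) * z + of_int (snd r)) ^ \<kappa>"
  let ?D = "\<lambda>r::int\<times>int. if r \<in> {(0, 1), (0, - 1)} then w (fst r) (snd r) else 0"
  have t: "?t w r = ?D r + ?t w' r" for r
  proof (cases "fst r = 0")
    case True
    show ?thesis
    proof (cases "\<bar>snd r\<bar> = 1")
      case True
      then have "snd r = 1 \<or> snd r = - 1" by arith
      then show ?thesis using \<open>fst r = 0\<close> \<kappa>(2) by (auto simp: w'_def prod_eq_iff)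
    qed (use True supp[of "snd r"] in \<open>auto simp: w'_def prod_eq_iff\<close>)
  qed (auto simp: w'_def)
  have "(?D has_sum (w 0 1 + w 0 (- 1))) UNIV \<longleftrightarrow> (?D has_sum (w 0 1 + w 0 (- 1))) {(0, 1), (0, - 1)}"
    by (rule has_sum_cong_neutral) auto
  moreover have "(?D has_sum (sum ?D {(0, 1), (0, - 1)})) {(0, 1), (0, - 1)}" by (rule has_sum_finite) simp
  ultimately have D: "(?D has_sum (w 0 1 + w 0 (- 1))) UNIV" by simp
  have "(?t w' has_sum eis w' \<kappa> z) UNIV"
    unfolding eis_def by (intro has_sum_infsum eis_summable w') (use z \<kappa> in auto)
  then have "((\<lambda>r. ?D r + ?t w' r) has_sum (w 0 1 + w 0 (- 1) + eis w' \<kappa> z)) UNIV"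
    by (intro has_sum_add D)
  then have "eis w \<kappa> z = w 0 1 + w 0 (- 1) + eis w' \<kappa> z"
    unfolding t[symmetric] eis_def[of w] by (rule infsumI)
  moreover have "cmod (eis w' \<kappa> z) \<le> 256 * lattice_sum / Im z ^ 4"
    using z \<kappa> by (intro eis_limit_aux w') (auto simp: w'_def)
  ultimately show ?thesis by simp
qed

section \<open>Fourier expansions\<close>

lemma periodic_of_int:
  fixes f :: "complex \<Rightarrow> complex"
  assumes per: "\<And>z. Im z > 0 \<Longrightarrow> f (z + 1) = f z" and z: "Im z > 0"
  shows "f (z + of_int n) = f z"
proof (induction n rule: int_induct[of _ 0])
  case (step1 i)
  then show ?case using per[of "z + of_int i"] z by (simp add: add.assoc)
next
  case (step2 i)
  then show ?case using per[of "z + of_int (i - 1)"] z by simp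
qed simp

text \<open>In the coordinate w = e z the function lives on the punctured disc. The bound C / Im z
  makes the origin removable with value 0, so the Taylor series has no constant term; Cauchy's
  inequality and absolute convergence then give the coefficient bound and the exponential
  decay.\<close>

lemma fourier_expansion:
  fixes f :: "complex \<Rightarrow> complex"
  assumes hol: "f holomorphic_on upper_half_plane"
    and per: "\<And>z. Im z > 0 \<Longrightarrow> f (z + 1) = f z"
    and low: "\<And>z. 0 < Im z \<Longrightarrow> Im z \<le> 1 \<Longrightarrow> \<bar>Re z\<bar> \<le> 1 \<Longrightarrow> cmod (f z) \<le> C / Im z ^ K"
    and top: "\<And>z. 1 \<le> Im z \<Longrightarrow> \<bar>Re z\<bar> \<le> 1 \<Longrightarrow> cmod (f z) \<le> C / Im z"
  obtains a :: "nat \<Rightarrow> complex" and B D :: real where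
    "\<And>z. Im z > 0 \<Longrightarrow> (\<lambda>n. a (Suc n) * e (of_nat (Suc n) * z)) sums f z"
    "\<And>n. n \<ge> 1 \<Longrightarrow> cmod (a n) \<le> B * real n ^ K"
    "\<And>z. Im z \<ge> 1 \<Longrightarrow> cmod (f z) \<le> D * exp (- 2 * pi * Im z)"
proof -
  have red: "\<exists>z'. f z' = f z \<and> Im z' = Im z \<and> \<bar>Re z'\<bar> \<le> 1" if "Im z > 0" for z
  proof (intro exI conjI)
    show "f (z + of_int (- \<lfloor>Re z\<rfloor>)) = f z" by (rule periodic_of_int[of f, OF per that])
    show "\<bar>Re (z + of_int (- \<lfloor>Re z\<rfloor>))\<bar> \<le> 1" by simp linarith
  qed simp
  have low': "cmod (f z) \<le> C / Im z ^ K" if "0 < Im z" "Im z \<le> 1" for z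
    using red[OF that(1)] low that by metis
  have top': "cmod (f z) \<le> C / Im z" if "1 \<le> Im z" for z
  proof -
    obtain z' where "f z' = f z" "Im z' = Im z" "\<bar>Re z'\<bar> \<le> 1" using red[of z] \<open>1 \<le> Im z\<close> by auto
    then show ?thesis using top[of z'] \<open>1 \<le> Im z\<close> by simp
  qed
  \<comment> \<open>\<open>lg\<close> jumps at the cut of \<open>Ln\<close>, but periodicity hides
    the jump in \<open>F\<close>.\<close>
  define lg where "lg w = Ln w / (2 * of_real pi * \<i>)" for w
  define F where "F w = f (lg w)" for w
  have e_lg: "e (lg w) = w" if "w \<noteq> 0" for w using that by (simp add: e_def lg_def)
  have Im_lg: "Im (lg w) = - ln (cmod w) / (2 * pi)" if "w \<noteq> 0" for w
  proof -
    have "lg w = - (\<i> * Ln w) / of_real (2 * pi)" by (simp add: lg_def divide_simps)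
    then have "Im (lg w) = - Re (Ln w) / (2 * pi)" by (simp only: Im_divide_of_real) simp
    then show ?thesis using that by simp
  qed
  have Im_lg_pos: "Im (lg w) > 0" if "w \<noteq> 0" "cmod w < 1" for w
    using that by (simp add: Im_lg divide_neg_pos)
  have F_e: "F (e z) = f z" if "Im z > 0" for z
  proof -
    have "e (lg (e z)) = e z" by (rule e_lg) (rule e_nonzero)
    then have "e (lg (e z) - z) = 1" using e_add[of "lg (e z) - z" z] e_nonzero[of z] by simp
    then obtain n :: int where "lg (e z) - z = of_int n" unfolding e_eq_1_iff by blast
    then have "lg (e z) = z + of_int n" by (simp add: algebra_simps)
    then show ?thesis unfolding F_def using periodic_of_int[of f, OF per that] by simp
  qed
  have opU: "open upper_half_plane" unfolding upper_half_plane_def by (rule open_halfspace_Im_gt)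
  have hol_F: "F holomorphic_on ball 0 1 - {0}"
  proof -
    have "F field_differentiable (at w0)" if w0: "w0 \<in> ball 0 1 - {0}" for w0
    proof -
      \<comment> \<open>A branch of the logarithm that is holomorphic near \<open>w0\<close>
        wherever \<open>w0\<close> lies, as \<open>Ln\<close> is applied only near 1.\<close>
      define L where "L w = (Ln (w / w0) + Ln w0) / (2 * of_real pi * \<i>)" for w
      have w0': "w0 \<noteq> 0" "cmod w0 < 1" using w0 by auto
      have e_L: "e (L w) = w" if "w \<noteq> 0" for w
        using that w0' by (simp add: e_def L_def exp_add)
      have "L w0 = lg w0" using w0' by (simp add: L_def lg_def)
      then have "L w0 \<in> upper_half_plane" using Im_lg_pos[OF w0'] by (simp add: upper_half_plane_def)
      then have 1: "f field_differentiable (at (L w0))"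
        using hol opU holomorphic_on_imp_differentiable_at by blast
      have 2: "L field_differentiable (at w0)"
      proof -
        have "(Ln \<circ> (\<lambda>w. w / w0)) field_differentiable (at w0)"
          using w0' by (intro field_differentiable_compose field_differentiable_at_Ln derivative_intros) auto
        then have "(\<lambda>w. Ln (w / w0)) field_differentiable (at w0)" by (simp add: o_def)
        then show ?thesis unfolding L_def by (intro derivative_intros) auto
      qed
      have "(f \<circ> L) field_differentiable (at w0)" by (rule field_differentiable_compose[OF 2 1])
      moreover have "eventually (\<lambda>w. (f \<circ> L) w = F w) (nhds w0)"
      proof -
        have "eventually (\<lambda>w. w \<in> ball 0 1 - {0}) (nhds w0)"
          using w0 by (intro eventually_nhds_in_open) auto
        then show ?thesis
        proof eventually_elim
          case (elim w)
          then have w: "w \<noteq> 0" "cmod w < 1" by auto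
          have "exp (- 2 * pi * Im (L w)) < 1" using w norm_e[of "L w"] e_L[OF w(1)] by simp
          then have "Im (L w) > 0" by (simp add: zero_less_mult_iff)
          then show ?case using F_e[of "L w"] e_L[OF w(1)] by simp
        qed
      qed
      ultimately show ?thesis
        unfolding field_differentiable_def using DERIV_cong_ev[OF refl _ refl, of "f \<circ> L" F w0] by simp
    qed
    then show ?thesis by (simp add: holomorphic_on_def field_differentiable_at_within)
  qed
  have lim_F: "(F \<longlongrightarrow> 0) (at 0)"
  proof (rule Lim_null_comparison)
    have "eventually (\<lambda>w. w \<in> ball 0 (exp (- 2 * pi)) - {0}) (at (0::complex))"
      by (intro eventually_at_in_open) auto
    then show "eventually (\<lambda>w. norm (F w) \<le> C * (2 * pi) / (- ln (cmod w))) (at 0)"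
    proof eventually_elim
      case (elim w)
      then have w: "w \<noteq> 0" "cmod w < exp (- 2 * pi)" by auto
      then have "ln (cmod w) < - 2 * pi" by (metis ln_less_cancel_iff exp_gt_zero ln_exp zero_less_norm_iff)
      then have "Im (lg w) \<ge> 1" using w by (simp add: Im_lg pos_divide_le_eq)
      then have "norm (F w) \<le> C / Im (lg w)" unfolding F_def by (rule top')
      also have "\<dots> = C * (2 * pi) / (- ln (cmod w))" using w by (simp add: Im_lg)
      finally show ?case .
    qed
    have "filterlim (\<lambda>w::complex. cmod w) (at_right 0) (at 0)"
      by (simp add: filterlim_at tendsto_norm_zero eventually_at_filter)
    then have "filterlim (\<lambda>w::complex. ln (cmod w)) at_bot (at 0)"
      by (rule filterlim_compose[OF ln_at_0])
    then have "filterlim (\<lambda>w::complex. - ln (cmod w)) at_top (at 0)"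
      by (simp add: filterlim_uminus_at_top)
    then show "((\<lambda>w::complex. C * (2 * pi) / (- ln (cmod w))) \<longlongrightarrow> 0) (at 0)"
      by (intro tendsto_divide_0[OF tendsto_const] filterlim_at_top_imp_at_infinity)
  qed
  define F0 where "F0 w = (if w = 0 then 0 else F w)" for w
  have hol_F0: "F0 holomorphic_on ball 0 1"
    unfolding F0_def using removable_singularity[OF hol_F _ lim_F] by simp
  define a where "a n = (deriv ^^ n) F0 0 / fact n" for n
  have ser: "(\<lambda>n. a (Suc n) * w ^ Suc n) sums F0 w" if "cmod w < 1" for w
  proof -
    have "(\<lambda>n. a n * w ^ n) sums F0 w"
      using holomorphic_power_series[OF hol_F0, of w] that by (simp add: a_def)
    then show ?thesis using sums_Suc_iff[of "\<lambda>n. a n * w ^ n" "F0 w"] by (simp add: a_def F0_def)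
  qed
  have e_lt: "cmod (e z) < 1" if "Im z > 0" for z using that by (simp add: norm_e)
  have F0_e: "F0 (e z) = f z" if "Im z > 0" for z using F_e[OF that] e_nonzero by (simp add: F0_def)
  have exp1: "(\<lambda>n. a (Suc n) * e (of_nat (Suc n) * z)) sums f z" if "Im z > 0" for z
    using ser[OF e_lt[OF that]] F0_e[OF that] unfolding e_of_nat_mult by simp
  have bnd: "cmod (a n) \<le> C * exp (2 * pi) * real n ^ K" if n: "n \<ge> 1" for n
  proof -
    \<comment> \<open>This circle is the height Im z = 1/n; there r^n is a constant, so the bound at
      low heights becomes a bound of order n^K.\<close>
    define r where "r = exp (- 2 * pi / real n)"
    have r: "0 < r" "r < 1" using n by (auto simp: r_def)
    have sub: "cball 0 r \<subseteq> ball (0::complex) 1" using r by auto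
    have "norm ((deriv ^^ n) F0 0) \<le> fact n * (C * real n ^ K) / r ^ n"
    proof (rule Cauchy_inequality[OF _ _ r(1)])
      show "F0 holomorphic_on ball 0 r" "continuous_on (cball 0 r) F0"
        using holomorphic_on_subset[OF hol_F0] sub ball_subset_cball holomorphic_on_imp_continuous_on
        by blast+
      fix w :: complex assume "norm (0 - w) = r"
      then have w: "cmod w = r" "w \<noteq> 0" using r by auto
      have "Im (lg w) = 1 / real n" using w n by (simp add: Im_lg r_def)
      then have "cmod (f (lg w)) \<le> C / (1 / real n) ^ K" using low'[of "lg w"] n by simp
      then show "norm (F0 w) \<le> C * real n ^ K" using w by (simp add: F0_def F_def power_one_over)
    qed
    moreover have "r ^ n = exp (- 2 * pi)" using n by (simp add: r_def exp_of_nat_mult[symmetric])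
    ultimately have "norm ((deriv ^^ n) F0 0) \<le> fact n * (C * exp (2 * pi) * real n ^ K)"
      by (simp add: exp_minus field_simps)
    then show ?thesis by (simp add: a_def norm_divide divide_le_eq mult.commute)
  qed
  define r where "r = exp (- 2 * pi)"
  have r: "0 < r" "r < 1" by (auto simp: r_def)
  have summ: "summable (\<lambda>n. cmod (a (Suc n)) * r ^ n)"
  proof -
    \<comment> \<open>Convergence at the larger radius sqrt r gives absolute convergence at r, the
      radius of height Im z = 1.\<close>
    have "summable (\<lambda>n. a (Suc n) * of_real (sqrt r) ^ Suc n)"
      using ser[of "of_real (sqrt r)"] r by (auto simp: sums_iff)
    then have "summable (\<lambda>n. a n * of_real (sqrt r) ^ n)"
      by (subst (asm) summable_Suc_iff)
    moreover have "cmod (of_real r) < cmod (of_real (sqrt r))"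
    proof -
      have "sqrt r < 1" using r by simp
      then have "sqrt r * sqrt r < 1 * sqrt r" using r by (intro mult_strict_right_mono) auto
      then show ?thesis using r by simp
    qed
    ultimately have "summable (\<lambda>n. norm (a n * of_real r ^ n))" by (rule powser_insidea)
    then have "summable (\<lambda>n. cmod (a (Suc n)) * r ^ Suc n)"
      using r by (subst summable_Suc_iff) (simp add: norm_mult norm_power)
    then have "summable (\<lambda>n. (cmod (a (Suc n)) * r ^ Suc n) * (1 / r))" by (rule summable_mult2)
    then show ?thesis using r by simp
  qed
  have dec: "cmod (f z) \<le> (\<Sum>n. cmod (a (Suc n)) * r ^ n) * exp (- 2 * pi * Im z)" if z: "Im z \<ge> 1" for z
  proof -
    define x where "x = exp (- 2 * pi * Im z)"
    have x: "0 < x" "x \<le> r" using z by (auto simp: x_def r_def)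
    have le: "norm (a (Suc n) * e (of_nat (Suc n) * z)) \<le> x * (cmod (a (Suc n)) * r ^ n)" for n
    proof -
      have "norm (a (Suc n) * e (of_nat (Suc n) * z)) = x * (cmod (a (Suc n)) * x ^ n)"
        unfolding e_of_nat_mult norm_mult norm_power norm_e by (simp add: x_def)
      also have "\<dots> \<le> x * (cmod (a (Suc n)) * r ^ n)"
        using x by (intro mult_left_mono power_mono) auto
      finally show ?thesis .
    qed
    have s: "summable (\<lambda>n. x * (cmod (a (Suc n)) * r ^ n))" by (rule summable_mult[OF summ])
    have "f z = (\<Sum>n. a (Suc n) * e (of_nat (Suc n) * z))" using exp1[of z] z by (simp add: sums_iff)
    also have "norm \<dots> \<le> (\<Sum>n. x * (cmod (a (Suc n)) * r ^ n))" by (rule norm_suminf_le[OF le s])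
    also have "\<dots> = x * (\<Sum>n. cmod (a (Suc n)) * r ^ n)" by (rule suminf_mult[OF summ])
    finally show ?thesis by (simp add: x_def mult.commute)
  qed
  show ?thesis by (rule that[OF exp1 bnd dec])
qed

section \<open>Mellin transforms\<close>

lemma integrable_exp_minus_abs: "integrable lborel (\<lambda>t::real. exp (- \<bar>t\<bar>))"
proof -
  have "integrable lborel (\<lambda>x::real. inverse (1 + x\<^sup>2))"
    using integrable_inverse_1_plus_square by (simp add: set_integrable_def)
  then have int: "integrable lborel (\<lambda>x::real. 2 * inverse (1 + x\<^sup>2))" by (rule integrable_mult_right)
  have le: "norm (exp (- \<bar>x\<bar>)) \<le> norm (2 * inverse (1 + x\<^sup>2))" for x :: real
  proof -
    have "(1 + x\<^sup>2) / 2 \<le> exp \<bar>x\<bar>" using exp_lower_Taylor_quadratic[of "\<bar>x\<bar>"] by simp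
    moreover have "0 < 1 + x\<^sup>2" by (intro add_pos_nonneg) auto
    ultimately have "exp (- \<bar>x\<bar>) \<le> 2 * inverse (1 + x\<^sup>2)"
      by (simp add: exp_minus inverse_eq_divide field_simps)
    then show ?thesis by simp
  qed
  show ?thesis
  proof (rule Bochner_Integration.integrable_bound[OF int])
    show "AE x in lborel. norm (exp (- \<bar>x\<bar>)) \<le> norm (2 * inverse (1 + (x::real)\<^sup>2))"
      by (intro AE_I2 le)
  qed simp
qed

text \<open>The Mellin transform, written additively: substitute \<open>y = exp t\<close> in the integral of \<open>G y * y powr (s - 1)\<close>.\<close>

definition mellin :: "(real \<Rightarrow> complex) \<Rightarrow> complex \<Rightarrow> complex" where
  "mellin G s = (LINT t|lborel. G (exp t) * exp (s * of_real t))"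

text \<open>With t = ln y this is decay faster than every power at both ends, y to 0 and y to
  infinity.\<close>

definition rapid_decay :: "(real \<Rightarrow> complex) \<Rightarrow> bool" where
  "rapid_decay G \<longleftrightarrow> continuous_on UNIV (\<lambda>t. G (exp t)) \<and> 
     (\<forall>N::nat. \<exists>D. \<forall>t. cmod (G (exp t)) \<le> D * exp (- real N * \<bar>t\<bar>))"

context
  fixes G :: "real \<Rightarrow> complex"
  assumes G: "rapid_decay G"
begin

lemma mellin_integrand_bound:
  fixes N :: nat
  obtains D where "D \<ge> 0"
    "\<And>s t. \<bar>Re s\<bar> \<le> real N \<Longrightarrow> cmod (G (exp t) * exp (s * of_real t)) \<le> D * exp (- 2 * \<bar>t\<bar>)"
proof -
  \<comment> \<open>N powers pay for exp (s t) on the strip, and two are kept for integrability and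
    for the rate of convergence of truncations.\<close>
  obtain D where D: "\<And>t. cmod (G (exp t)) \<le> D * exp (- real (N + 2) * \<bar>t\<bar>)"
    using G unfolding rapid_decay_def by blast
  have D0: "D \<ge> 0" using order_trans[OF norm_ge_zero D[of 0]] by simp
  have "cmod (G (exp t) * exp (s * of_real t)) \<le> D * exp (- 2 * \<bar>t\<bar>)" if s: "\<bar>Re s\<bar> \<le> real N" for s t
  proof -
    have "Re s * t \<le> \<bar>Re s\<bar> * \<bar>t\<bar>" by (metis abs_ge_self abs_mult)
    also have "\<dots> \<le> real N * \<bar>t\<bar>" using s by (intro mult_right_mono) auto
    finally have "exp (Re s * t) \<le> exp (real N * \<bar>t\<bar>)" by simp
    then have "cmod (G (exp t)) * exp (Re s * t) \<le> (D * exp (- real (N + 2) * \<bar>t\<bar>)) * exp (real N * \<bar>t\<bar>)"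
      using D[of t] by (intro mult_mono) (simp_all add: D0)
    also have "\<dots> = D * exp (- 2 * \<bar>t\<bar>)"
      by (simp add: mult.assoc exp_add[symmetric] algebra_simps)
    finally show ?thesis by (simp add: norm_mult norm_exp_eq_Re)
  qed
  with D0 that show ?thesis by blast
qed

lemma mellin_integrand_continuous: "continuous_on UNIV (\<lambda>t. G (exp t) * exp (s * of_real t))"
  using G unfolding rapid_decay_def by (intro continuous_intros) auto

lemma integrable_exp_minus_2_abs: "integrable lborel (\<lambda>t::real. D * exp (- 2 * \<bar>t\<bar>))"
proof -
  have "integrable lborel (\<lambda>t::real. D * exp (- \<bar>t\<bar>))"
    by (intro integrable_mult_right integrable_exp_minus_abs)
  then show ?thesis
    by (rule Bochner_Integration.integrable_bound) (auto simp: abs_mult intro!: AE_I2 mult_left_mono)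
qed

lemma mellin_integrable: "integrable lborel (\<lambda>t. G (exp t) * exp (s * of_real t))"
proof -
  obtain D where D: "D \<ge> 0"
    "\<And>s' t. \<bar>Re s'\<bar> \<le> real (nat \<lceil>\<bar>Re s\<bar>\<rceil>) \<Longrightarrow> cmod (G (exp t) * exp (s' * of_real t)) \<le> D * exp (- 2 * \<bar>t\<bar>)"
    using mellin_integrand_bound by blast
  have le: "\<bar>Re s\<bar> \<le> real (nat \<lceil>\<bar>Re s\<bar>\<rceil>)" by linarith
  show ?thesis
  proof (rule Bochner_Integration.integrable_bound[OF integrable_exp_minus_2_abs[of D]])
    show "(\<lambda>t. G (exp t) * exp (s * of_real t)) \<in> borel_measurable lborel"
      using mellin_integrand_continuous by (simp add: borel_measurable_continuous_onI)
    show "AE t in lborel. norm (G (exp t) * exp (s * of_real t)) \<le> norm (D * exp (- 2 * \<bar>t\<bar>))"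
      using D(2)[OF le] D(1) by (intro AE_I2) simp
  qed
qed

lemma mellin_bounded: "bounded_in_vertical_strips (mellin G)"
  unfolding bounded_in_vertical_strips_def
proof (intro allI)
  fix x y :: real
  define N where "N = nat \<lceil>max \<bar>x\<bar> \<bar>y\<bar>\<rceil>"
  have N: "max \<bar>x\<bar> \<bar>y\<bar> \<le> real N" unfolding N_def by linarith
  obtain D where D: "D \<ge> 0"
    "\<And>s t. \<bar>Re s\<bar> \<le> real N \<Longrightarrow> cmod (G (exp t) * exp (s * of_real t)) \<le> D * exp (- 2 * \<bar>t\<bar>)"
    using mellin_integrand_bound by blast
  have "cmod (mellin G s) \<le> (LINT t|lborel. D * exp (- 2 * \<bar>t\<bar>))" if "x \<le> Re s" "Re s \<le> y" for s
  proof -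
    have s: "\<bar>Re s\<bar> \<le> real N" using that N by linarith
    have "cmod (mellin G s) \<le> (LINT t|lborel. cmod (G (exp t) * exp (s * of_real t)))"
      unfolding mellin_def by (rule integral_norm_bound)
    also have "\<dots> \<le> (LINT t|lborel. D * exp (- 2 * \<bar>t\<bar>))"
      by (intro integral_mono integrable_norm mellin_integrable integrable_exp_minus_2_abs D(2)[OF s])
    finally show ?thesis .
  qed
  then show "bounded (mellin G ` {s. x \<le> Re s \<and> Re s \<le> y})"
    unfolding bounded_iff by blast
qed

text \<open>Integrals over compact intervals are holomorphic by differentiation under the integral
  sign, and they converge uniformly near every point, with error of order exp (- n).\<close>

lemma mellin_holomorphic: "mellin G holomorphic_on UNIV"
proof -
  let ?f = "\<lambda>s t. G (exp t) * exp (s * of_real t)"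
  define I where "I n s = integral (cbox (- real n) (real n)) (?f s)" for n s
  have cont: "continuous_on A (\<lambda>t. G (exp t))" for A
    using G continuous_on_subset unfolding rapid_decay_def by blast
  have hol_I: "I n holomorphic_on UNIV" for n
    unfolding I_def
  proof (rule leibniz_rule_holomorphic)
    fix s :: complex and t :: real
    show "((\<lambda>s. ?f s t) has_field_derivative (G (exp t) * (of_real t * exp (s * of_real t)))) (at s within UNIV)"
      by (auto intro!: derivative_eq_intros)
  next
    fix s :: complex
    show "?f s integrable_on cbox (- real n) (real n)"
      by (intro integrable_continuous continuous_intros cont)
  next
    have "continuous_on (UNIV \<times> cbox (- real n) (real n)) (\<lambda>x::complex \<times> real. G (exp (snd x)))"
      by (rule continuous_on_compose2[OF cont[of UNIV]]) (auto intro!: continuous_intros)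
    then show "continuous_on (UNIV \<times> cbox (- real n) (real n)) (\<lambda>(s, t). G (exp t) * (of_real t * exp (s * of_real t)))"
      unfolding case_prod_beta by (intro continuous_intros)
  qed simp
  have "mellin G field_differentiable (at s0)" for s0
  proof -
    define N where "N = nat \<lceil>cmod s0 + 1\<rceil>"
    have N: "\<bar>Re s\<bar> \<le> real N" if "s \<in> cball s0 1" for s
    proof -
      have "cmod s \<le> cmod s0 + 1" using that norm_triangle_ineq4[of s0 "s0 - s"] by (simp add: dist_norm)
      then show ?thesis using abs_Re_le_cmod[of s] unfolding N_def by linarith
    qed
    obtain D where D: "D \<ge> 0"
      "\<And>s t. \<bar>Re s\<bar> \<le> real N \<Longrightarrow> cmod (?f s t) \<le> D * exp (- 2 * \<bar>t\<bar>)"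
      using mellin_integrand_bound by blast
    define E where "E = (LINT t|lborel. D * exp (- \<bar>t\<bar>))"
    have iE: "integrable lborel (\<lambda>t::real. D * exp (- \<bar>t\<bar>))"
      by (intro integrable_mult_right integrable_exp_minus_abs)
    have diff: "cmod (I n s - mellin G s) \<le> exp (- real n) * E" if s: "s \<in> cball s0 1" for n s
    proof -
      let ?S = "cbox (- real n) (real n)"
      have int: "integrable lborel (?f s)" by (rule mellin_integrable)
      have set_int: "set_integrable lborel ?S (?f s)" 
        unfolding set_integrable_def using int by (intro integrable_mult_indicator) auto
      have "I n s = (LINT t|lborel. indicator ?S t *\<^sub>R ?f s t)"
        unfolding I_def using set_borel_integral_eq_integral(2)[OF set_int] by (simp add: set_lebesgue_integral_def)
      then have "I n s - mellin G s = (LINT t|lborel. indicator ?S t *\<^sub>R ?f s t - ?f s t)"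
        unfolding mellin_def using set_int int by (simp add: set_integrable_def Bochner_Integration.integral_diff)
      also have "cmod \<dots> \<le> (LINT t|lborel. cmod (indicator ?S t *\<^sub>R ?f s t - ?f s t))"
        by (rule integral_norm_bound)
      also have "\<dots> \<le> (LINT t|lborel. exp (- real n) * (D * exp (- \<bar>t\<bar>)))"
      proof (rule integral_mono)
        show "integrable lborel (\<lambda>t. cmod (indicator ?S t *\<^sub>R ?f s t - ?f s t))"
          using set_int int unfolding set_integrable_def
          by (intro integrable_norm Bochner_Integration.integrable_diff)
        show "integrable lborel (\<lambda>t. exp (- real n) * (D * exp (- \<bar>t\<bar>)))"
          by (rule integrable_mult_right[OF iE])
        fix t :: real
        show "cmod (indicator ?S t *\<^sub>R ?f s t - ?f s t) \<le> exp (- real n) * (D * exp (- \<bar>t\<bar>))"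
        proof (cases "t \<in> ?S")
          case True
          then show ?thesis using D(1) by simp
        next
          case False
          then have t: "real n \<le> \<bar>t\<bar>" by auto
          have "cmod (indicator ?S t *\<^sub>R ?f s t - ?f s t) = cmod (?f s t)" using False by simp
          also have "\<dots> \<le> D * exp (- 2 * \<bar>t\<bar>)" by (rule D(2)[OF N[OF s]])
          \<comment> \<open>One factor becomes the rate exp (- n) outside the interval, the other
            remains integrable.\<close>
          also have "exp (- 2 * \<bar>t\<bar>) = exp (- \<bar>t\<bar>) * exp (- \<bar>t\<bar>)" by (simp add: exp_add[symmetric])
          also have "D * (exp (- \<bar>t\<bar>) * exp (- \<bar>t\<bar>)) \<le> D * (exp (- real n) * exp (- \<bar>t\<bar>))"
            using t D(1) by (intro mult_left_mono mult_right_mono) auto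
          finally show ?thesis by (simp add: mult_ac)
        qed
      qed
      also have "\<dots> = exp (- real n) * E" by (simp add: E_def)
      finally show ?thesis .
    qed
    have "uniform_limit (cball s0 1) I (mellin G) sequentially"
    proof (rule uniform_limitI)
      fix \<epsilon> :: real assume "\<epsilon> > 0"
      have "((\<lambda>n. exp (- real n) * E) \<longlongrightarrow> 0 * E) sequentially"
        by (intro tendsto_intros filterlim_compose[OF exp_at_bot] filterlim_real_sequentially
            filterlim_compose[OF filterlim_uminus_at_bot_at_top])
      then have "eventually (\<lambda>n. exp (- real n) * E < \<epsilon>) sequentially"
        using \<open>\<epsilon> > 0\<close> by (intro order_tendstoD(2)) auto
      then show "eventually (\<lambda>n. \<forall>s\<in>cball s0 1. dist (I n s) (mellin G s) < \<epsilon>) sequentially"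
        by eventually_elim (use diff in \<open>fastforce simp: dist_norm intro: le_less_trans\<close>)
    qed
    moreover have "eventually (\<lambda>n. continuous_on (cball s0 1) (I n) \<and> I n holomorphic_on ball s0 1) sequentially"
      using hol_I holomorphic_on_subset holomorphic_on_imp_continuous_on
      by (intro always_eventually) (meson subset_UNIV continuous_on_subset)
    ultimately have "mellin G holomorphic_on ball s0 1"
      using holomorphic_uniform_limit sequentially_bot by metis
    then show ?thesis by (meson centre_in_ball holomorphic_on_imp_differentiable_at open_ball zero_less_one)
  qed
  then show ?thesis by (simp add: holomorphic_on_def field_differentiable_at_within)
qed

end

text \<open>Inversion of y to 1/(M y) is the reflection of t to - ln M - t, which preserves Lebesgue
  measure.\<close>

lemma mellin_functional_equation:
  assumes M: "M > 0" and G: "\<And>y. y > 0 \<Longrightarrow> G\<^sub>1 y = A * of_real (y powr (- real k)) * G\<^sub>2 (1 / (M * y))"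
  shows "mellin G\<^sub>1 s = A * of_real M powr (of_nat k - s) * mellin G\<^sub>2 (of_nat k - s)"
proof -
  have "mellin G\<^sub>1 s = (LINT t|lborel. G\<^sub>1 (exp (- ln M + - 1 * t)) * exp (s * of_real (- ln M + - 1 * t)))"
    unfolding mellin_def by (subst lborel_integral_real_affine[where c = "- 1" and t = "- ln M"]) auto
  also have "\<dots> = (LINT t|lborel. A * of_real M powr (of_nat k - s) * (G\<^sub>2 (exp t) * exp ((of_nat k - s) * of_real t)))"
  proof (rule Bochner_Integration.integral_cong[OF refl])
    fix t :: real
    have e1: "exp (- ln M + - 1 * t) = 1 / (M * exp t)"
      using M by (simp add: exp_add exp_minus exp_diff divide_simps)
    have e2: "1 / (M * (1 / (M * exp t))) = exp t" using M by simp
    have "G\<^sub>1 (exp (- ln M + - 1 * t)) = A * of_real (exp (- ln M + - 1 * t) powr (- real k)) * G\<^sub>2 (exp t)"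
      using G[of "exp (- ln M + - 1 * t)"] unfolding e1 e2 using M by simp
    also have "exp (- ln M + - 1 * t) powr (- real k) = exp (real k * (ln M + t))"
      by (simp add: powr_def algebra_simps)
    also have "(of_real (exp (real k * (ln M + t))) :: complex) = exp (of_nat k * (of_real (ln M) + of_real t))"
      by (simp add: exp_of_real[symmetric])
    finally have g1: "G\<^sub>1 (exp (- ln M + - 1 * t)) = A * exp (of_nat k * (of_real (ln M) + of_real t)) * G\<^sub>2 (exp t)" .
    have "of_real M powr (of_nat k - s) = exp ((of_nat k - s) * of_real (ln M))"
      using M by (simp add: powr_def Ln_of_real)
    then have "of_real M powr (of_nat k - s) * exp ((of_nat k - s) * of_real t)
       = exp (of_nat k * (of_real (ln M) + of_real t)) * exp (s * of_real (- ln M + - 1 * t))"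
      by (simp add: exp_add[symmetric] algebra_simps)
    note eq = this
    have "G\<^sub>1 (exp (- ln M + - 1 * t)) * exp (s * of_real (- ln M + - 1 * t))
      = A * G\<^sub>2 (exp t) * (exp (of_nat k * (of_real (ln M) + of_real t)) * exp (s * of_real (- ln M + - 1 * t)))"
      unfolding g1 by (simp only: mult_ac)
    also have "\<dots> = A * of_real M powr (of_nat k - s) * (G\<^sub>2 (exp t) * exp ((of_nat k - s) * of_real t))"
      unfolding eq[symmetric] by (simp only: mult_ac)
    finally show "G\<^sub>1 (exp (- ln M + - 1 * t)) * exp (s * of_real (- ln M + - 1 * t)) = \<dots>" .
  qed
  also have "\<dots> = A * of_real M powr (of_nat k - s) * mellin G\<^sub>2 (of_nat k - s)"
    unfolding mellin_def by (rule integral_mult_right_zero)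
  finally show ?thesis .
qed

lemma power_le_fact_exp:
  fixes x :: real
  assumes "x \<ge> 0"
  shows "x ^ n \<le> fact n * exp x"
proof -
  have "(\<Sum>i\<in>{n}. x ^ i /\<^sub>R fact i) \<le> (\<Sum>i. x ^ i /\<^sub>R fact i)"
    using assms by (intro sum_le_suminf summable_exp_generic) auto
  then show ?thesis by (simp add: exp_def field_simps)
qed

text \<open>Substituting t = exp u for a nonnegative integrand yields integrability as well. The
  complex substitution below needs integrability beforehand, and this function is its
  majorant.\<close>

lemma integrable_gamma_additive_real:
  assumes \<sigma>: "\<sigma> > 0"
  shows "integrable lborel (\<lambda>u::real. exp (- exp u) * exp (\<sigma> * u))"
proof -
  let ?f = "\<lambda>u::real. exp (- exp u) * exp (\<sigma> * u)"
  have "((\<lambda>t. t powr (\<sigma> - 1) / exp t) has_integral Gamma \<sigma>) {0..}"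
    by (rule Gamma_integral_real[OF \<sigma>])
  then have "(\<lambda>t. t powr (\<sigma> - 1) / exp t) absolutely_integrable_on {0..}"
    by (intro nonnegative_absolutely_integrable_1) (auto simp: has_integral_iff)
  then have "(\<lambda>t. t powr (\<sigma> - 1) / exp t) absolutely_integrable_on {0<..}"
    by (rule set_integrable_subset) auto
  then have "integrable lebesgue (\<lambda>t. indicator {0<..} t *\<^sub>R (t powr (\<sigma> - 1) / exp t))"
    by (simp add: set_integrable_def)
  then have i: "set_integrable lborel {0<..} (\<lambda>t. t powr (\<sigma> - 1) / exp t)"
    unfolding set_integrable_def by (subst (asm) integrable_completion) simp_all
  have eq: "?f (ln t) * (1 / t) = t powr (\<sigma> - 1) / exp t" if "t > 0" for t
    using that by (simp add: powr_def exp_minus exp_diff left_diff_distrib divide_simps)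
  have "set_integrable lborel (einterval (- \<infinity>) \<infinity>) ?f"
  proof (rule interval_integral_substitution_nonneg(1)[where a = 0 and b = \<infinity> and g = ln and g' = "\<lambda>x. 1 / x"])
    show "(0::ereal) < \<infinity>" by simp
    show "DERIV ln x :> 1 / x" if "0 < ereal x" "ereal x < \<infinity>" for x
      using that by (auto intro!: derivative_eq_intros)
    show "isCont ?f (ln x)" for x by (intro continuous_intros)
    show "isCont (\<lambda>x. 1 / x) x" if "0 < ereal x" "ereal x < \<infinity>" for x :: real
      using that by (intro continuous_intros) auto
    show "0 \<le> 1 / x" if "0 \<le> ereal x" "ereal x \<le> \<infinity>" for x :: real using that by simp
    show "((ereal \<circ> ln \<circ> real_of_ereal) \<longlongrightarrow> - \<infinity>) (at_right 0)"
      unfolding zero_ereal_def ereal_tendsto_simps1 ereal_tendsto_simps2 by (rule ln_at_0)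
    show "((ereal \<circ> ln \<circ> real_of_ereal) \<longlongrightarrow> \<infinity>) (at_left \<infinity>)"
      unfolding ereal_tendsto_simps1 ereal_tendsto_simps2 by (rule ln_at_top)
    have "set_integrable lborel {0<..} (\<lambda>t. ?f (ln t) * (1 / t))"
      using i by (subst set_integrable_cong[OF refl refl eq]) auto
    moreover have "einterval 0 \<infinity> = {0<..}" by (auto simp: einterval_def)
    ultimately show "set_integrable lborel (einterval 0 \<infinity>) (\<lambda>t. ?f (ln t) * (1 / t))" by simp
  qed auto
  then show ?thesis by (simp add: set_integrable_def)
qed

lemma
  assumes s: "Re s > 0"
  shows integrable_gamma_additive: "integrable lborel (\<lambda>u. of_real (exp (- exp u)) * exp (s * of_real u))"
    and gamma_additive: "(LINT u|lborel. of_real (exp (- exp u)) * exp (s * of_real u)) = Gamma s"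
proof -
  let ?h = "\<lambda>u::real. of_real (exp (- exp u)) * exp (s * of_real u)"
  let ?f = "\<lambda>x::real. of_real x powr (s - 1) / of_real (exp x) :: complex"
  show int: "integrable lborel ?h"
  proof (rule Bochner_Integration.integrable_bound[OF integrable_gamma_additive_real[OF s]])
    have "continuous_on UNIV ?h" by (intro continuous_intros)
    then show "?h \<in> borel_measurable lborel" by (simp add: borel_measurable_continuous_onI)
  qed (simp add: norm_mult norm_exp_eq_Re)
  have "?f absolutely_integrable_on {0<..}" by (rule absolutely_integrable_Gamma_integral'[OF s])
  then have "integrable lebesgue (\<lambda>x. indicator {0<..} x *\<^sub>R ?f x)" by (simp add: set_integrable_def)
  moreover have "(\<lambda>x. indicator {0<..} x *\<^sub>R ?f x) \<in> borel_measurable borel"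
    by (rule borel_measurable_continuous_on_indicator) (auto intro!: continuous_intros)
  ultimately have i: "set_integrable lborel {0<..} ?f"
    unfolding set_integrable_def by (subst (asm) integrable_completion) simp_all
  have eq: "exp u *\<^sub>R ?f (exp u) = ?h u" for u
  proof -
    have "of_real (exp u) powr (s - 1) = exp ((s - 1) * of_real u)"
      by (simp add: powr_def Ln_of_real)
    moreover have "of_real (exp u) = exp (of_real u :: complex)" by (simp add: exp_of_real)
    ultimately have "exp u *\<^sub>R ?f (exp u) = exp (of_real u) * exp ((s - 1) * of_real u) / of_real (exp (exp u))"
      by (simp add: scaleR_conv_of_real)
    also have "\<dots> = ?h u"
      by (simp add: exp_add[symmetric] algebra_simps exp_minus divide_inverse)
    finally show ?thesis .
  qed
  have ei: "einterval 0 \<infinity> = {0<..}" by (auto simp: einterval_def)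
  have "(LBINT x=0..\<infinity>. ?f x) = (LBINT u=- \<infinity>..\<infinity>. exp u *\<^sub>R ?f (exp u))"
  proof (rule interval_integral_substitution_integrable)
    show "DERIV exp x :> exp x" for x :: real by (rule DERIV_exp)
    show "isCont ?f (exp x)" for x by (intro continuous_intros) auto
    show "isCont exp x" for x :: real by (rule isCont_exp)
    show "((ereal \<circ> exp \<circ> real_of_ereal) \<longlongrightarrow> 0) (at_right (- \<infinity>))"
      unfolding zero_ereal_def ereal_tendsto_simps1 ereal_tendsto_simps2 by (rule exp_at_bot)
    show "((ereal \<circ> exp \<circ> real_of_ereal) \<longlongrightarrow> \<infinity>) (at_left \<infinity>)"
      unfolding ereal_tendsto_simps1 ereal_tendsto_simps2 by (rule exp_at_top)
    show "set_integrable lborel (einterval (- \<infinity>) \<infinity>) (\<lambda>x. exp x *\<^sub>R ?f (exp x))"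
      unfolding eq set_integrable_def using int by simp
    show "set_integrable lborel (einterval 0 \<infinity>) ?f" unfolding ei by (rule i)
  qed auto
  moreover have "(LBINT x=0..\<infinity>. ?f x) = Gamma s"
  proof -
    have "(LBINT x=0..\<infinity>. ?f x) = (LINT x:{0<..}|lborel. ?f x)"
      by (simp add: interval_lebesgue_integral_def ei)
    also have "\<dots> = integral {0<..} ?f" by (rule set_borel_integral_eq_integral(2)[OF i])
    also have "\<dots> = Gamma s" using Gamma_integral_complex'[OF s] by (rule integral_unique)
    finally show ?thesis .
  qed
  moreover have "(LBINT u=- \<infinity>..\<infinity>. exp u *\<^sub>R ?f (exp u)) = (LINT u|lborel. ?h u)"
    unfolding eq by (simp add: interval_lebesgue_integral_def set_lebesgue_integral_def)
  ultimately show "(LINT u|lborel. ?h u) = Gamma s" by simp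
qed

lemma
  assumes s: "Re s > 0" and a: "a > 0"
  shows integrable_gamma_additive_scaled: "integrable lborel (\<lambda>t. of_real (exp (- (a * exp t))) * exp (s * of_real t))"
    and gamma_additive_scaled:
      "(LINT t|lborel. of_real (exp (- (a * exp t))) * exp (s * of_real t)) = Gamma s * of_real a powr (- s)"
proof -
  let ?h = "\<lambda>u::real. of_real (exp (- exp u)) * exp (s * of_real u) :: complex"
  have eq: "of_real (exp (- (a * exp t))) * exp (s * of_real t) = of_real a powr (- s) * ?h (ln a + 1 * t)" for t
  proof -
    have "exp (ln a + 1 * t) = a * exp t" using a by (simp add: exp_add)
    moreover have "of_real a powr (- s) * exp (s * of_real (ln a + 1 * t)) = exp (s * of_real t)"
      using a by (simp add: powr_def Ln_of_real exp_add[symmetric] algebra_simps)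
    ultimately show ?thesis by (simp add: mult.left_commute)
  qed
  show "integrable lborel (\<lambda>t. of_real (exp (- (a * exp t))) * exp (s * of_real t))"
    unfolding eq by (intro integrable_mult_right lborel_integrable_real_affine integrable_gamma_additive[OF s]) simp
  have "(LINT t|lborel. of_real (exp (- (a * exp t))) * exp (s * of_real t))
      = of_real a powr (- s) * (LINT t|lborel. ?h (ln a + 1 * t))"
    unfolding eq by (rule integral_mult_right_zero)
  also have "(LINT t|lborel. ?h (ln a + 1 * t)) = Gamma s"
    using lborel_integral_real_affine[of 1 ?h "ln a"] gamma_additive[OF s] by simp
  finally show "(LINT t|lborel. of_real (exp (- (a * exp t))) * exp (s * of_real t)) = Gamma s * of_real a powr (- s)"
    by (simp add: mult.commute)
qed

text \<open>Termwise integration: each exponential contributes a Gamma integral, and the integrals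
  of the absolute values are summable because Re s > K + 1.\<close>

lemma mellin_dirichlet_series:
  fixes b :: "nat \<Rightarrow> complex"
  assumes b: "\<And>n. cmod (b n) \<le> B * real (Suc n) ^ K" and s: "Re s > real K + 1"
    and G: "\<And>y. y > 0 \<Longrightarrow> G y = (\<Sum>n. b n * of_real (exp (- (2 * pi * real (Suc n) * y))))"
  shows "mellin G s = of_real (2 * pi) powr (- s) * Gamma s * (\<Sum>n. b n * of_nat (Suc n) powr (- s))"
proof -
  define \<sigma> where "\<sigma> = Re s"
  have s0: "Re s > 0" using s by linarith
  define c where "c n = 2 * pi * real (Suc n)" for n
  have c: "c n > 0" for n by (simp add: c_def)
  define f where "f n t = b n * (of_real (exp (- (c n * exp t))) * exp (s * of_real t))" for n t
  have B0: "B \<ge> 0" using order_trans[OF norm_ge_zero b[of 0]] by simp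
  have int_f: "integrable lborel (f n)" for n
    unfolding f_def by (intro integrable_mult_right integrable_gamma_additive_scaled s0 c)
  have val_f: "(LINT t|lborel. f n t) = b n * (Gamma s * of_real (c n) powr (- s))" for n
    unfolding f_def by (simp add: gamma_additive_scaled[OF s0 c])
  have norm_f: "cmod (f n t) = cmod (b n) * (exp (- (c n * exp t)) * exp (\<sigma> * t))" for n t
    by (simp add: f_def norm_mult norm_exp_eq_Re \<sigma>_def)
  have "summable (\<lambda>n. real n powr (real K - \<sigma>))" using s by (simp add: summable_real_powr_iff \<sigma>_def)
  then have summ_powr: "summable (\<lambda>n. real (Suc n) powr (real K - \<sigma>))" by (subst summable_Suc_iff)
  have b_powr: "cmod (b n) * real (Suc n) powr (- \<sigma>) \<le> B * real (Suc n) powr (real K - \<sigma>)" for n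
  proof -
    have "cmod (b n) * real (Suc n) powr (- \<sigma>) \<le> (B * real (Suc n) ^ K) * real (Suc n) powr (- \<sigma>)"
      by (intro mult_right_mono b) simp
    also have "real (Suc n) ^ K = real (Suc n) powr real K" by (simp add: powr_realpow)
    also have "B * real (Suc n) powr real K * real (Suc n) powr - \<sigma> = B * real (Suc n) powr (real K - \<sigma>)"
      by (simp add: mult.assoc powr_add[symmetric])
    finally show ?thesis .
  qed
  have summ_b: "summable (\<lambda>n. cmod (b n) * real (Suc n) powr (- \<sigma>))"
    by (rule summable_comparison_test'[OF summable_mult[OF summ_powr, of B]]) (use b_powr in simp)
  \<comment> \<open>The absolute value of a term is the same integrand at the real point
    \<open>\<sigma>\<close>, so its integral comes from the complex formula.\<close>
  have norm_int: "(LINT t|lborel. cmod (f n t)) = cmod (Gamma (of_real \<sigma> :: complex)) * (2 * pi) powr (- \<sigma>) *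
      (cmod (b n) * real (Suc n) powr (- \<sigma>))" for n
  proof -
    define I where "I = (LINT t|lborel. exp (- (c n * exp t)) * exp (\<sigma> * t))"
    have "I \<ge> 0" unfolding I_def by (intro Bochner_Integration.integral_nonneg) simp
    have "of_real I = (LINT t|lborel. of_real (exp (- (c n * exp t)) * exp (\<sigma> * t)) :: complex)"
      unfolding I_def by (rule integral_complex_of_real[symmetric])
    also have "\<dots> = (LINT t|lborel. of_real (exp (- (c n * exp t))) * exp (of_real \<sigma> * of_real t))"
      by (simp add: exp_of_real[symmetric])
    also have "\<dots> = Gamma (of_real \<sigma>) * of_real (c n) powr (- of_real \<sigma>)"
      by (rule gamma_additive_scaled) (use s0 c in \<open>auto simp: \<sigma>_def\<close>)
    finally have "cmod (of_real I) = cmod (Gamma (of_real \<sigma>) * of_real (c n) powr (- of_real \<sigma>))" by simp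
    then have "I = cmod (Gamma (of_real \<sigma>)) * c n powr (- \<sigma>)"
      using \<open>I \<ge> 0\<close> c[of n] by (simp add: norm_mult norm_powr_real_powr)
    moreover have "c n powr (- \<sigma>) = (2 * pi) powr (- \<sigma>) * real (Suc n) powr (- \<sigma>)"
      unfolding c_def by (rule powr_mult)
    ultimately show ?thesis unfolding norm_f by (simp add: I_def)
  qed
  have summ_f: "summable (\<lambda>n. cmod (f n t))" for t
  proof -
    define x where "x = 2 * pi * exp t"
    have x: "x > 0" by (simp add: x_def)
    \<comment> \<open>The exponent K + 2 lets the exponential beat the coefficient growth m^K and
      still leave 1/m^2.\<close>
    define C where "C = (B * exp (\<sigma> * t)) * (fact (K + 2) / x ^ (K + 2))"
    have le: "cmod (f n t) \<le> C * inverse (real (Suc n) ^ 2)" for n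
    proof -
      define m where "m = real (Suc n)"
      have m: "m > 0" by (simp add: m_def)
      define F X where "F = (fact (K + 2) :: real)" and "X = x ^ (K + 2)"
      have X: "X > 0" using x by (simp add: X_def)
      have "(m * x) ^ (K + 2) \<le> F * exp (m * x)" using m x unfolding F_def by (intro power_le_fact_exp) simp
      also have "(m * x) ^ (K + 2) = m ^ K * (m ^ 2 * X)" by (simp only: power_mult_distrib power_add X_def mult_ac)
      finally have "m ^ K * exp (- (m * x)) \<le> F / (m ^ 2 * X)"
        using m X by (simp add: exp_minus field_simps)
      then have 1: "m ^ K * exp (- (m * x)) \<le> F / X * inverse (m ^ 2)"
        by (simp add: divide_inverse mult_ac)
      have "cmod (f n t) = cmod (b n) * (exp (- (m * x)) * exp (\<sigma> * t))"
        unfolding norm_f by (simp add: c_def m_def x_def mult_ac)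
      also have "\<dots> \<le> B * m ^ K * (exp (- (m * x)) * exp (\<sigma> * t))"
        using b[of n] by (intro mult_right_mono) (auto simp: m_def)
      also have "\<dots> = (B * exp (\<sigma> * t)) * (m ^ K * exp (- (m * x)))" by (simp only: mult_ac)
      also have "\<dots> \<le> (B * exp (\<sigma> * t)) * (F / X * inverse (m ^ 2))"
        using B0 by (intro mult_left_mono[OF 1]) simp
      finally show ?thesis by (simp only: C_def F_def X_def m_def mult.assoc)
    qed
    have "summable (\<lambda>n. inverse (real n ^ 2))" by (rule inverse_power_summable) simp
    then have "summable (\<lambda>n. inverse (real (Suc n) ^ 2))" by (subst summable_Suc_iff)
    from summable_mult[OF this, of C] show ?thesis
      by (rule summable_comparison_test') (simp only: real_norm_def abs_norm_cancel le)
  qed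
  have "(\<lambda>n. LINT t|lborel. f n t) sums (LINT t|lborel. (\<Sum>n. f n t))"
  proof (rule sums_integral[OF int_f])
    show "summable (\<lambda>n. LINT t|lborel. cmod (f n t))"
      unfolding norm_int by (rule summable_mult[OF summ_b])
    show "AE t in lborel. summable (\<lambda>n. cmod (f n t))" using summ_f by simp
  qed
  moreover have "(\<Sum>n. f n t) = G (exp t) * exp (s * of_real t)" for t
  proof -
    have "G (exp t) = (\<Sum>n. b n * of_real (exp (- (c n * exp t))))" using G[of "exp t"] by (simp add: c_def)
    moreover have "(\<Sum>n. f n t) = (\<Sum>n. exp (s * of_real t) * (b n * of_real (exp (- (c n * exp t)))))"
      by (simp add: f_def mult_ac)
    moreover have "\<dots> = exp (s * of_real t) * (\<Sum>n. b n * of_real (exp (- (c n * exp t))))"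
    proof (rule suminf_mult)
      have "summable (\<lambda>n. exp (- (s * of_real t)) * f n t)"
        by (intro summable_mult summable_norm_cancel[OF summ_f])
      moreover have "exp (- (s * of_real t)) * f n t = b n * of_real (exp (- (c n * exp t)))" for n
        by (simp add: f_def exp_minus)
      ultimately show "summable (\<lambda>n. b n * (of_real (exp (- (c n * exp t))) :: complex))" by simp
    qed
    ultimately show ?thesis by (simp only: mult.commute)
  qed
  ultimately have "mellin G s = (\<Sum>n. b n * (Gamma s * of_real (c n) powr (- s)))"
    by (simp add: mellin_def val_f sums_iff)
  also have "\<dots> = (\<Sum>n. (of_real (2 * pi) powr (- s) * Gamma s) * (b n * of_nat (Suc n) powr (- s)))"
  proof (rule suminf_cong)
    fix n
    have "(of_real (c n) :: complex) = of_real (2 * pi) * of_real (real (Suc n))" by (simp add: c_def)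
    moreover have "(of_real (2 * pi) * of_real (real (Suc n)) :: complex) powr (- s)
        = of_real (2 * pi) powr (- s) * of_real (real (Suc n)) powr (- s)"
      by (rule powr_times_real) auto
    ultimately show "b n * (Gamma s * of_real (c n) powr (- s))
        = (of_real (2 * pi) powr (- s) * Gamma s) * (b n * of_nat (Suc n) powr (- s))"
      by (simp only: of_real_of_nat_eq mult_ac)
  qed
  also have "\<dots> = of_real (2 * pi) powr (- s) * Gamma s * (\<Sum>n. b n * of_nat (Suc n) powr (- s))"
  proof (rule suminf_mult)
    have "norm (b n * of_nat (Suc n) powr (- s)) = cmod (b n) * real (Suc n) powr (- \<sigma>)" for n
      using norm_powr_real_powr[of "of_nat (Suc n)" "- s"] by (simp add: norm_mult \<sigma>_def)
    then show "summable (\<lambda>n. b n * of_nat (Suc n) powr (- s))"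
      using summ_b by (intro summable_norm_cancel[of "\<lambda>n. b n * of_nat (Suc n) powr (- s)"]) simp
  qed
  finally show ?thesis .
qed

section \<open>Twists of a Fricke pair\<close>

lemma gauss_sum_nonzero:
  assumes "primitive_character q \<psi>" shows "gauss_sum q \<psi> \<noteq> 0"
proof -
  have psi: "dirichlet_character q \<psi>" using assms by (simp add: primitive_character_def)
  have "\<psi> (- 1) \<noteq> 0" using character_minus_1[OF psi] by auto
  then show ?thesis using gauss_sum_mult_cnj[OF assms] character_pos[OF psi] by auto
qed

definition twisted_series :: "(nat \<Rightarrow> complex) \<Rightarrow> (int \<Rightarrow> complex) \<Rightarrow> real \<Rightarrow> complex" where
  "twisted_series a \<psi> y = (\<Sum>n. a (Suc n) * \<psi> (int (Suc n)) * of_real (exp (- (2 * pi * real (Suc n) * y))))"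

text \<open>The twist written through values of \<open>f\<close> on the vertical lines over u/q,
  where modularity applies. By \<open>gauss_sum_twist\<close> the sum over u turns the n-th
  exponential into \<open>\<psi> n\<close> times the Gauss sum in the denominator.\<close>

definition additive_twist :: "(complex \<Rightarrow> complex) \<Rightarrow> nat \<Rightarrow> (int \<Rightarrow> complex) \<Rightarrow> real \<Rightarrow> complex" where
  "additive_twist f q \<psi> y = (\<Sum>u<q. cnj (\<psi> (int u)) * f (of_nat u / of_nat q + \<i> * of_real y)) /
     gauss_sum q (\<lambda>n. cnj (\<psi> n))"

lemma twisted_series_eq_additive_twist:
  assumes prim: "primitive_character q \<psi>" and y: "y > 0"
    and f: "\<And>z. Im z > 0 \<Longrightarrow> (\<lambda>n. a (Suc n) * e (of_nat (Suc n) * z)) sums f z"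
  shows "twisted_series a \<psi> y = additive_twist f q \<psi> y"
proof -
  let ?\<tau> = "gauss_sum q (\<lambda>n. cnj (\<psi> n))"
  have \<tau>: "?\<tau> \<noteq> 0" by (rule gauss_sum_nonzero[OF primitive_cnj[OF prim]])
  have "(\<lambda>n. \<Sum>u<q. cnj (\<psi> (int u)) * (a (Suc n) * e (of_nat (Suc n) * (of_nat u / of_nat q + \<i> * of_real y))))
      sums (\<Sum>u<q. cnj (\<psi> (int u)) * f (of_nat u / of_nat q + \<i> * of_real y))"
  proof (intro sums_sum sums_mult f)
    fix u :: nat
    have "Im (of_nat u / of_nat q :: complex) = 0"
      using Im_divide_of_real[of "of_nat u" "real q"] by simp
    then show "Im (of_nat u / of_nat q + \<i> * of_real y) > 0" using y by simp
  qed
  moreover have "(\<Sum>u<q. cnj (\<psi> (int u)) * (a (Suc n) * e (of_nat (Suc n) * (of_nat u / of_nat q + \<i> * of_real y))))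
      = ?\<tau> * (a (Suc n) * \<psi> (int (Suc n)) * of_real (exp (- (2 * pi * real (Suc n) * y))))" for n
  proof -
    have ey: "e (of_nat (Suc n) * (\<i> * of_real y)) = of_real (exp (- (2 * pi * real (Suc n) * y)))"
      by (simp add: e_def exp_of_real[symmetric] algebra_simps)
    have "e (of_nat (Suc n) * (of_nat u / of_nat q + \<i> * of_real y))
        = e (of_nat u * of_int (int (Suc n)) / of_nat q) * of_real (exp (- (2 * pi * real (Suc n) * y)))" for u
      unfolding distrib_left e_add ey by (simp add: mult.commute)
    then have "(\<Sum>u<q. cnj (\<psi> (int u)) * (a (Suc n) * e (of_nat (Suc n) * (of_nat u / of_nat q + \<i> * of_real y))))
      = (\<Sum>u<q. (a (Suc n) * of_real (exp (- (2 * pi * real (Suc n) * y)))) *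
          (cnj (\<psi> (int u)) * e (of_nat u * of_int (int (Suc n)) / of_nat q)))"
      by (simp only: mult_ac)
    also have "\<dots> = (a (Suc n) * of_real (exp (- (2 * pi * real (Suc n) * y)))) * (\<psi> (int (Suc n)) * ?\<tau>)"
      unfolding sum_distrib_left[symmetric] gauss_sum_twist[OF prim] ..
    finally show ?thesis by (simp only: mult_ac)
  qed
  ultimately have "(\<lambda>n. ?\<tau> * (a (Suc n) * \<psi> (int (Suc n)) * of_real (exp (- (2 * pi * real (Suc n) * y)))))
      sums (\<Sum>u<q. cnj (\<psi> (int u)) * f (of_nat u / of_nat q + \<i> * of_real y))" by simp
  then have "(\<lambda>n. a (Suc n) * \<psi> (int (Suc n)) * of_real (exp (- (2 * pi * real (Suc n) * y))))
      sums additive_twist f q \<psi> y"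
    using \<tau> sums_divide[of _ _ ?\<tau>] unfolding additive_twist_def by fastforce
  then show ?thesis unfolding twisted_series_def by (rule sums_unique[symmetric])
qed

text \<open>The exponential beats every power for y >= 1 and, in the variable 1/(M y), for y <= 1/M;
  the range between is compact. One constant is needed per range.\<close>

lemma rapid_decayI:
  fixes G :: "real \<Rightarrow> complex"
  assumes cont: "continuous_on UNIV (\<lambda>t. G (exp t))" and M: "M \<ge> 1"
    and top: "\<And>y. y \<ge> 1 \<Longrightarrow> cmod (G y) \<le> C * exp (- y)"
    and bot: "\<And>y. 0 < y \<Longrightarrow> y \<le> 1 / M \<Longrightarrow> cmod (G y) \<le> C * exp (- (1 / (M * y))) / y ^ k"
  shows "rapid_decay G"
  unfolding rapid_decay_def
proof (intro conjI cont allI)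
  fix N :: nat
  have C: "C \<ge> 0" using order_trans[OF norm_ge_zero top[of 1]] by (simp add: zero_le_mult_iff)
  have "compact ((\<lambda>t. G (exp t)) ` {- ln M..0})"
    by (intro compact_continuous_image continuous_on_subset[OF cont]) auto
  then have "bounded ((\<lambda>t. G (exp t)) ` {- ln M..0})" by (rule compact_imp_bounded)
  then obtain C' where "\<forall>x\<in>(\<lambda>t. G (exp t)) ` {- ln M..0}. cmod x \<le> C'" unfolding bounded_iff by blast
  then have C': "cmod (G (exp t)) \<le> C'" if "t \<in> {- ln M..0}" for t using that by simp
  have C'0: "C' \<ge> 0" using order_trans[OF norm_ge_zero C'[of 0]] M by simp
  define D1 D2 D3 where "D1 = C * fact N" and "D2 = C * (fact (N + k) * M ^ (N + k))" and "D3 = C' * M ^ N"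
  have D: "D1 \<ge> 0" "D2 \<ge> 0" "D3 \<ge> 0" using C C'0 M by (auto simp: D1_def D2_def D3_def)
  have "cmod (G (exp t)) \<le> (D1 + D2 + D3) * exp (- real N * \<bar>t\<bar>)" for t
  proof -
    consider "t \<ge> 0" | "t \<le> - ln M" | "- ln M \<le> t" "t \<le> 0" by linarith
    then have "\<exists>D\<in>{D1, D2, D3}. cmod (G (exp t)) \<le> D * exp (- real N * \<bar>t\<bar>)"
    proof cases
      case 1
      have "exp t ^ N \<le> fact N * exp (exp t)" by (intro power_le_fact_exp) simp
      then have "exp (- exp t) \<le> fact N / exp t ^ N" by (simp add: exp_minus field_simps)
      also have "\<dots> = fact N * exp (- real N * \<bar>t\<bar>)"
        using 1 by (simp add: exp_of_nat_mult exp_minus divide_inverse)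
      finally have "C * exp (- exp t) \<le> C * (fact N * exp (- real N * \<bar>t\<bar>))" using C by (rule mult_left_mono)
      then have "cmod (G (exp t)) \<le> D1 * exp (- real N * \<bar>t\<bar>)" using top[of "exp t"] 1 by (simp add: D1_def)
      then show ?thesis by blast
    next
      case 2
      define y where "y = exp t"
      have y: "y > 0" by (simp add: y_def)
      have "exp t \<le> exp (- ln M)" using 2 by simp
      then have "y \<le> 1 / M" using M by (simp add: y_def exp_minus inverse_eq_divide)
      then have le: "cmod (G y) \<le> C * exp (- (1 / (M * y))) / y ^ k" using y by (intro bot)
      \<comment> \<open>The exponent is N + k because the bound near 0 carries the extra factor 1 /
        y^k.\<close>
      have "(1 / (M * y)) ^ (N + k) \<le> fact (N + k) * exp (1 / (M * y))"
        using M y by (intro power_le_fact_exp) simp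
      then have "1 \<le> fact (N + k) * exp (1 / (M * y)) * (M * y) ^ (N + k)"
        using M y by (simp only: power_one_over) (simp add: divide_le_eq)
      then have "exp (- (1 / (M * y))) \<le> fact (N + k) * (M * y) ^ (N + k)"
        by (simp add: exp_minus field_simps)
      then have "C * exp (- (1 / (M * y))) / y ^ k \<le> C * (fact (N + k) * (M * y) ^ (N + k)) / y ^ k"
        using C y by (intro divide_right_mono mult_left_mono) auto
      also have "\<dots> = D2 * y ^ N"
        using y by (simp add: D2_def power_mult_distrib power_add)
      also have "y ^ N = exp (- real N * \<bar>t\<bar>)"
      proof -
        have "ln M \<ge> 0" using M by simp
        then have "- real N * \<bar>t\<bar> = real N * t" using 2 by simp
        then show ?thesis by (simp only: exp_of_nat_mult y_def)
      qed
      finally show ?thesis using le by (auto simp: y_def)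
    next
      case 3
      have "1 = M ^ N * exp (- real N * ln M)" using M by (simp add: exp_minus exp_of_nat_mult)
      also have "\<dots> \<le> M ^ N * exp (- real N * \<bar>t\<bar>)"
      proof -
        have "real N * \<bar>t\<bar> \<le> real N * ln M" using 3 by (intro mult_left_mono) auto
        then show ?thesis using M by (intro mult_left_mono) auto
      qed
      finally have "C' * 1 \<le> C' * (M ^ N * exp (- real N * \<bar>t\<bar>))" using C'0 by (rule mult_left_mono)
      then have "cmod (G (exp t)) \<le> D3 * exp (- real N * \<bar>t\<bar>)" using C'[of t] 3 by (simp add: D3_def)
      then show ?thesis by blast
    qed
    then obtain D' where D': "D' \<in> {D1, D2, D3}" "cmod (G (exp t)) \<le> D' * exp (- real N * \<bar>t\<bar>)" by blast
    have "D' \<le> D1 + D2 + D3" using D'(1) D by auto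
    then have "D' * exp (- real N * \<bar>t\<bar>) \<le> (D1 + D2 + D3) * exp (- real N * \<bar>t\<bar>)" by (rule mult_right_mono) simp
    with D'(2) show ?thesis by linarith
  qed
  then show "\<exists>D. \<forall>t. cmod (G (exp t)) \<le> D * exp (- real N * \<bar>t\<bar>)" by blast
qed

text \<open>The line over u/q goes to the line over c/q under a matrix of \<Gamma>_0(p) combined
  with the Fricke involution, where p u c is congruent to - 1 modulo q.\<close>

definition fricke_reflection :: "nat \<Rightarrow> nat \<Rightarrow> nat \<Rightarrow> nat" where
  "fricke_reflection p q u = (SOME c. c < q \<and> int q dvd int p * int u * int c + 1)"

lemma fricke_reflection:
  assumes "q > 0" "coprime q p" "coprime u q"
  shows "fricke_reflection p q u < q" "int q dvd int p * int u * int (fricke_reflection p q u) + 1"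
proof -
  have "coprime (int (p * u)) (int q)" using assms by (simp add: coprime_commute)
  then obtain x where x: "[int (p * u) * x = 1] (mod int q)" using cong_solve_coprime_int by blast
  define c where "c = nat ((- x) mod int q)"
  have c: "int c = (- x) mod int q" using assms(1) by (simp add: c_def)
  have "[int (p * u) * int c = int (p * u) * (- x)] (mod int q)"
    unfolding c by (intro cong_scalar_left) (simp add: cong_def)
  moreover have "[int (p * u) * (- x) = - 1] (mod int q)"
    using x by (simp add: cong_minus_minus_iff)
  ultimately have "[int p * int u * int c = - 1] (mod int q)" by (metis cong_trans of_nat_mult)
  then have "int q dvd int p * int u * int c + 1" by (simp add: cong_iff_dvd_diff)
  moreover have "c < q"
  proof -
    have "int c < int q" unfolding c using assms(1) by simp
    then show ?thesis by simp
  qed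
  ultimately have "\<exists>c. c < q \<and> int q dvd int p * int u * int c + 1" by blast
  then have "fricke_reflection p q u < q \<and> int q dvd int p * int u * int (fricke_reflection p q u) + 1"
    unfolding fricke_reflection_def by (rule someI_ex)
  then show "fricke_reflection p q u < q" "int q dvd int p * int u * int (fricke_reflection p q u) + 1" by auto
qed

lemma fricke_reflection_coprime:
  assumes "q > 0" "coprime q p" "coprime u q"
  shows "coprime (fricke_reflection p q u) q"
proof -
  let ?c = "fricke_reflection p q u"
  have "is_unit d" if "d dvd int ?c" "d dvd int q" for d
  proof -
    have "d dvd int p * int u * int ?c + 1" using fricke_reflection(2)[OF assms] that(2) dvd_trans by blast
    moreover have "d dvd int p * int u * int ?c" using that(1) by simp
    ultimately show ?thesis using dvd_add_right_iff by blast
  qed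
  then have "coprime (int ?c) (int q)" by (intro coprimeI)
  then show ?thesis by simp
qed

text \<open>The defining congruence is symmetric in u and c, and p c is invertible modulo q, so its
  solution in the range below q is unique.\<close>

lemma fricke_reflection_involution:
  assumes "q > 0" "coprime q p" "coprime u q" "u < q"
  shows "fricke_reflection p q (fricke_reflection p q u) = u"
proof -
  let ?c = "fricke_reflection p q u"
  let ?v = "fricke_reflection p q ?c"
  note c = fricke_reflection[OF assms(1-3)] fricke_reflection_coprime[OF assms(1-3)]
  note v = fricke_reflection[OF assms(1,2) c(3)]
  have "int q dvd (int p * int ?c * int ?v + 1) - (int p * int u * int ?c + 1)"
    by (rule dvd_diff[OF v(2) c(2)])
  then have "int q dvd int (p * ?c) * (int ?v - int u)" by (simp add: algebra_simps)
  moreover have "coprime (int q) (int (p * ?c))" using assms(2) c(3) by (simp add: coprime_commute)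
  ultimately have "int q dvd int ?v - int u" by (simp add: coprime_dvd_mult_right_iff)
  then have "[int ?v = int u] (mod int q)" by (simp add: cong_iff_dvd_diff)
  then have "[?v = u] (mod q)" by (simp only: cong_int_iff)
  then show ?thesis using v(1) assms(4) by (simp add: cong_def)
qed

text \<open>
  The hypothesis \<open>rel\<close> is the modularity of \<open>f\<close> under the matrix with rows \<open>(a, u)\<close> and \<open>(p c, q)\<close>, read off on
  the vertical line above \<open>u / q\<close>.
\<close>

locale fricke_pair =
  fixes p k :: nat and f g :: "complex \<Rightarrow> complex" and D :: real
  assumes p: "p > 0"
    and cont: "continuous_on upper_half_plane f"
    and f_top: "\<And>z. Im z \<ge> 1 \<Longrightarrow> cmod (f z) \<le> D * exp (- 2 * pi * Im z)"
    and g_top: "\<And>z. Im z \<ge> 1 \<Longrightarrow> cmod (g z) \<le> D * exp (- 2 * pi * Im z)"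
    and rel: "\<And>q u c. q > 0 \<Longrightarrow> int q dvd int p * int u * int c + 1 \<Longrightarrow>
      \<exists>\<omega>. cmod \<omega> = 1 \<and> (\<forall>t>0. f (of_nat u / of_nat q + \<i> * of_real t) =
        \<omega> * \<i> ^ k / of_real (real p ^ (k div 2) * (real q * t) ^ k) *
        g (of_nat c / of_nat q + \<i> * of_real (1 / (real (p * q\<^sup>2) * t))))"
begin

lemma Im_line: "Im (of_nat u / of_nat q + \<i> * of_real y) = y"
  using Im_divide_of_real[of "of_nat u" "real q"] by simp

text \<open>Near y = 0 the relation \<open>rel\<close> moves each point to height 1/(p q^2 y) >= 1,
  where \<open>g\<close> decays. Only the modulus of the multiplier enters, so it may vary with
  u.\<close>

lemma additive_twist_rapid_decay:
  assumes prim: "primitive_character q \<psi>" and qp: "coprime q p"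
  shows "rapid_decay (additive_twist f q \<psi>)"
proof -
  have psi: "dirichlet_character q \<psi>" using prim by (simp add: primitive_character_def)
  note qpos = character_pos[OF psi]
  define T where "T = 1 / cmod (gauss_sum q (\<lambda>n. cnj (\<psi> n)))"
  have D: "D \<ge> 0" using order_trans[OF norm_ge_zero f_top[of \<i>]] by (simp add: zero_le_mult_iff)
  have T: "T \<ge> 0" by (simp add: T_def)
  define M where "M = real (p * q\<^sup>2)"
  have "p * q\<^sup>2 \<ge> 1" using p qpos by (simp add: Suc_le_eq)
  then have M: "M \<ge> 1" unfolding M_def by (metis of_nat_1 of_nat_mono)
  define C where "C = real q * D * T"
  have twist_le: "cmod (additive_twist f q \<psi> y) \<le> real q * B * T"
    if B: "\<And>u. coprime u q \<Longrightarrow> u < q \<Longrightarrow> cmod (f (of_nat u / of_nat q + \<i> * of_real y)) \<le> B" and "B \<ge> 0" for y B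
  proof -
    have "cmod (\<Sum>u<q. cnj (\<psi> (int u)) * f (of_nat u / of_nat q + \<i> * of_real y)) \<le> (\<Sum>u<q. B)"
    proof (rule sum_norm_le)
      fix u assume u: "u \<in> {..<q}"
      show "cmod (cnj (\<psi> (int u)) * f (of_nat u / of_nat q + \<i> * of_real y)) \<le> B"
      proof (cases "coprime u q")
        case True
        then have "cmod (\<psi> (int u)) = 1" by (intro norm_character[OF psi]) simp
        then show ?thesis using B[OF True] u by (simp add: norm_mult)
      next
        case False
        then have "\<psi> (int u) = 0" using character_nonzero_iff[OF psi, of "int u"] by simp
        then show ?thesis using \<open>B \<ge> 0\<close> by simp
      qed
    qed
    then have "cmod (additive_twist f q \<psi> y) \<le> (real q * B) / cmod (gauss_sum q (\<lambda>n. cnj (\<psi> n)))"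
      unfolding additive_twist_def norm_divide by (intro divide_right_mono) simp_all
    then show ?thesis by (simp add: T_def)
  qed
  have two_pi: "2 * pi \<ge> 1" using pi_gt3 by linarith
  show ?thesis
  proof (rule rapid_decayI[OF _ M])
    have "continuous_on UNIV (\<lambda>t. f (of_nat u / of_nat q + \<i> * of_real (exp t)))" for u
      by (rule continuous_on_compose2[OF cont])
        (auto intro!: continuous_intros simp: upper_half_plane_def Im_line simp del: plus_complex.sel)
    then show "continuous_on UNIV (\<lambda>t. additive_twist f q \<psi> (exp t))"
      unfolding additive_twist_def divide_inverse by (intro continuous_intros)
  next
    fix y :: real assume y: "y \<ge> 1"
    have "cmod (f (of_nat u / of_nat q + \<i> * of_real y)) \<le> D * exp (- y)" for u
    proof -
      have "cmod (f (of_nat u / of_nat q + \<i> * of_real y)) \<le> D * exp (- 2 * pi * y)"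
        using f_top[of "of_nat u / of_nat q + \<i> * of_real y"] y unfolding Im_line by simp
      also have "\<dots> \<le> D * exp (- y)"
        using D y mult_right_mono[OF two_pi, of y] by (intro mult_left_mono) auto
      finally show ?thesis .
    qed
    then have "cmod (additive_twist f q \<psi> y) \<le> real q * (D * exp (- y)) * T"
      using D by (intro twist_le) auto
    then show "cmod (additive_twist f q \<psi> y) \<le> C * exp (- y)" by (simp add: C_def mult_ac)
  next
    fix y :: real assume y: "0 < y" "y \<le> 1 / M"
    define x where "x = 1 / (M * y)"
    have x: "x \<ge> 1" using y M by (simp add: x_def field_simps)
    have "cmod (f (of_nat u / of_nat q + \<i> * of_real y)) \<le> D * exp (- x) / y ^ k" if u: "coprime u q" "u < q" for u
    proof -
      let ?c = "fricke_reflection p q u"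
      obtain \<omega> where \<omega>: "cmod \<omega> = 1" "f (of_nat u / of_nat q + \<i> * of_real y) =
        \<omega> * \<i> ^ k / of_real (real p ^ (k div 2) * (real q * y) ^ k) *
        g (of_nat ?c / of_nat q + \<i> * of_real x)"
        using rel[OF qpos fricke_reflection(2)[OF qpos qp u(1)]] y(1) unfolding x_def M_def by blast
      have "cmod (f (of_nat u / of_nat q + \<i> * of_real y)) =
          cmod (g (of_nat ?c / of_nat q + \<i> * of_real x)) / (real p ^ (k div 2) * (real q * y) ^ k)"
        unfolding \<omega>(2) norm_mult norm_divide norm_of_real norm_power using \<omega>(1) y(1) by simp
      also have "\<dots> \<le> cmod (g (of_nat ?c / of_nat q + \<i> * of_real x)) / y ^ k"
      proof (rule divide_left_mono)
        have "1 * y ^ k \<le> real p ^ (k div 2) * (real q * y) ^ k"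
        proof (rule mult_mono)
          show "1 \<le> real p ^ (k div 2)" using p by (intro one_le_power) simp
          show "y ^ k \<le> (real q * y) ^ k" using y(1) qpos by (intro power_mono) auto
        qed (use y in auto)
        then show "y ^ k \<le> real p ^ (k div 2) * (real q * y) ^ k" by simp
        show "0 < real p ^ (k div 2) * (real q * y) ^ k * y ^ k"
          using p qpos y(1) by simp
      qed simp
      also have "\<dots> \<le> D * exp (- x) / y ^ k"
      proof (rule divide_right_mono)
        have "cmod (g (of_nat ?c / of_nat q + \<i> * of_real x)) \<le> D * exp (- 2 * pi * x)"
          using g_top[of "of_nat ?c / of_nat q + \<i> * of_real x"] x unfolding Im_line by simp
        also have "\<dots> \<le> D * exp (- x)"
          using D x mult_right_mono[OF two_pi, of x] by (intro mult_left_mono) auto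
        finally show "cmod (g (of_nat ?c / of_nat q + \<i> * of_real x)) \<le> D * exp (- x)" .
      qed (use y in simp)
      finally show ?thesis .
    qed
    then have "cmod (additive_twist f q \<psi> y) \<le> real q * (D * exp (- x) / y ^ k) * T"
      using D y by (intro twist_le) auto
    then show "cmod (additive_twist f q \<psi> y) \<le> C * exp (- (1 / (M * y))) / y ^ k"
      by (simp add: C_def x_def mult_ac)
  qed
qed

end

lemma mellin_cong: "(\<And>y. y > 0 \<Longrightarrow> G\<^sub>1 y = G\<^sub>2 y) \<Longrightarrow> mellin G\<^sub>1 s = mellin G\<^sub>2 s"
  unfolding mellin_def by simp

lemma rapid_decay_cong: "(\<And>y. y > 0 \<Longrightarrow> G\<^sub>1 y = G\<^sub>2 y) \<Longrightarrow> rapid_decay G\<^sub>1 \<longleftrightarrow> rapid_decay G\<^sub>2"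
  unfolding rapid_decay_def by simp

context fricke_pair
begin

text \<open>With \<open>X\<close> common to all u, the sum over u can be reindexed by the
  reflection. The congruence for c turns the conjugate of \<open>\<psi> u\<close> into
  \<open>\<psi> (- 1) * \<psi> p * \<psi> c\<close>, and the product of the two Gauss sums converts
  the remaining factor into \<open>\<tau>\<^sup>2 / q\<close>.\<close>

lemma additive_twist_reflection:
  assumes prim: "primitive_character q \<psi>" and qp: "coprime q p" and y: "y > 0"
    and X: "\<And>u c t. int q dvd int p * int u * int c + 1 \<Longrightarrow> t > 0 \<Longrightarrow>
      f (of_nat u / of_nat q + \<i> * of_real t) = X * \<i> ^ k / of_real (real p ^ (k div 2) * (real q * t) ^ k) *
        g (of_nat c / of_nat q + \<i> * of_real (1 / (real (p * q\<^sup>2) * t)))"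
  shows "additive_twist f q \<psi> y = X * \<psi> (int p) * ((gauss_sum q \<psi>)\<^sup>2 / of_nat q) *
    (\<i> ^ k / of_real (real p ^ (k div 2) * (real q * y) ^ k)) *
    additive_twist g q (\<lambda>n. cnj (\<psi> n)) (1 / (real (p * q\<^sup>2) * y))"
proof -
  have psi: "dirichlet_character q \<psi>" using prim by (simp add: primitive_character_def)
  note qpos = character_pos[OF psi]
  let ?\<sigma> = "fricke_reflection p q"
  define \<tau> \<tau>' where "\<tau> = gauss_sum q \<psi>" and "\<tau>' = gauss_sum q (\<lambda>n. cnj (\<psi> n))"
  have \<tau>0: "\<tau> \<noteq> 0" "\<tau>' \<noteq> 0"
    using gauss_sum_nonzero[OF prim] gauss_sum_nonzero[OF primitive_cnj[OF prim]] by (auto simp: \<tau>_def \<tau>'_def)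
  define U where "U = {u. u < q \<and> coprime u q}"
  define x where "x = 1 / (real (p * q\<^sup>2) * y)"
  define F where "F = \<i> ^ k / (of_real (real p ^ (k div 2) * (real q * y) ^ k) :: complex)"
  define S where "S = (\<Sum>c\<in>U. \<psi> (int c) * g (of_nat c / of_nat q + \<i> * of_real x))"
  have restrict: "(\<Sum>u<q. cnj (\<phi> (int u)) * h u) = (\<Sum>u\<in>U. cnj (\<phi> (int u)) * h u)"
    if "dirichlet_character q \<phi>" for \<phi> and h :: "nat \<Rightarrow> complex"
  proof (rule sum.mono_neutral_right)
    show "\<forall>u\<in>{..<q} - U. cnj (\<phi> (int u)) * h u = 0"
      using character_nonzero_iff[OF that] by (auto simp: U_def)
  qed (auto simp: U_def)
  have rel': "cnj (\<psi> (int u)) * f (of_nat u / of_nat q + \<i> * of_real y)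
      = \<psi> (- 1) * \<psi> (int p) * (X * F) * (\<psi> (int (?\<sigma> u)) * g (of_nat (?\<sigma> u) / of_nat q + \<i> * of_real x))"
    if u: "u \<in> U" for u
  proof -
    have u': "coprime u q" "u < q" using u by (auto simp: U_def)
    note c = fricke_reflection[OF qpos qp u'(1)]
    have f_eq: "f (of_nat u / of_nat q + \<i> * of_real y) = X * F * g (of_nat (?\<sigma> u) / of_nat q + \<i> * of_real x)"
      using X[OF c(2) y] by (simp add: F_def x_def)
    have "[int p * int u * int (?\<sigma> u) = - 1] (mod int q)" using c(2) by (simp add: cong_iff_dvd_diff)
    then have "\<psi> (int p) * \<psi> (int u) * \<psi> (int (?\<sigma> u)) = \<psi> (- 1)"
      using character_cong[OF psi] by (simp only: character_mult[OF psi, symmetric])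
    moreover have "\<psi> (- 1) * \<psi> (- 1) = 1" using character_minus_1[OF psi] by auto
    ultimately have 1: "\<psi> (- 1) * (\<psi> (int p) * \<psi> (int u) * \<psi> (int (?\<sigma> u))) = 1" by simp
    have "\<psi> (int u) * cnj (\<psi> (int u)) = 1" using u' by (intro character_cnj_mult[OF psi]) simp
    have "cnj (\<psi> (int u)) = (\<psi> (- 1) * (\<psi> (int p) * \<psi> (int u) * \<psi> (int (?\<sigma> u)))) * cnj (\<psi> (int u))"
      unfolding 1 by simp
    also have "\<dots> = \<psi> (- 1) * \<psi> (int p) * \<psi> (int (?\<sigma> u)) * (\<psi> (int u) * cnj (\<psi> (int u)))"
      by (simp only: mult_ac)
    also have "\<dots> = \<psi> (- 1) * \<psi> (int p) * \<psi> (int (?\<sigma> u))"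
      using \<open>\<psi> (int u) * cnj (\<psi> (int u)) = 1\<close> by simp
    finally show ?thesis unfolding f_eq by (simp only: mult_ac)
  qed
  have "(\<Sum>u<q. cnj (\<psi> (int u)) * f (of_nat u / of_nat q + \<i> * of_real y))
      = (\<Sum>u\<in>U. \<psi> (- 1) * \<psi> (int p) * (X * F) * (\<psi> (int (?\<sigma> u)) * g (of_nat (?\<sigma> u) / of_nat q + \<i> * of_real x)))"
    unfolding restrict[OF psi] using rel' by (intro sum.cong) auto
  also have "\<dots> = \<psi> (- 1) * \<psi> (int p) * (X * F) *
      (\<Sum>u\<in>U. \<psi> (int (?\<sigma> u)) * g (of_nat (?\<sigma> u) / of_nat q + \<i> * of_real x))"
    by (rule sum_distrib_left[symmetric])
  \<comment> \<open>The reflection is an involution of \<open>U\<close>, so its values may serve as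
    the summation index.\<close>
  also have "(\<Sum>u\<in>U. \<psi> (int (?\<sigma> u)) * g (of_nat (?\<sigma> u) / of_nat q + \<i> * of_real x)) = S"
    unfolding S_def
    by (rule sum.reindex_bij_witness[of U ?\<sigma> ?\<sigma>])
      (auto simp: U_def fricke_reflection_involution fricke_reflection_coprime fricke_reflection(1) qpos qp)
  finally have L: "additive_twist f q \<psi> y = \<psi> (- 1) * \<psi> (int p) * (X * F) * S / \<tau>'"
    unfolding additive_twist_def \<tau>'_def by simp
  have "additive_twist g q (\<lambda>n. cnj (\<psi> n)) x = S / \<tau>"
    unfolding additive_twist_def S_def \<tau>_def restrict[OF character_cnj[OF psi]] by simp
  then have S: "S = \<tau> * additive_twist g q (\<lambda>n. cnj (\<psi> n)) x" using \<tau>0 by simp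
  have "\<tau> * \<tau>' = \<psi> (- 1) * of_nat q" unfolding \<tau>_def \<tau>'_def by (rule gauss_sum_mult_cnj[OF prim])
  then have "\<tau> * (\<tau> * \<tau>') = \<tau> * (\<psi> (- 1) * of_nat q)" by simp
  then have "\<psi> (- 1) * \<tau> * of_nat q = \<tau>\<^sup>2 * \<tau>'" by (simp only: power2_eq_square mult_ac)
  then have "\<psi> (- 1) * \<tau> / \<tau>' = \<tau>\<^sup>2 / of_nat q" using \<tau>0 qpos by (subst frac_eq_eq) simp_all
  moreover have "additive_twist f q \<psi> y = X * \<psi> (int p) * (\<psi> (- 1) * \<tau> / \<tau>') * F * additive_twist g q (\<lambda>n. cnj (\<psi> n)) x"
    unfolding L S by (simp add: mult_ac)
  ultimately show ?thesis by (simp add: F_def x_def \<tau>_def)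
qed

lemma mellin_additive_twist_functional_equation:
  assumes prim: "primitive_character q \<psi>" and qp: "coprime q p" and k: "even k"
    and X: "\<And>u c t. int q dvd int p * int u * int c + 1 \<Longrightarrow> t > 0 \<Longrightarrow>
      f (of_nat u / of_nat q + \<i> * of_real t) = X * \<i> ^ k / of_real (real p ^ (k div 2) * (real q * t) ^ k) *
        g (of_nat c / of_nat q + \<i> * of_real (1 / (real (p * q\<^sup>2) * t)))"
  shows "mellin (additive_twist f q \<psi>) s =
    \<i> ^ k * X * \<psi> (int p) * ((gauss_sum q \<psi>)\<^sup>2 / of_nat q) * of_nat (p * q\<^sup>2) powr (of_nat k / 2 - s) *
    mellin (additive_twist g q (\<lambda>n. cnj (\<psi> n))) (of_nat k - s)"
proof -
  have psi: "dirichlet_character q \<psi>" using prim by (simp add: primitive_character_def)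
  note qpos = character_pos[OF psi]
  define M where "M = real (p * q\<^sup>2)"
  have M: "M > 0" using p qpos by (simp add: M_def)
  define A where "A = X * \<psi> (int p) * ((gauss_sum q \<psi>)\<^sup>2 / of_nat q) * (\<i> ^ k / of_real (real p ^ (k div 2) * real q ^ k))"
  have "mellin (additive_twist f q \<psi>) s = A * of_real M powr (of_nat k - s) *
      mellin (additive_twist g q (\<lambda>n. cnj (\<psi> n))) (of_nat k - s)"
  proof (rule mellin_functional_equation[OF M])
    fix y :: real assume y: "y > 0"
    have "\<i> ^ k / (of_real (real p ^ (k div 2) * (real q * y) ^ k) :: complex)
        = \<i> ^ k / of_real (real p ^ (k div 2) * real q ^ k) * of_real (y powr (- real k))"
      using y by (simp add: power_mult_distrib powr_minus powr_realpow divide_inverse)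
    note eq = this
    have "additive_twist f q \<psi> y = X * \<psi> (int p) * ((gauss_sum q \<psi>)\<^sup>2 / of_nat q) *
      (\<i> ^ k / of_real (real p ^ (k div 2) * (real q * y) ^ k)) *
      additive_twist g q (\<lambda>n. cnj (\<psi> n)) (1 / (real (p * q\<^sup>2) * y))"
      using prim qp y X by (rule additive_twist_reflection)
    then show "additive_twist f q \<psi> y = A * of_real (y powr (- real k)) *
        additive_twist g q (\<lambda>n. cnj (\<psi> n)) (1 / (M * y))"
      by (simp only: eq M_def A_def mult.assoc)
  qed
  \<comment> \<open>Split off M^(k/2) = p^(k/2) q^k, which cancels the denominator inside
    \<open>A\<close>.\<close>
  also have "of_real M powr (of_nat k - s) = of_real (real p ^ (k div 2) * real q ^ k) * of_nat (p * q\<^sup>2) powr (of_nat k / 2 - s)"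
  proof -
    obtain j where j: "k = 2 * j" using k by (elim evenE)
    have M0: "(of_real M :: complex) \<noteq> 0" using M by simp
    have "of_nat k - s = of_nat j + (of_nat k / 2 - s)" by (simp add: j)
    then have "(of_real M :: complex) powr (of_nat k - s) = of_real M powr of_nat j * of_real M powr (of_nat k / 2 - s)"
      by (simp only: powr_add)
    also have "(of_real M :: complex) powr of_nat j = of_real (real p ^ (k div 2) * real q ^ k)"
      using M0 by (simp add: powr_nat' M_def j power_mult_distrib power_mult)
    finally have "(of_real M :: complex) powr (of_nat k - s) =
        of_real (real p ^ (k div 2) * real q ^ k) * of_real M powr (of_nat k / 2 - s)" .
    moreover have "(of_real M :: complex) = of_nat (p * q\<^sup>2)" by (simp add: M_def)
    ultimately show ?thesis by (simp only:)
  qed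
  finally have eq: "mellin (additive_twist f q \<psi>) s = A * (of_real (real p ^ (k div 2) * real q ^ k) *
      of_nat (p * q\<^sup>2) powr (of_nat k / 2 - s)) * mellin (additive_twist g q (\<lambda>n. cnj (\<psi> n))) (of_nat k - s)" .
  define R where "R = (of_real (real p ^ (k div 2) * real q ^ k) :: complex)"
  have "R \<noteq> 0" using p qpos by (simp add: R_def)
  moreover have "A = X * \<psi> (int p) * ((gauss_sum q \<psi>)\<^sup>2 / of_nat q) * (\<i> ^ k / R)" by (simp only: A_def R_def)
  ultimately have "A * R = \<i> ^ k * X * \<psi> (int p) * ((gauss_sum q \<psi>)\<^sup>2 / of_nat q)" by simp
  then show ?thesis unfolding eq R_def[symmetric] by (simp only: mult.assoc[symmetric])
qed

text \<open>Replacing t by 1/(p q^2 t) solves the relation for \<open>g\<close> and exchanges u and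
  c. The two normalising factors are then inverse to each other, and
  \<open>\<i> ^ k * \<i> ^ k\<close> is 1 as k is even.\<close>

lemma swapped:
  assumes k: "even k" and cont_g: "continuous_on upper_half_plane g"
  shows "fricke_pair p k g f D"
proof (unfold_locales)
  fix q u c :: nat assume q: "q > 0" and dvd: "int q dvd int p * int u * int c + 1"
  have "int q dvd int p * int c * int u + 1" using dvd by (simp add: mult_ac)
  from rel[OF q this] obtain \<omega> where \<omega>: "cmod \<omega> = 1"
    "\<And>t. t > 0 \<Longrightarrow> f (of_nat c / of_nat q + \<i> * of_real t) =
        \<omega> * \<i> ^ k / of_real (real p ^ (k div 2) * (real q * t) ^ k) *
        g (of_nat u / of_nat q + \<i> * of_real (1 / (real (p * q\<^sup>2) * t)))" by blast
  have "g (of_nat u / of_nat q + \<i> * of_real t) = inverse \<omega> * \<i> ^ k / of_real (real p ^ (k div 2) * (real q * t) ^ k) *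
        f (of_nat c / of_nat q + \<i> * of_real (1 / (real (p * q\<^sup>2) * t)))" if t: "t > 0" for t
  proof -
    define t' where "t' = 1 / (real (p * q\<^sup>2) * t)"
    have t': "t' > 0" "1 / (real (p * q\<^sup>2) * t') = t" using p q t by (auto simp: t'_def)
    define P Q where "P = (of_real (real p ^ (k div 2) * (real q * t') ^ k) :: complex)"
      and "Q = (of_real (real p ^ (k div 2) * (real q * t) ^ k) :: complex)"
    obtain j where j: "k = 2 * j" using k by (elim evenE)
    have "real p ^ j * real p ^ j = real p ^ k" by (simp add: j mult_2 power_add)
    moreover have "(real p ^ j * (real q * t') ^ k) * (real p ^ j * (real q * t) ^ k)
        = (real p ^ j * real p ^ j) * (real q * t') ^ k * (real q * t) ^ k" by (simp only: mult_ac)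
    ultimately have "(real p ^ j * (real q * t') ^ k) * (real p ^ j * (real q * t) ^ k)
        = (real p * (real q * t') * (real q * t)) ^ k" by (simp only: power_mult_distrib)
    also have "real p * (real q * t') * (real q * t) = 1"
      using p q t by (simp add: t'_def power2_eq_square)
    finally have "P * Q = 1" unfolding P_def Q_def by (simp add: j flip: of_real_mult del: mult_eq_1_iff)
    then have Q: "inverse P = Q" by (metis inverse_unique mult.commute)
    have ik: "\<i> ^ k * \<i> ^ k = (1 :: complex)" by (simp add: j power_mult power_mult_distrib[symmetric])
    have \<omega>0: "\<omega> \<noteq> 0" using \<omega>(1) by auto
    have "f (of_nat c / of_nat q + \<i> * of_real t') = \<omega> * \<i> ^ k / P * g (of_nat u / of_nat q + \<i> * of_real t)"
      using \<omega>(2)[OF t'(1)] unfolding t'(2) P_def .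
    then have "inverse \<omega> * \<i> ^ k / Q * f (of_nat c / of_nat q + \<i> * of_real t')
        = (inverse \<omega> * \<omega>) * (\<i> ^ k * \<i> ^ k) * (inverse P * inverse Q) * g (of_nat u / of_nat q + \<i> * of_real t)"
      by (simp only: divide_inverse mult_ac)
    also have "inverse P * inverse Q = 1" using \<open>P * Q = 1\<close> by (metis inverse_mult_distrib inverse_1)
    finally show ?thesis using \<omega>0 ik by (simp add: Q_def t'_def)
  qed
  then show "\<exists>\<omega>. cmod \<omega> = 1 \<and> (\<forall>t>0. g (of_nat u / of_nat q + \<i> * of_real t) =
        \<omega> * \<i> ^ k / of_real (real p ^ (k div 2) * (real q * t) ^ k) *
        f (of_nat c / of_nat q + \<i> * of_real (1 / (real (p * q\<^sup>2) * t))))"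
    using \<omega>(1) by (intro exI[of _ "inverse \<omega>"]) (auto simp: norm_inverse)
qed (use p cont_g f_top g_top in auto)

lemma twisted_series_continuation:
  assumes f: "\<And>z. Im z > 0 \<Longrightarrow> (\<lambda>n. a (Suc n) * e (of_nat (Suc n) * z)) sums f z"
    and a: "\<And>n. n \<ge> 1 \<Longrightarrow> cmod (a n) \<le> B * real n ^ k"
    and prim: "primitive_character q \<psi>" and qp: "coprime q p"
  shows "entire_continuation (real k + 1) (completed_L a \<psi>) (mellin (twisted_series a \<psi>))"
    and "bounded_in_vertical_strips (mellin (twisted_series a \<psi>))"
proof -
  have psi: "dirichlet_character q \<psi>" using prim by (simp add: primitive_character_def)
  have decay: "rapid_decay (twisted_series a \<psi>)"
    using additive_twist_rapid_decay[OF prim qp] twisted_series_eq_additive_twist[OF prim _ f]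
    by (subst rapid_decay_cong[of _ "additive_twist f q \<psi>"]) auto
  have "mellin (twisted_series a \<psi>) s = completed_L a \<psi> s" if s: "Re s > real k + 1" for s
  proof -
    have "mellin (twisted_series a \<psi>) s = of_real (2 * pi) powr (- s) * Gamma s *
        (\<Sum>n. a (Suc n) * \<psi> (int (Suc n)) * of_nat (Suc n) powr (- s))"
    proof (rule mellin_dirichlet_series[OF _ s])
      fix n
      have "cmod (a (Suc n)) * cmod (\<psi> (int (Suc n))) \<le> cmod (a (Suc n)) * 1"
        by (intro mult_left_mono norm_character_le[OF psi]) simp
      then show "cmod (a (Suc n) * \<psi> (int (Suc n))) \<le> B * real (Suc n) ^ k"
        using a[of "Suc n"] by (simp add: norm_mult)
    qed (simp add: twisted_series_def)
    then show ?thesis by (simp only: completed_L_def twisted_L_def)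
  qed
  then show "entire_continuation (real k + 1) (completed_L a \<psi>) (mellin (twisted_series a \<psi>))"
    unfolding entire_continuation_def using mellin_holomorphic[OF decay] by blast
  show "bounded_in_vertical_strips (mellin (twisted_series a \<psi>))" by (rule mellin_bounded[OF decay])
qed

end

section \<open>Forms with a multiplier of infinite order\<close>

text \<open>Quadruples let products and residues be computed by simplification;
  \<open>int^2^2\<close> returns only where membership in \<open>cusp_forms\<close> is
  applied.\<close>

type_synonym mat2 = "int \<times> int \<times> int \<times> int"

fun mat2_mult :: "mat2 \<Rightarrow> mat2 \<Rightarrow> mat2" where
  "mat2_mult (a, b, c, d) (a', b', c', d') = (a * a' + b * c', a * b' + b * d', c * a' + d * c', c * b' + d * d')"

fun mat2_det :: "mat2 \<Rightarrow> int" where "mat2_det (a, b, c, d) = a * d - b * c"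

fun mat2_adj :: "mat2 \<Rightarrow> mat2" where "mat2_adj (a, b, c, d) = (d, - b, - c, a)"

fun mat2_mod :: "int \<Rightarrow> mat2 \<Rightarrow> mat2" where
  "mat2_mod N (a, b, c, d) = (a mod N, b mod N, c mod N, d mod N)"

definition mat2_pow :: "mat2 \<Rightarrow> nat \<Rightarrow> mat2" where
  "mat2_pow X n = (mat2_mult X ^^ n) (1, 0, 0, 1)"

lemma mat2_mult_assoc: "mat2_mult (mat2_mult X Y) Z = mat2_mult X (mat2_mult Y Z)"
  by (cases X; cases Y; cases Z) (simp add: algebra_simps)

lemma mat2_mult_1: "mat2_mult (1, 0, 0, 1) X = X" "mat2_mult X (1, 0, 0, 1) = X"
  by (cases X; simp)+

lemma mat2_det_mult: "mat2_det (mat2_mult X Y) = mat2_det X * mat2_det Y"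
  by (cases X; cases Y) (simp add: algebra_simps)

lemma mat2_pow_Suc: "mat2_pow X (Suc n) = mat2_mult X (mat2_pow X n)"
  by (simp add: mat2_pow_def)

lemma mat2_pow_add: "mat2_pow X (m + n) = mat2_mult (mat2_pow X m) (mat2_pow X n)"
proof (induction m)
  case 0
  then show ?case by (simp add: mat2_pow_def mat2_mult_1)
next
  case (Suc m)
  then show ?case by (simp add: mat2_pow_Suc mat2_mult_assoc)
qed

lemma mat2_det_pow: "mat2_det X = 1 \<Longrightarrow> mat2_det (mat2_pow X n) = 1"
  by (induction n) (simp_all add: mat2_pow_Suc mat2_det_mult, simp add: mat2_pow_def)

lemma mat2_mult_adj: "mat2_det X = 1 \<Longrightarrow> mat2_mult X (mat2_adj X) = (1, 0, 0, 1)"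
  by (cases X) (simp add: algebra_simps)

lemma mat2_mod_mult_cong:
  assumes "mat2_mod N X = mat2_mod N Y"
  shows "mat2_mod N (mat2_mult X Z) = mat2_mod N (mat2_mult Y Z)"
proof -
  obtain a b c d where X: "X = (a, b, c, d)" by (cases X)
  obtain a' b' c' d' where Y: "Y = (a', b', c', d')" by (cases Y)
  obtain x y z w where Z: "Z = (x, y, z, w)" by (cases Z)
  have "a mod N = a' mod N" "b mod N = b' mod N" "c mod N = c' mod N" "d mod N = d' mod N"
    using assms by (simp_all add: X Y)
  then show ?thesis unfolding X Y Z by (auto intro!: mod_add_cong mod_mult_cong)
qed

text \<open>Only finitely many residue matrices exist, so two powers agree modulo N; multiplying by
  the adjugate of the lower one cancels it.\<close>

lemma mat2_pow_mod_1:
  assumes det: "mat2_det X = 1" and N: "N > 0"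
  obtains n where "n > 0" "mat2_mod N (mat2_pow X n) = mat2_mod N (1, 0, 0, 1)"
proof -
  let ?A = "{0..<N} \<times> {0..<N} \<times> {0..<N} \<times> {0..<N}"
  have "(\<lambda>n. mat2_mod N (mat2_pow X n)) ` UNIV \<subseteq> ?A"
  proof
    fix Y assume "Y \<in> (\<lambda>n. mat2_mod N (mat2_pow X n)) ` UNIV"
    then obtain n where "Y = mat2_mod N (mat2_pow X n)" by blast
    then show "Y \<in> ?A" using N by (cases "mat2_pow X n") simp
  qed
  then have "finite (range (\<lambda>n. mat2_mod N (mat2_pow X n)))" by (rule finite_subset) simp
  then have "\<not> inj (\<lambda>n. mat2_mod N (mat2_pow X n))" using finite_imageD infinite_UNIV_nat by blast
  then obtain i j where ij: "i < j" "mat2_mod N (mat2_pow X i) = mat2_mod N (mat2_pow X j)"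
    unfolding inj_def by (metis linorder_neqE_nat)
  have "mat2_pow X j = mat2_mult (mat2_pow X (j - i)) (mat2_pow X i)"
    using mat2_pow_add[of X "j - i" i] ij(1) by simp
  then have "mat2_pow X (j - i) = mat2_mult (mat2_pow X j) (mat2_adj (mat2_pow X i))"
    by (simp add: mat2_mult_assoc mat2_mult_adj[OF mat2_det_pow[OF det]] mat2_mult_1)
  then have "mat2_mod N (mat2_pow X (j - i)) = mat2_mod N (mat2_mult (mat2_pow X i) (mat2_adj (mat2_pow X i)))"
    using mat2_mod_mult_cong[OF ij(2)] by simp
  then have "mat2_mod N (mat2_pow X (j - i)) = mat2_mod N (1, 0, 0, 1)"
    by (simp only: mat2_mult_adj[OF mat2_det_pow[OF det]])
  then show ?thesis using that[of "j - i"] ij(1) by simp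
qed

lemma int_moebius:
  fixes a b c d :: int
  assumes det: "a * d - b * c = 1" and z: "Im z > 0"
  shows "of_int c * z + of_int d \<noteq> (0::complex)"
    and "Im ((of_int a * z + of_int b) / (of_int c * z + of_int d)) > 0"
proof -
  show nz: "of_int c * z + of_int d \<noteq> (0::complex)"
  proof
    assume 0: "of_int c * z + of_int d = (0::complex)"
    then have "real_of_int c * Im z = 0" by (simp add: complex_eq_iff)
    then have "c = 0" using z by simp
    then have "d = 0" using 0 by simp
    then show False using \<open>c = 0\<close> det by simp
  qed
  have "of_int (a * d - b * c) = (1::real)" using det by simp
  then have rdet: "real_of_int a * real_of_int d - real_of_int b * real_of_int c = 1" by simp
  let ?w = "of_int c * z + of_int d :: complex"
  have pos: "(Re ?w)\<^sup>2 + (Im ?w)\<^sup>2 > 0"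
    using nz by (auto simp: complex_eq_iff sum_power2_gt_zero_iff)
  have "Im ((of_int a * z + of_int b) / ?w) =
      (Im (of_int a * z + of_int b) * Re ?w - Re (of_int a * z + of_int b) * Im ?w) / ((Re ?w)\<^sup>2 + (Im ?w)\<^sup>2)"
    by (rule Im_divide)
  also have "Im (of_int a * z + of_int b) * Re ?w - Re (of_int a * z + of_int b) * Im ?w
     = Im z * (real_of_int a * real_of_int d - real_of_int b * real_of_int c)"
    by (simp add: algebra_simps)
  also have "\<dots> = Im z" unfolding rdet by simp
  finally have "Im ((of_int a * z + of_int b) / ?w) = Im z / ((Re ?w)\<^sup>2 + (Im ?w)\<^sup>2)" .
  then show "Im ((of_int a * z + of_int b) / ?w) > 0" using divide_pos_pos[OF z pos] by (simp only:)
qed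

fun mat2_act :: "mat2 \<Rightarrow> complex \<Rightarrow> complex" where
  "mat2_act (a, b, c, d) z = (of_int a * z + of_int b) / (of_int c * z + of_int d)"

fun mat2_factor :: "mat2 \<Rightarrow> complex \<Rightarrow> complex" where
  "mat2_factor (a, b, c, d) z = of_int c * z + of_int d"

lemma mat2_act_upper: "mat2_det X = 1 \<Longrightarrow> Im z > 0 \<Longrightarrow> Im (mat2_act X z) > 0"
  by (cases X) (simp only: mat2_det.simps mat2_act.simps int_moebius)

lemma mat2_factor_nonzero: "mat2_det X = 1 \<Longrightarrow> Im z > 0 \<Longrightarrow> mat2_factor X z \<noteq> 0"
  by (cases X) (simp only: mat2_det.simps mat2_factor.simps int_moebius not_False_eq_True)

lemma mat2_cocycle:
  assumes "mat2_det Y = 1" "Im z > 0" "mat2_det X = 1"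
  shows "mat2_factor (mat2_mult X Y) z = mat2_factor X (mat2_act Y z) * mat2_factor Y z"
    and "mat2_act (mat2_mult X Y) z = mat2_act X (mat2_act Y z)"
proof -
  obtain a b c d where X: "X = (a, b, c, d)" by (cases X)
  obtain a' b' c' d' where Y: "Y = (a', b', c', d')" by (cases Y)
  have nz: "of_int c' * z + of_int d' \<noteq> (0::complex)"
    using mat2_factor_nonzero[OF assms(1,2)] by (simp add: Y)
  define w x where "w = (of_int c' * z + of_int d' :: complex)" and "x = (of_int a' * z + of_int b' :: complex)"
  have fr: "\<alpha> * (x / w) + \<beta> = (\<alpha> * x + \<beta> * w) / w" for \<alpha> \<beta> :: complex
    using nz by (simp add: w_def[symmetric] add_divide_distrib)
  have act: "mat2_act Y z = x / w" by (simp add: Y x_def w_def)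
  have factor: "mat2_factor X (x / w) = (of_int c * x + of_int d * w) / w" by (simp only: X mat2_factor.simps fr)
  have mult: "mat2_factor (mat2_mult X Y) z = of_int c * x + of_int d * w"
    "mat2_act (mat2_mult X Y) z = (of_int a * x + of_int b * w) / (of_int c * x + of_int d * w)"
    by (simp_all add: X Y x_def w_def algebra_simps)
  show "mat2_factor (mat2_mult X Y) z = mat2_factor X (mat2_act Y z) * mat2_factor Y z"
    using nz unfolding act factor mult by (simp add: Y w_def)
  show "mat2_act (mat2_mult X Y) z = mat2_act X (mat2_act Y z)"
    using nz unfolding act mult(2) by (simp only: X mat2_act.simps fr) (simp add: w_def)
qed

lemma powi_norm_inj:
  fixes x y :: complex and m :: int
  assumes "cmod x < cmod y" "x \<noteq> 0" "m \<noteq> 0" shows "x powi m \<noteq> y powi m"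
proof
  assume eq: "x powi m = y powi m"
  have "x ^ nat \<bar>m\<bar> = y ^ nat \<bar>m\<bar>"
    using eq assms(3) by (auto simp: power_int_def power_inverse split: if_splits)
  then have "cmod x ^ nat \<bar>m\<bar> = cmod y ^ nat \<bar>m\<bar>" by (metis norm_power)
  moreover have "cmod x ^ nat \<bar>m\<bar> < cmod y ^ nat \<bar>m\<bar>" using assms by (intro power_strict_mono) auto
  ultimately show False by simp
qed

text \<open>
  Some power \<open>E\<close> of the matrix lies in \<open>\<Gamma>(N)\<close>, and comparing the two transformation laws under \<open>E\<close> forces
  \<open>(c z + d)\<^bsup>k - l\<^esup>\<close> to be the constant \<open>\<omega>\<^bsup>- n\<^esup>\<close> wherever \<open>F\<close> does not vanish.
\<close>

lemma not_cusp_form: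
  fixes a b c d :: int and \<omega> :: complex
  assumes det: "a * d - b * c = 1"
    and trans: "\<And>z. Im z > 0 \<Longrightarrow> F ((of_int a * z + of_int b) / (of_int c * z + of_int d)) =
      \<omega> * (of_int c * z + of_int d) ^ k * F z"
    and \<omega>: "\<And>n::nat. n > 0 \<Longrightarrow> \<omega> ^ n \<noteq> 1"
    and z0: "Im z0 > 0" "F z0 \<noteq> 0"
    and N: "N \<ge> 1"
  shows "F \<notin> cusp_forms l N"
proof
  assume F: "F \<in> cusp_forms l N"
  define X :: mat2 where "X = (a, b, c, d)"
  have detX: "mat2_det X = 1" using det by (simp add: X_def)
  have pow: "F (mat2_act (mat2_pow X n) z) = \<omega> ^ n * mat2_factor (mat2_pow X n) z ^ k * F z" if "Im z > 0" for n z
  proof (induction n)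
    case 0
    then show ?case by (simp add: mat2_pow_def)
  next
    case (Suc n)
    let ?Y = "mat2_pow X n"
    note detY = mat2_det_pow[OF detX, of n]
    have "F (mat2_act (mat2_pow X (Suc n)) z) = F (mat2_act X (mat2_act ?Y z))"
      unfolding mat2_pow_Suc mat2_cocycle(2)[OF detY that detX] ..
    also have "\<dots> = \<omega> * mat2_factor X (mat2_act ?Y z) ^ k * F (mat2_act ?Y z)"
      using trans[OF mat2_act_upper[OF detY that]] by (simp add: X_def)
    also have "\<dots> = \<omega> ^ Suc n * (mat2_factor X (mat2_act ?Y z) * mat2_factor ?Y z) ^ k * F z"
      unfolding Suc.IH by (simp add: power_mult_distrib mult_ac)
    finally show ?case unfolding mat2_pow_Suc mat2_cocycle(1)[OF detY that detX] .
  qed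
  obtain n where n: "n > 0" "mat2_mod (int N) (mat2_pow X n) = mat2_mod (int N) (1, 0, 0, 1)"
    using mat2_pow_mod_1[OF detX, of "int N"] N by (metis of_nat_0_less_iff zero_less_one order_less_le_trans)
  obtain a' b' c' d' where E: "mat2_pow X n = (a', b', c', d')" by (cases "mat2_pow X n")
  have detE: "a' * d' - b' * c' = 1" using mat2_det_pow[OF detX, of n] by (simp add: E)
  define \<gamma> :: "int^2^2" where "\<gamma> = (\<chi> i j. if i = 1 then (if j = 1 then a' else b') else (if j = 1 then c' else d'))"
  have \<gamma>: "\<gamma> $ 1 $ 1 = a'" "\<gamma> $ 1 $ 2 = b'" "\<gamma> $ 2 $ 1 = c'" "\<gamma> $ 2 $ 2 = d'" by (simp_all add: \<gamma>_def)
  have "\<gamma> \<in> principal_congruence_subgroup N"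
    using detE n(2) unfolding principal_congruence_subgroup_def SL2Z_def
    by (simp add: det_2 \<gamma> forall_2 mat_def cong_def E)
  then have inv: "slash l F \<gamma> z = F z" if "Im z > 0" for z
    using F that unfolding cusp_forms_def upper_half_plane_def by blast
  let ?j = "\<lambda>z. of_int c' * z + of_int d' :: complex"
  have const: "?j z powi (int k - l) = inverse (\<omega> ^ n)" if z: "Im z > 0" "F z \<noteq> 0" for z
  proof -
    have j: "?j z \<noteq> 0" using int_moebius(1)[OF detE z(1)] .
    have "?j z powi (- l) * (\<omega> ^ n * ?j z ^ k * F z) = F z"
      using inv[OF z(1)] pow[OF z(1), of n] by (simp add: slash_def automorphy_factor_def moebius_def \<gamma> E)
    then have "(?j z powi (- l) * ?j z ^ k) * \<omega> ^ n = 1" using z(2) by (simp add: mult_ac)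
    moreover have "?j z powi (- l) * ?j z ^ k = ?j z powi (int k - l)"
      using j by (simp add: power_int_diff power_int_minus divide_inverse mult.commute)
    ultimately show ?thesis by (metis inverse_unique mult.commute)
  qed
  show False
  proof (cases "c' = 0 \<or> int k = l")
    case True
    \<comment> \<open>The automorphy factor contributes only a sign here, so the power 2 n of
      \<open>\<omega>\<close> would be 1.\<close>
    have "?j z0 powi (int k - l) = 1 \<or> ?j z0 powi (int k - l) = - 1"
    proof (cases "int k = l")
      case False
      then have c': "c' = 0" using True by simp
      then have "a' * d' = 1" using detE by simp
      then have "d' = 1 \<or> d' = - 1" by (simp add: zmult_eq_1_iff) blast
      then have "?j z0 = 1 \<or> ?j z0 = - 1" using c' by auto
      moreover have "(- 1 :: complex) powi m = 1 \<or> (- 1 :: complex) powi m = - 1" for m :: int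
        by (cases "even m") (simp_all add: power_int_minus_left)
      ultimately show ?thesis by (metis power_int_1_left)
    qed simp
    then have "inverse (\<omega> ^ n) = 1 \<or> inverse (\<omega> ^ n) = - 1" using const[OF z0] by simp
    then have "\<omega> ^ n = 1 \<or> \<omega> ^ n = - 1" by (metis inverse_inverse_eq inverse_1 inverse_minus_eq)
    then have "\<omega> ^ (n * 2) = 1" unfolding power_mult by auto
    then show False using \<omega>[of "n * 2"] n(1) by simp
  next
    case False
    have hol: "F holomorphic_on upper_half_plane" using F by (simp add: cusp_forms_def)
    have op: "open upper_half_plane" unfolding upper_half_plane_def by (rule open_halfspace_Im_gt)
    have "z0 \<in> upper_half_plane" using z0 by (simp add: upper_half_plane_def)
    then have "isCont F z0"
      using hol op holomorphic_on_imp_continuous_on continuous_on_eq_continuous_at by blast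
    then have "eventually (\<lambda>z. F z \<noteq> 0) (at z0)"
      using z0(2) by (intro tendsto_imp_eventually_ne) (auto simp: isCont_def)
    then obtain \<delta> where \<delta>: "\<delta> > 0" "\<And>z. z \<noteq> z0 \<Longrightarrow> dist z z0 < \<delta> \<Longrightarrow> F z \<noteq> 0"
      unfolding eventually_at by blast
    \<comment> \<open>A nearby point straight above \<open>z0\<close> has a strictly larger |c' z +
      d'|, so a nonzero power of this factor cannot be constant.\<close>
    define z1 where "z1 = z0 + \<i> * of_real (\<delta> / 2)"
    have "dist z1 z0 < \<delta>" using \<delta>(1) by (simp add: z1_def dist_norm norm_mult)
    moreover have "z1 \<noteq> z0" using \<delta>(1) by (simp add: z1_def)
    ultimately have z1: "F z1 \<noteq> 0" using \<delta>(2) by blast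
    have Im_z1: "Im z1 > Im z0" using \<delta>(1) by (simp add: z1_def)
    then have "?j z0 powi (int k - l) = ?j z1 powi (int k - l)"
      using const[OF z0] const[OF _ z1] z0(1) by simp
    moreover have "cmod (?j z0) < cmod (?j z1)"
    proof -
      have "(real_of_int c' * Im z0)\<^sup>2 < (real_of_int c' * Im z1)\<^sup>2"
        using False Im_z1 z0(1) by (simp add: power_mult_distrib power_strict_mono)
      moreover have "Re z1 = Re z0" by (simp add: z1_def)
      ultimately show ?thesis unfolding cmod_def by (intro real_sqrt_less_mono) simp
    qed
    ultimately show False
      using powi_norm_inj[of "?j z0" "?j z1" "int k - l"] int_moebius(1)[OF detE z0(1)] False by simp
  qed
qed

section \<open>The construction\<close>

text \<open>
  The weight \<open>V c d = exp (\<i> H c d)\<close> attached to a row \<open>(c, d)\<close>; on the bottom rows of \<open>\<Gamma>\<^sub>0(p)\<close> it is a unitary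
  character.
\<close>

locale row_character =
  fixes p k :: nat and chi :: "int \<Rightarrow> complex" and V :: "int \<Rightarrow> int \<Rightarrow> complex"
  assumes p: "prime p" "p \<ge> 27"
    and chi: "dirichlet_character p chi" "chi (- 1) = 1"
    and k: "even k" "k \<ge> 16"
    and V_norm: "cmod (V c d) = 1"
    and V_minus: "V (- c) (- d) = V c d"
    and V_mult: "a * d - b * c = 1 \<Longrightarrow> int p dvd c \<Longrightarrow> coprime x y \<Longrightarrow>
      V (x * a + y * c) (x * b + y * d) = V x y * V c d"
    and V_small: "a * d - b * c = 1 \<Longrightarrow> int p dvd c \<Longrightarrow> 1 \<le> d \<Longrightarrow> 3 * d\<^sup>2 + 24 \<le> int p \<Longrightarrow> V c d = 1"
    and V_inf: "\<exists>a b c d. a * d - b * c = 1 \<and> int p dvd c \<and> (\<forall>n>0. V c d ^ n \<noteq> 1)"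
begin

text \<open>Coprime rows with p dividing c are the bottom rows of \<Gamma>_0(p), which give the
  series for the cusp infinity. The complementary coprime rows in \<open>w\<^sub>2\<close> give the
  series for the cusp 0.\<close>

definition w\<^sub>1 :: "int \<Rightarrow> int \<Rightarrow> complex" where
  "w\<^sub>1 c d = (if coprime c d \<and> int p dvd c then cnj (chi d) * V c d else 0)"

definition w\<^sub>2 :: "int \<Rightarrow> int \<Rightarrow> complex" where
  "w\<^sub>2 c d = (if coprime c d \<and> \<not> int p dvd c then 1 else 0)"

definition f :: "complex \<Rightarrow> complex" where
  "f z = eis w\<^sub>1 8 z * eis w\<^sub>2 (k - 8) z"

text \<open>The power of p is half of the factor p^k produced by the Fricke substitution; it gives
  \<open>f_fricke\<close> the balanced factor p^(k/2) z^k.\<close>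

definition g :: "complex \<Rightarrow> complex" where
  "g z = of_nat p ^ (k div 2) * (eis (fricke_weight p w\<^sub>1) 8 z * eis (fricke_weight p w\<^sub>2) (k - 8) z)"

text \<open>Inverse to the character in \<open>w\<^sub>1\<close>: in \<open>eis_moebius\<close> the
  multiplier compensates for what the weight picks up.\<close>

definition mult :: "int \<Rightarrow> int \<Rightarrow> complex" where
  "mult c d = chi d * cnj (V c d)"

section \<open>Transformation laws under \<Gamma>_0(p) and the Fricke involution\<close>

lemma pp: "p > 0" "int p > 0" using p by auto

lemma p_not_unit: "\<not> is_unit (int p)" using p by simp

lemma V_cnj: "V c d * cnj (V c d) = 1"
  using V_norm[of c d] complex_norm_square[of "V c d"] by simp

lemma coprime_p_if_det:
  assumes "a * d - b * c = 1" "int p dvd c"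
  shows "coprime d (int p)" "\<not> int p dvd a"
proof -
  have "coprime c d" by (rule det_1_coprime(4)[OF assms(1)])
  then have "coprime (int p) d" using assms(2) coprime_divisors[of "int p" c d d] by simp
  then show "coprime d (int p)" by (simp add: coprime_commute)
  show "\<not> int p dvd a"
  proof
    assume "int p dvd a"
    then have "int p dvd a * d - b * c" using assms(2) by (intro dvd_diff dvd_mult dvd_mult2) auto
    then show False using assms(1) p_not_unit by simp
  qed
qed

lemma chi_1: "chi 1 = 1" by (rule character_1[OF chi(1)])

lemma admissible_w: "admissible_weight w\<^sub>1" "admissible_weight w\<^sub>2"
proof -
  have "cmod (chi d) * cmod (V c d) \<le> 1" for c d
    using norm_character_le[OF chi(1), of d] V_norm by simp
  then show "admissible_weight w\<^sub>1" by (auto simp: admissible_weight_def w\<^sub>1_def norm_mult)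
  show "admissible_weight w\<^sub>2" by (auto simp: admissible_weight_def w\<^sub>2_def)
qed

lemma row_action:
  assumes det: "a * d - b * c = 1" and c: "int p dvd c"
  shows "coprime (u * a + v * c) (u * b + v * d) \<longleftrightarrow> coprime u v"
    and "int p dvd u * a + v * c \<longleftrightarrow> int p dvd u"
proof -
  let ?u = "u * a + v * c" and ?v = "u * b + v * d"
  have "?u * d - ?v * c = u * (a * d - b * c)" "?v * a - ?u * b = v * (a * d - b * c)" by (simp_all add: algebra_simps)
  then have uv: "u = ?u * d - ?v * c" "v = ?v * a - ?u * b" unfolding det by simp_all
  have "g dvd u \<and> g dvd v \<longleftrightarrow> g dvd ?u \<and> g dvd ?v" for g
  proof
    assume "g dvd u \<and> g dvd v"
    then show "g dvd ?u \<and> g dvd ?v" by (auto intro: dvd_add dvd_mult2)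
  next
    assume "g dvd ?u \<and> g dvd ?v"
    then have "g dvd ?u * d - ?v * c" "g dvd ?v * a - ?u * b" by (auto intro!: dvd_diff dvd_mult2)
    then show "g dvd u \<and> g dvd v" using uv by metis
  qed
  then show "coprime ?u ?v \<longleftrightarrow> coprime u v" by (auto simp: coprime_def)
  have "int p dvd ?u \<longleftrightarrow> int p dvd u * a" using c dvd_add_left_iff[of "int p" "v * c" "u * a"] by simp
  also have "\<dots> \<longleftrightarrow> int p dvd u"
    using coprime_p_if_det(2)[OF det c] prime_dvd_mult_iff[of "int p" u a] p(1) by simp
  finally show "int p dvd ?u \<longleftrightarrow> int p dvd u" .
qed

lemma w\<^sub>1_trans:
  assumes det: "a * d - b * c = 1" and c: "int p dvd c"
  shows "w\<^sub>1 u v = mult c d * w\<^sub>1 (u * a + v * c) (u * b + v * d)"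
proof (cases "coprime u v \<and> int p dvd u")
  case True
  \<comment> \<open>On the support p divides u, so the lower right entry is multiplicative modulo
    p.\<close>
  have "[u * b + v * d = 0 + v * d] (mod int p)"
    using True by (intro cong_add cong_refl) (simp add: cong_0_iff)
  then have "chi (u * b + v * d) = chi v * chi d"
    using character_cong[OF chi(1)] by (simp add: character_mult[OF chi(1), symmetric])
  then have "w\<^sub>1 (u * a + v * c) (u * b + v * d) = cnj (chi v * chi d) * (V u v * V c d)"
    using True by (simp add: w\<^sub>1_def row_action[OF det c] V_mult[OF det c])
  then have "mult c d * w\<^sub>1 (u * a + v * c) (u * b + v * d) =
      (chi d * cnj (chi d)) * (V c d * cnj (V c d)) * (cnj (chi v) * V u v)"
    by (simp add: mult_def mult_ac)
  then show ?thesis using True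
    by (simp add: V_cnj character_cnj_mult[OF chi(1) coprime_p_if_det(1)[OF det c]] w\<^sub>1_def)
next
  case False
  then show ?thesis by (auto simp: w\<^sub>1_def row_action[OF det c])
qed

lemma w\<^sub>2_trans:
  assumes det: "a * d - b * c = 1" and c: "int p dvd c"
  shows "w\<^sub>2 u v = 1 * w\<^sub>2 (u * a + v * c) (u * b + v * d)"
  by (simp add: w\<^sub>2_def row_action[OF det c])

lemma kappa: "4 \<le> (8::nat)" "4 \<le> k - 8" "8 \<le> k - 8" "even (k - 8)" "8 + (k - 8) = k"
  using k by auto

lemma f_moebius:
  assumes det: "a * d - b * c = 1" and c: "int p dvd c" and z: "Im z > 0"
  shows "f ((of_int a * z + of_int b) / (of_int c * z + of_int d)) = mult c d * (of_int c * z + of_int d) ^ k * f z"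
proof -
  let ?j = "of_int c * z + of_int d"
  have "f ((of_int a * z + of_int b) / ?j) =
      (mult c d * ?j ^ 8 * eis w\<^sub>1 8 z) * (1 * ?j ^ (k - 8) * eis w\<^sub>2 (k - 8) z)"
    unfolding f_def
    by (intro arg_cong2[of _ _ _ _ "(*)"] eis_moebius admissible_w kappa det z w\<^sub>1_trans w\<^sub>2_trans c)
  also have "\<dots> = mult c d * (?j ^ 8 * ?j ^ (k - 8)) * f z" by (simp add: f_def mult_ac)
  also have "?j ^ 8 * ?j ^ (k - 8) = ?j ^ k" by (simp only: power_add[symmetric] kappa)
  finally show ?thesis .
qed

lemma f_fricke:
  assumes z: "Im z > 0"
  shows "f (- 1 / (of_nat p * z)) = of_nat p ^ (k div 2) * z ^ k * g z"
proof -
  obtain j where j: "k = 2 * j" using k(1) by (elim evenE)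
  have "f (- 1 / (of_nat p * z)) = ((of_nat p * z) ^ 8 * (of_nat p * z) ^ (k - 8)) *
      (eis (fricke_weight p w\<^sub>1) 8 z * eis (fricke_weight p w\<^sub>2) (k - 8) z)"
    unfolding f_def eis_fricke[OF pp(1) z] by (simp only: mult_ac)
  also have "(of_nat p * z) ^ 8 * (of_nat p * z) ^ (k - 8) = (of_nat p * z) ^ k"
    by (simp only: power_add[symmetric] kappa)
  also have "\<dots> = of_nat p ^ (k div 2) * z ^ k * of_nat p ^ (k div 2)"
    by (simp add: power_mult_distrib j mult_2 power_add)
  finally show ?thesis by (simp add: g_def mult.assoc)
qed

lemma f_periodic: "Im z > 0 \<Longrightarrow> f (z + 1) = f z"
  using f_moebius[of 1 1 1 0 z] V_small[of 1 1 1 0] p(2) chi_1 by (simp add: mult_def)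

lemma Im_fricke: "Im z > 0 \<Longrightarrow> Im (- 1 / (of_nat p * z)) > 0"
proof -
  assume z: "Im z > 0"
  have "Im ((of_int 0 * z + of_int (- 1)) / (of_int 1 * z + of_int 0)) > 0"
    by (rule int_moebius(2)[OF _ z]) simp
  then have "Im (- 1 / z) > 0" by simp
  moreover have "- 1 / (of_nat p * z) = (- 1 / z) / of_real (real p)" by simp
  ultimately show ?thesis using pp(1) by (simp only: Im_divide_of_real divide_pos_pos of_nat_0_less_iff)
qed

text \<open>Conjugation by the Fricke matrix takes the rows (a, b), (p c, d) to (d, - c), (- b p,
  a). So \<open>g\<close> transforms under \<Gamma>_0(p) too, with the multiplier read off from the
  original matrix.\<close>

lemma g_moebius:
  assumes det: "a * d - b * (int p * c) = 1" and z: "Im z > 0"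
  shows "g ((of_int d * z + of_int (- c)) / (of_int (- (b * int p)) * z + of_int a)) =
    mult (int p * c) d * (of_int (- (b * int p)) * z + of_int a) ^ k * g z"
proof -
  define w where "w = - 1 / (of_nat p * z)"
  define z' where "z' = (of_int d * z + of_int (- c)) / (of_int (- (b * int p)) * z + of_int a)"
  have z0: "z \<noteq> 0" "(of_nat p :: complex) \<noteq> 0" using z pp by auto
  have w: "Im w > 0" unfolding w_def by (rule Im_fricke[OF z])
  have det': "d * a - (- c) * (- (b * int p)) = 1" using det by (simp add: algebra_simps)
  let ?j = "of_int (- (b * int p)) * z + of_int a :: complex"
  have j: "?j \<noteq> 0" by (rule int_moebius(1)[OF det' z])
  have z': "Im z' > 0" unfolding z'_def by (rule int_moebius(2)[OF det' z])
  then have z'0: "z' \<noteq> 0" by auto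
  have z'j: "z' * ?j = of_int d * z - of_int c" using j by (simp add: z'_def)
  have e1: "of_int (int p * c) * w + of_int d = z' * ?j / z"
    unfolding z'j using z0 by (simp add: w_def field_simps)
  have e2: "of_int a * w + of_int b = - ?j / (of_nat p * z)"
    using z0 by (simp add: w_def field_simps)
  have "(of_int a * w + of_int b) / (of_int (int p * c) * w + of_int d) = - 1 / (of_nat p * z')"
    unfolding e1 e2 using j z0 z'0 by (simp add: divide_simps)
  then have "f (- 1 / (of_nat p * z')) = mult (int p * c) d * (z' * ?j / z) ^ k * f w"
    using f_moebius[OF det _ w] unfolding e1 by simp
  then have "of_nat p ^ (k div 2) * z' ^ k * g z' =
      mult (int p * c) d * (z' * ?j / z) ^ k * (of_nat p ^ (k div 2) * z ^ k * g z)"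
    unfolding w_def f_fricke[OF z'] f_fricke[OF z] .
  also have "\<dots> = of_nat p ^ (k div 2) * z' ^ k * (mult (int p * c) d * ?j ^ k * g z)"
    using z0 by (simp add: power_mult_distrib power_divide)
  finally have "g z' = mult (int p * c) d * ?j ^ k * g z" using z'0 z0 by simp
  then show ?thesis unfolding z'_def .
qed

text \<open>Translation is the Fricke conjugate of a parabolic matrix fixing the cusp 0, with bottom
  row (- p, 1). \<open>V_small\<close> applies to lower right entry 1 because p >= 27.\<close>

lemma g_periodic: "Im z > 0 \<Longrightarrow> g (z + 1) = g z"
  using g_moebius[of 1 1 0 "- 1" z] V_small[of 1 1 0 "- int p"] p(2) chi_1 by (simp add: mult_def)

section \<open>Growth at the cusps\<close>

lemma f_g_holomorphic: "f holomorphic_on upper_half_plane" "g holomorphic_on upper_half_plane"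
  unfolding f_def g_def
  by (intro holomorphic_intros eis_holomorphic admissible_w admissible_fricke_weight kappa)+

text \<open>At infinity the second factor of \<open>f\<close> vanishes; after the Fricke
  substitution it is the first one, while the second gets a nonzero constant term.\<close>

lemma fricke_w_0: "fricke_weight p w\<^sub>1 0 d = 0" "fricke_weight p w\<^sub>2 0 d = (if \<bar>d\<bar> = 1 then 1 else 0)"
proof -
  have "\<not> (is_unit d \<and> int p dvd d)" using p_not_unit dvd_trans by blast
  then show "fricke_weight p w\<^sub>1 0 d = 0" "fricke_weight p w\<^sub>2 0 d = (if \<bar>d\<bar> = 1 then 1 else 0)"
    by (auto simp: fricke_weight_def w\<^sub>1_def w\<^sub>2_def)
qed

text \<open>At large height one factor is bounded and the other decays; at low height the two power
  bounds multiply. These are the growth hypotheses of \<open>fourier_expansion\<close>.\<close>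

lemma product_bounds:
  assumes w: "admissible_weight w" "admissible_weight w'" and \<kappa>: "8 \<le> \<kappa>" "8 \<le> \<kappa>'"
    and zero: "(\<forall>d. w 0 d = 0) \<or> (\<forall>d. w' 0 d = 0)"
  obtains C where "\<And>z. 0 < Im z \<Longrightarrow> Im z \<le> 1 \<Longrightarrow> \<bar>Re z\<bar> \<le> 1 \<Longrightarrow>
      cmod (eis w \<kappa> z * eis w' \<kappa>' z) \<le> C / Im z ^ (\<kappa> + \<kappa>')"
    "\<And>z. 1 \<le> Im z \<Longrightarrow> \<bar>Re z\<bar> \<le> 1 \<Longrightarrow> cmod (eis w \<kappa> z * eis w' \<kappa>' z) \<le> C / Im z"
proof -
  have \<kappa>4: "4 \<le> \<kappa>" "4 \<le> \<kappa>'" using \<kappa> by auto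
  define S where "S = max 1 lattice_sum"
  have S: "S \<ge> 1" "lattice_sum \<le> S" by (auto simp: S_def)
  define C where "C = (4 ^ \<kappa> * S) * (4 ^ \<kappa>' * S) + (256 * S) * (4 ^ \<kappa> * S) + (256 * S) * (4 ^ \<kappa>' * S)"
  have parts: "0 \<le> (4 ^ \<kappa> * S) * (4 ^ \<kappa>' * S)" "0 \<le> (256 * S) * (4 ^ \<kappa> * S)" "0 \<le> (256 * S) * (4 ^ \<kappa>' * S)"
    using S by auto
  have 1: "cmod (eis w \<kappa> z * eis w' \<kappa>' z) \<le> C / Im z ^ (\<kappa> + \<kappa>')"
    if z: "0 < Im z" "Im z \<le> 1" "\<bar>Re z\<bar> \<le> 1" for z
  proof -
    have "cmod (eis w \<kappa> z) \<le> 4 ^ \<kappa> * S / Im z ^ \<kappa>"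
      by (rule order_trans[OF norm_eis_le[OF w(1) \<kappa>4(1) z]]) (use S z in \<open>intro divide_right_mono mult_left_mono; simp\<close>)
    moreover have "cmod (eis w' \<kappa>' z) \<le> 4 ^ \<kappa>' * S / Im z ^ \<kappa>'"
      by (rule order_trans[OF norm_eis_le[OF w(2) \<kappa>4(2) z]]) (use S z in \<open>intro divide_right_mono mult_left_mono; simp\<close>)
    ultimately have "cmod (eis w \<kappa> z * eis w' \<kappa>' z) \<le> (4 ^ \<kappa> * S / Im z ^ \<kappa>) * (4 ^ \<kappa>' * S / Im z ^ \<kappa>')"
      unfolding norm_mult using S z by (intro mult_mono) auto
    also have "\<dots> = (4 ^ \<kappa> * S) * (4 ^ \<kappa>' * S) / Im z ^ (\<kappa> + \<kappa>')" by (simp add: power_add)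
    also have "\<dots> \<le> C / Im z ^ (\<kappa> + \<kappa>')" using parts z by (intro divide_right_mono) (auto simp: C_def)
    finally show ?thesis .
  qed
  have 2: "cmod (eis w \<kappa> z * eis w' \<kappa>' z) \<le> C / Im z"
    if z: "1 \<le> Im z" "\<bar>Re z\<bar> \<le> 1" for z
  proof -
    have e: "cmod (eis w \<kappa> z) \<le> 4 ^ \<kappa> * S"
      by (rule order_trans[OF norm_eis_le_top[OF w(1) \<kappa>4(1) z]]) (use S in simp)
    have e': "cmod (eis w' \<kappa>' z) \<le> 4 ^ \<kappa>' * S"
      by (rule order_trans[OF norm_eis_le_top[OF w(2) \<kappa>4(2) z]]) (use S in simp)
    have "Im z \<le> Im z ^ 4" using z self_le_power[of "Im z" 4] by simp
    then have small: "256 * lattice_sum / Im z ^ 4 \<le> 256 * S / Im z"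
      using S z lattice_sum_nonneg by (intro frac_le) auto
    from zero show ?thesis
    proof
      assume "\<forall>d. w 0 d = 0"
      then have "cmod (eis w \<kappa> z) \<le> 256 * S / Im z"
        using eis_limit_aux[OF w(1) \<kappa>4(1) z \<kappa>(1)] small by force
      then have "cmod (eis w \<kappa> z * eis w' \<kappa>' z) \<le> (256 * S / Im z) * (4 ^ \<kappa>' * S)"
        unfolding norm_mult using e' S z by (intro mult_mono) auto
      also have "\<dots> = (256 * S) * (4 ^ \<kappa>' * S) / Im z" by simp
      also have "\<dots> \<le> C / Im z" using parts z by (intro divide_right_mono) (auto simp: C_def)
      finally show ?thesis .
    next
      assume "\<forall>d. w' 0 d = 0"
      then have "cmod (eis w' \<kappa>' z) \<le> 256 * S / Im z"
        using eis_limit_aux[OF w(2) \<kappa>4(2) z \<kappa>(2)] small by force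
      then have "cmod (eis w \<kappa> z * eis w' \<kappa>' z) \<le> (4 ^ \<kappa> * S) * (256 * S / Im z)"
        unfolding norm_mult using e S z by (intro mult_mono) auto
      also have "\<dots> = (256 * S) * (4 ^ \<kappa> * S) / Im z" by simp
      also have "\<dots> \<le> C / Im z" using parts z by (intro divide_right_mono) (auto simp: C_def)
      finally show ?thesis .
    qed
  qed
  from that[OF 1 2] show ?thesis by blast
qed

text \<open>For z' on the line over c/q, the matrix with rows (a, u), (p c, q) sends - 1/(p z') to
  the point over u/q. So \<open>f_moebius\<close> followed by \<open>f_fricke\<close> gives the
  relation.\<close>

lemma f_vertical:
  fixes u c q :: nat
  assumes q: "q > 0" and dvd: "int q dvd int p * int u * int c + 1" and t: "t > 0"
  shows "f (of_nat u / of_nat q + \<i> * of_real t) =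
    mult (int p * int c) (int q) * \<i> ^ k / of_real (real p ^ (k div 2) * (real q * t) ^ k) *
    g (of_nat c / of_nat q + \<i> * of_real (1 / (real (p * q\<^sup>2) * t)))"
proof -
  obtain a where a: "int p * int u * int c + 1 = int q * a" using dvd by (elim dvdE)
  then have det: "a * int q - int u * (int p * int c) = 1" by (simp add: algebra_simps)
  have "(of_int (int q * a) :: complex) = of_int (int p * int u * int c + 1)" by (simp only: a)
  then have ac: "of_int a * of_nat q = 1 + of_nat u * (of_nat p * of_nat c :: complex)"
    by (simp add: mult_ac add.commute)
  define P T Q where "P = (of_nat p :: complex)" and "T = (of_real t :: complex)" and "Q = (of_nat q :: complex)"
  have nz: "P \<noteq> 0" "T \<noteq> 0" "Q \<noteq> 0" using pp q t by (auto simp: P_def T_def Q_def)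
  define z' where "z' = of_nat c / of_nat q + \<i> * of_real (1 / (real (p * q\<^sup>2) * t))"
  have Im_z': "Im z' = 1 / (real (p * q\<^sup>2) * t)"
    using Im_divide_of_real[of "of_nat c" "real q"] by (simp add: z'_def)
  then have Im_pos: "Im z' > 0" using pp q t by simp
  then have z'0: "z' \<noteq> 0" by auto
  have z'_eq: "z' = of_nat c / Q + \<i> / (P * Q\<^sup>2 * T)" by (simp add: z'_def P_def Q_def T_def)
  define w where "w = - 1 / (P * z')"
  have w: "Im w > 0" unfolding w_def P_def by (rule Im_fricke[OF Im_pos])
  have qz: "Q * z' - of_nat c = \<i> / (P * Q * T)"
    unfolding z'_eq using nz by (simp add: field_simps power2_eq_square)
  have j: "of_int (int p * int c) * w + of_int (int q) = (\<i> / (P * Q * T)) / z'"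
    unfolding qz[symmetric] using nz z'0 by (simp add: w_def P_def Q_def field_simps)
  have num: "of_int a * w + of_int (int u) = (of_nat u * P * z' - of_int a) / (P * z')"
    using nz z'0 by (simp add: w_def field_simps)
  have "Q * (of_nat u * P * z' - of_int a) = of_nat u * P * (Q * z') - of_int a * Q" by (simp add: algebra_simps)
  also have "Q * z' = of_nat c + \<i> / (P * Q * T)" using qz by (simp add: algebra_simps)
  also have "of_int a * Q = 1 + of_nat u * (P * of_nat c)" using ac by (simp add: P_def Q_def)
  also have "of_nat u * P * (of_nat c + \<i> / (P * Q * T)) - (1 + of_nat u * (P * of_nat c))
      = of_nat u * \<i> / (Q * T) - 1" using nz by (simp add: field_simps)
  finally have num2: "of_nat u * P * z' - of_int a = (of_nat u * \<i> / (Q * T) - 1) / Q"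
    using nz by (simp add: field_simps)
  have act: "(of_int a * w + of_int (int u)) / (of_int (int p * int c) * w + of_int (int q)) = of_nat u / Q + \<i> * T"
    unfolding j num num2 using nz z'0 by (simp add: field_simps)
  have "f (of_nat u / Q + \<i> * T) = mult (int p * int c) (int q) * ((\<i> / (P * Q * T)) / z') ^ k * f w"
    using f_moebius[OF det dvd_triv_left w] unfolding act unfolding j .
  also have "f w = P ^ (k div 2) * z' ^ k * g z'"
    unfolding w_def P_def by (rule f_fricke[OF Im_pos])
  also have "mult (int p * int c) (int q) * ((\<i> / (P * Q * T)) / z') ^ k * (P ^ (k div 2) * z' ^ k * g z')
     = mult (int p * int c) (int q) * (\<i> ^ k * P ^ (k div 2) / (P * Q * T) ^ k) * g z'"
    using z'0 by (simp add: power_divide power_mult_distrib mult_ac)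
  also have "\<i> ^ k * P ^ (k div 2) / (P * Q * T) ^ k = \<i> ^ k / (P ^ (k div 2) * (Q * T) ^ k)"
  proof -
    obtain j where "k = 2 * j" using k(1) by (elim evenE)
    then have "(P * Q * T) ^ k = P ^ (k div 2) * (P ^ (k div 2) * (Q * T) ^ k)"
      by (simp add: power_mult_distrib mult_2 power_add)
    then show ?thesis using nz by simp
  qed
  also have "P ^ (k div 2) * (Q * T) ^ k = of_real (real p ^ (k div 2) * (real q * t) ^ k)"
    by (simp add: P_def Q_def T_def)
  finally show ?thesis by (simp add: P_def Q_def T_def z'_def)
qed

end

section \<open>Multipliers on vertical lines, non-vanishing and infinite order\<close>

context row_character
begin

text \<open>For small q the factor \<open>V\<close> drops out and the multiplier depends on q alone,
  as the functional equation demands. For the other q modulus 1 suffices for decay.\<close>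

lemma vertical_multiplier:
  fixes u c q :: nat
  assumes q: "q > 0" and dvd: "int q dvd int p * int u * int c + 1"
  shows "cmod (mult (int p * int c) (int q)) = 1"
    and "3 * q\<^sup>2 + 24 \<le> p \<Longrightarrow> mult (int p * int c) (int q) = chi (int q)"
proof -
  obtain a where a: "int p * int u * int c + 1 = int q * a" using dvd by (elim dvdE)
  then have det: "a * int q - int u * (int p * int c) = 1" by (simp add: algebra_simps)
  have "cmod (chi (int q)) = 1"
    by (rule norm_character[OF chi(1) coprime_p_if_det(1)[OF det dvd_triv_left]])
  then show "cmod (mult (int p * int c) (int q)) = 1" by (simp add: mult_def norm_mult V_norm)
  assume "3 * q\<^sup>2 + 24 \<le> p"
  then have "int (3 * q\<^sup>2 + 24) \<le> int p" by (simp only: of_nat_le_iff)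
  then have "V (int p * int c) (int q) = 1" using q by (intro V_small[OF det]) auto
  then show "mult (int p * int c) (int q) = chi (int q)" by (simp add: mult_def)
qed

text \<open>At this height the error term is at most 1 and cannot cancel the constant term
  2.\<close>

lemma eis_nonzero_high:
  assumes w: "admissible_weight w" and \<kappa>: "8 \<le> \<kappa>" "even \<kappa>"
    and supp: "\<And>d. \<bar>d\<bar> \<noteq> 1 \<Longrightarrow> w 0 d = 0" and sum: "w 0 1 + w 0 (- 1) = 2"
    and z: "1 + 256 * lattice_sum \<le> Im z" "\<bar>Re z\<bar> \<le> 1"
  shows "eis w \<kappa> z \<noteq> 0"
proof
  assume 0: "eis w \<kappa> z = 0"
  have z1: "1 \<le> Im z" using z(1) lattice_sum_nonneg by linarith
  then have "Im z \<le> Im z ^ 4" using self_le_power[of "Im z" 4] by simp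
  then have "256 * lattice_sum / Im z ^ 4 \<le> 1" using z(1) z1 by (simp add: divide_le_eq)
  moreover have "cmod (eis w \<kappa> z - (w 0 1 + w 0 (- 1))) \<le> 256 * lattice_sum / Im z ^ 4"
    using z1 by (intro eis_constant_term w \<kappa> z supp) auto
  ultimately show False unfolding 0 sum by simp
qed

text \<open>Evenness of \<open>chi\<close> enters here: for an odd character the rows (0, 1) and (0,
  - 1) would cancel.\<close>

lemma w\<^sub>1_0: "\<bar>d\<bar> \<noteq> 1 \<Longrightarrow> w\<^sub>1 0 d = 0" "w\<^sub>1 0 1 + w\<^sub>1 0 (- 1) = 2"
proof -
  have V1: "V 0 1 = 1" using V_small[of 1 1 0 0] p(2) by simp
  moreover have "V 0 (- 1) = 1" using V_minus[of 0 1] V1 by simp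
  ultimately show "w\<^sub>1 0 1 + w\<^sub>1 0 (- 1) = 2" by (simp add: w\<^sub>1_def chi_1 chi(2))
  show "\<bar>d\<bar> \<noteq> 1 \<Longrightarrow> w\<^sub>1 0 d = 0" by (simp add: w\<^sub>1_def)
qed

text \<open>If f were zero, the second factor would vanish high up, where the first does not, hence
  everywhere by analytic continuation. But its Fricke transform has a nonzero constant term.\<close>

lemma f_not_identically_zero: "\<exists>z. Im z > 0 \<and> f z \<noteq> 0"
proof (rule ccontr)
  assume "\<not> ?thesis"
  then have f0: "f z = 0" if "Im z > 0" for z using that by blast
  define Y where "Y = 1 + 256 * lattice_sum"
  have Y: "Y \<ge> 1" using lattice_sum_nonneg by (simp add: Y_def)
  define \<xi> where "\<xi> = \<i> * of_real (Y + 1)"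
  have ball: "Im z > 0 \<and> Y \<le> Im z \<and> \<bar>Re z\<bar> \<le> 1" if "z \<in> ball \<xi> 1" for z
  proof -
    have "cmod (z - \<xi>) < 1" using that by (simp add: dist_norm norm_minus_commute)
    then have "\<bar>Re z\<bar> < 1" "\<bar>Im z - (Y + 1)\<bar> < 1"
      using abs_Re_le_cmod[of "z - \<xi>"] abs_Im_le_cmod[of "z - \<xi>"] by (auto simp: \<xi>_def)
    then show ?thesis using Y by auto
  qed
  have w2_zero: "eis w\<^sub>2 (k - 8) z = 0" if "z \<in> ball \<xi> 1" for z
  proof -
    have "eis w\<^sub>1 8 z \<noteq> 0"
      using ball[OF that] w\<^sub>1_0 by (intro eis_nonzero_high admissible_w) (auto simp: Y_def)
    then show ?thesis using f0[of z] ball[OF that] by (simp add: f_def)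
  qed
  have op: "open upper_half_plane" unfolding upper_half_plane_def by (rule open_halfspace_Im_gt)
  have conn: "connected upper_half_plane"
    unfolding upper_half_plane_def by (intro convex_connected convex_halfspace_Im_gt)
  have \<xi>: "\<xi> \<in> upper_half_plane" using Y by (simp add: \<xi>_def upper_half_plane_def)
  have sub: "ball \<xi> 1 \<subseteq> upper_half_plane" using ball by (auto simp: upper_half_plane_def)
  have lim: "\<xi> islimpt ball \<xi> 1" by (intro interior_limit_point) simp
  have zero: "eis w\<^sub>2 (k - 8) z = 0" if "z \<in> upper_half_plane" for z
    by (rule analytic_continuation[OF eis_holomorphic[OF admissible_w(2) kappa(2)] op conn sub \<xi> lim w2_zero that])
  have "eis (fricke_weight p w\<^sub>2) (k - 8) \<xi> \<noteq> 0"
    by (rule eis_nonzero_high) (use admissible_fricke_weight admissible_w kappa fricke_w_0 in \<open>auto simp: \<xi>_def Y_def\<close>)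
  moreover have "eis w\<^sub>2 (k - 8) (- 1 / (of_nat p * \<xi>)) = (of_nat p * \<xi>) ^ (k - 8) * eis (fricke_weight p w\<^sub>2) (k - 8) \<xi>"
    using \<xi> by (intro eis_fricke pp) (simp add: upper_half_plane_def)
  moreover have "- 1 / (of_nat p * \<xi>) \<in> upper_half_plane"
    using Im_fricke[of \<xi>] \<xi> by (simp only: upper_half_plane_def mem_Collect_eq)
  moreover have "of_nat p * \<xi> \<noteq> 0" using pp \<xi> by (auto simp: upper_half_plane_def)
  ultimately show False using zero by simp
qed

lemma g_not_identically_zero: "\<exists>z. Im z > 0 \<and> g z \<noteq> 0"
proof -
  obtain z where z: "Im z > 0" "f z \<noteq> 0" using f_not_identically_zero by blast
  define z' where "z' = - 1 / (of_nat p * z)"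
  have z': "Im z' > 0" unfolding z'_def by (rule Im_fricke[OF z(1)])
  have "z \<noteq> 0" using z by auto
  then have "- 1 / (of_nat p * z') = z" using pp by (simp add: z'_def)
  then have "g z' \<noteq> 0" using f_fricke[OF z'] z(2) by auto
  with z' show ?thesis by blast
qed

text \<open>Raising to the power totient p removes \<open>chi\<close> and leaves a power of the
  conjugate of \<open>V\<close>.\<close>

lemma mult_infinite_order:
  assumes det: "a * d - b * c = 1" "int p dvd c" and V: "\<And>n::nat. n > 0 \<Longrightarrow> V c d ^ n \<noteq> 1"
    and n: "n > 0"
  shows "mult c d ^ n \<noteq> 1"
proof
  assume 1: "mult c d ^ n = 1"
  have "mult c d ^ (n * totient p) = 1" by (simp add: power_mult 1)
  moreover have "mult c d ^ (n * totient p) = (chi d ^ totient p) ^ n * cnj (V c d ^ (n * totient p))"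
    by (simp add: mult_def power_mult_distrib power_mult[symmetric] mult.commute[of n])
  ultimately have "cnj (V c d ^ (n * totient p)) = 1"
    by (simp only: character_power_totient[OF chi(1) coprime_p_if_det(1)[OF det]] power_one mult_1)
  then have "V c d ^ (n * totient p) = 1" by (metis complex_cnj_cnj complex_cnj_one)
  moreover have "n * totient p > 0" using n pp by simp
  ultimately show False using V by blast
qed

text \<open>Stated for any F that agrees with the form on the upper half-plane, because
  \<open>fourier_series\<close> need not match it elsewhere. For \<open>g\<close> the Fricke
  conjugate of the matrix of infinite order is used.\<close>

lemma not_cusp_form_if_agree:
  assumes N: "N \<ge> 1"
  shows "(\<And>z. Im z > 0 \<Longrightarrow> F z = f z) \<Longrightarrow> F \<notin> cusp_forms l N"
    and "(\<And>z. Im z > 0 \<Longrightarrow> F z = g z) \<Longrightarrow> F \<notin> cusp_forms l N"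
proof -
  obtain a b c d where det: "a * d - b * c = 1" and c: "int p dvd c"
    and V: "\<And>n::nat. n > 0 \<Longrightarrow> V c d ^ n \<noteq> 1" using V_inf by blast
  have ord: "mult c d ^ n \<noteq> 1" if "n > 0" for n :: nat
    by (rule mult_infinite_order[OF det c V that])
  show "F \<notin> cusp_forms l N" if F: "\<And>z. Im z > 0 \<Longrightarrow> F z = f z"
  proof -
    obtain z0 where z0: "Im z0 > 0" "F z0 \<noteq> 0" using f_not_identically_zero F by metis
    show ?thesis
    proof (rule not_cusp_form[where F = F and k = k, OF det _ ord z0 N])
      fix z assume z: "Im z > 0"
      show "F ((of_int a * z + of_int b) / (of_int c * z + of_int d)) = mult c d * (of_int c * z + of_int d) ^ k * F z"
        unfolding F[OF z] F[OF int_moebius(2)[OF det z]] by (rule f_moebius[OF det c z])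
    qed
  qed
  show "F \<notin> cusp_forms l N" if F: "\<And>z. Im z > 0 \<Longrightarrow> F z = g z"
  proof -
    obtain c' where c': "c = int p * c'" using c by (elim dvdE)
    have det': "a * d - b * (int p * c') = 1" using det c' by simp
    then have det'': "d * a - (- c') * (- (b * int p)) = 1" by (simp add: algebra_simps)
    obtain z0 where z0: "Im z0 > 0" "F z0 \<noteq> 0" using g_not_identically_zero F by metis
    show ?thesis
    proof (rule not_cusp_form[where F = F and k = k, OF det'' _ ord z0 N])
      fix z assume z: "Im z > 0"
      show "F ((of_int d * z + of_int (- c')) / (of_int (- (b * int p)) * z + of_int a)) =
          mult c d * (of_int (- (b * int p)) * z + of_int a) ^ k * F z"
        unfolding F[OF z] F[OF int_moebius(2)[OF det'' z]] c' by (rule g_moebius[OF det' z])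
    qed
  qed
qed

section \<open>Fourier coefficients and the functional equation of the twists\<close>

lemma fourier_data:
  obtains a b :: "nat \<Rightarrow> complex" and B D :: real where
    "\<And>z. Im z > 0 \<Longrightarrow> (\<lambda>n. a (Suc n) * e (of_nat (Suc n) * z)) sums f z"
    "\<And>n. n \<ge> 1 \<Longrightarrow> cmod (a n) \<le> B * real n ^ k"
    "\<And>z. Im z > 0 \<Longrightarrow> (\<lambda>n. b (Suc n) * e (of_nat (Suc n) * z)) sums g z"
    "\<And>n. n \<ge> 1 \<Longrightarrow> cmod (b n) \<le> B * real n ^ k"
    "fricke_pair p k f g D"
proof -
  have w20: "w\<^sub>2 0 d = 0" for d by (simp add: w\<^sub>2_def)
  obtain C\<^sub>1 where C1: "\<And>z. 0 < Im z \<Longrightarrow> Im z \<le> 1 \<Longrightarrow> \<bar>Re z\<bar> \<le> 1 \<Longrightarrow> cmod (f z) \<le> C\<^sub>1 / Im z ^ k"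
    "\<And>z. 1 \<le> Im z \<Longrightarrow> \<bar>Re z\<bar> \<le> 1 \<Longrightarrow> cmod (f z) \<le> C\<^sub>1 / Im z"
    using product_bounds[OF admissible_w, of 8 "k - 8"] kappa w20 unfolding f_def by (metis order_refl)
  obtain a B\<^sub>1 D\<^sub>1 where a: "\<And>z. Im z > 0 \<Longrightarrow> (\<lambda>n. a (Suc n) * e (of_nat (Suc n) * z)) sums f z"
    "\<And>n. n \<ge> 1 \<Longrightarrow> cmod (a n) \<le> B\<^sub>1 * real n ^ k"
    "\<And>z. Im z \<ge> 1 \<Longrightarrow> cmod (f z) \<le> D\<^sub>1 * exp (- 2 * pi * Im z)"
    by (rule fourier_expansion[OF f_g_holomorphic(1) f_periodic C1]) blast+
  define P where "P = real p ^ (k div 2)"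
  have P: "P > 0" using pp by (simp add: P_def)
  obtain C\<^sub>2 where C2: "\<And>z. 0 < Im z \<Longrightarrow> Im z \<le> 1 \<Longrightarrow> \<bar>Re z\<bar> \<le> 1 \<Longrightarrow>
      cmod (eis (fricke_weight p w\<^sub>1) 8 z * eis (fricke_weight p w\<^sub>2) (k - 8) z) \<le> C\<^sub>2 / Im z ^ k"
    "\<And>z. 1 \<le> Im z \<Longrightarrow> \<bar>Re z\<bar> \<le> 1 \<Longrightarrow>
      cmod (eis (fricke_weight p w\<^sub>1) 8 z * eis (fricke_weight p w\<^sub>2) (k - 8) z) \<le> C\<^sub>2 / Im z"
    using product_bounds[OF admissible_w[THEN admissible_fricke_weight], of 8 "k - 8"] kappa fricke_w_0(1)
    by (metis order_refl)
  have g_norm: "cmod (g z) = P * cmod (eis (fricke_weight p w\<^sub>1) 8 z * eis (fricke_weight p w\<^sub>2) (k - 8) z)" for z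
    by (simp add: g_def P_def norm_mult norm_power)
  have C2': "cmod (g z) \<le> P * C\<^sub>2 / Im z ^ k" if "0 < Im z" "Im z \<le> 1" "\<bar>Re z\<bar> \<le> 1" for z
    unfolding g_norm using mult_left_mono[OF C2(1)[OF that], of P] P by simp
  have C2'': "cmod (g z) \<le> P * C\<^sub>2 / Im z" if "1 \<le> Im z" "\<bar>Re z\<bar> \<le> 1" for z
    unfolding g_norm using mult_left_mono[OF C2(2)[OF that], of P] P by simp
  obtain b B\<^sub>2 D\<^sub>2 where b: "\<And>z. Im z > 0 \<Longrightarrow> (\<lambda>n. b (Suc n) * e (of_nat (Suc n) * z)) sums g z"
    "\<And>n. n \<ge> 1 \<Longrightarrow> cmod (b n) \<le> B\<^sub>2 * real n ^ k"
    "\<And>z. Im z \<ge> 1 \<Longrightarrow> cmod (g z) \<le> D\<^sub>2 * exp (- 2 * pi * Im z)"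
    by (rule fourier_expansion[OF f_g_holomorphic(2) g_periodic C2' C2'']) blast+
  define B D where "B = max B\<^sub>1 B\<^sub>2" and "D = max D\<^sub>1 D\<^sub>2"
  have B: "cmod (a n) \<le> B * real n ^ k" "cmod (b n) \<le> B * real n ^ k" if "n \<ge> 1" for n
  proof -
    have "B\<^sub>1 * real n ^ k \<le> B * real n ^ k" "B\<^sub>2 * real n ^ k \<le> B * real n ^ k"
      by (simp_all add: B_def mult_right_mono)
    then show "cmod (a n) \<le> B * real n ^ k" "cmod (b n) \<le> B * real n ^ k"
      using a(2)[OF that] b(2)[OF that] by linarith+
  qed
  have pair: "fricke_pair p k f g D"
  proof
    show "p > 0" by (rule pp)
    show "continuous_on upper_half_plane f" using f_g_holomorphic(1) by (rule holomorphic_on_imp_continuous_on)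
    show "cmod (f z) \<le> D * exp (- 2 * pi * Im z)" if "Im z \<ge> 1" for z
      using order_trans[OF a(3)[OF that], of "D * exp (- 2 * pi * Im z)"] by (simp add: D_def)
    show "cmod (g z) \<le> D * exp (- 2 * pi * Im z)" if "Im z \<ge> 1" for z
      using order_trans[OF b(3)[OF that], of "D * exp (- 2 * pi * Im z)"] by (simp add: D_def)
    show "\<exists>\<omega>. cmod \<omega> = 1 \<and> (\<forall>t>0. f (of_nat u / of_nat q + \<i> * of_real t) =
        \<omega> * \<i> ^ k / of_real (real p ^ (k div 2) * (real q * t) ^ k) *
        g (of_nat c / of_nat q + \<i> * of_real (1 / (real (p * q\<^sup>2) * t))))"
      if "q > 0" "int q dvd int p * int u * int c + 1" for q u c
      using vertical_multiplier(1)[OF that] f_vertical[OF that] by blast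
  qed
  show ?thesis by (rule that[OF a(1) B(1) b(1) B(2) pair])
qed

lemma twisted_functional_equation:
  assumes pair: "fricke_pair p k f g D"
    and prim: "primitive_character q \<psi>" and qp: "coprime q p" and small: "3 * q\<^sup>2 + 24 \<le> p"
    and a: "\<And>z. Im z > 0 \<Longrightarrow> (\<lambda>n. a (Suc n) * e (of_nat (Suc n) * z)) sums f z"
    and b: "\<And>z. Im z > 0 \<Longrightarrow> (\<lambda>n. b (Suc n) * e (of_nat (Suc n) * z)) sums g z"
  shows "mellin (twisted_series a \<psi>) s =
    \<i> ^ k * chi (int q) * \<psi> (int p) * ((gauss_sum q \<psi>)\<^sup>2 / of_nat q) *
    of_nat (p * q\<^sup>2) powr (of_nat k / 2 - s) * mellin (twisted_series b (\<lambda>n. cnj (\<psi> n))) (of_nat k - s)"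
proof -
  have psi: "dirichlet_character q \<psi>" using prim by (simp add: primitive_character_def)
  note qpos = character_pos[OF psi]
  have "mellin (twisted_series a \<psi>) s = mellin (additive_twist f q \<psi>) s"
    by (intro mellin_cong twisted_series_eq_additive_twist[OF prim _ a])
  also have "\<dots> = \<i> ^ k * chi (int q) * \<psi> (int p) * ((gauss_sum q \<psi>)\<^sup>2 / of_nat q) *
    of_nat (p * q\<^sup>2) powr (of_nat k / 2 - s) * mellin (additive_twist g q (\<lambda>n. cnj (\<psi> n))) (of_nat k - s)"
  proof (rule fricke_pair.mellin_additive_twist_functional_equation[OF pair prim qp k(1)])
    fix u c t assume "int q dvd int p * int u * int c + 1" "t > (0::real)"
    then show "f (of_nat u / of_nat q + \<i> * of_real t) = chi (int q) * \<i> ^ k / of_real (real p ^ (k div 2) * (real q * t) ^ k) *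
        g (of_nat c / of_nat q + \<i> * of_real (1 / (real (p * q\<^sup>2) * t)))"
      using f_vertical[OF qpos] vertical_multiplier(2)[OF qpos _ small] by simp
  qed
  also have "mellin (additive_twist g q (\<lambda>n. cnj (\<psi> n))) (of_nat k - s) = mellin (twisted_series b (\<lambda>n. cnj (\<psi> n))) (of_nat k - s)"
    by (intro mellin_cong twisted_series_eq_additive_twist[OF primitive_cnj[OF prim] _ b, symmetric])
  finally show ?thesis .
qed

end

section \<open>The character of infinite order and the assembly\<close>

lemma sqrt_2_mult_ne_int:
  fixes n :: nat and m :: int
  assumes "n > 0" shows "real n * sqrt 2 \<noteq> of_int m"
proof
  assume "real n * sqrt 2 = of_int m"
  then have "(real n * sqrt 2)\<^sup>2 = (of_int m)\<^sup>2" by simp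
  then have "of_int (2 * (int n)\<^sup>2) = (of_int (m\<^sup>2) :: real)" by (simp add: power_mult_distrib mult.commute)
  then have eq: "2 * (int n)\<^sup>2 = m\<^sup>2" by (simp only: of_int_eq_iff)
  then have m: "m \<noteq> 0" using assms by auto
  have two: "prime_elem (2::int)" by simp
  \<comment> \<open>The exponent of 2 is odd in 2 n^2 and even in m^2.\<close>
  have "multiplicity 2 (2 * (int n)\<^sup>2) = 1 + 2 * multiplicity 2 (int n)"
    using assms by (simp add: prime_elem_multiplicity_mult_distrib[OF two] prime_elem_multiplicity_power_distrib[OF two])
  moreover have "multiplicity 2 (m\<^sup>2) = 2 * multiplicity 2 m"
    using m by (simp add: prime_elem_multiplicity_power_distrib[OF two])
  ultimately have "1 + 2 * multiplicity 2 (int n) = 2 * multiplicity 2 m" using eq by simp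
  then show False by presburger
qed

lemma exists_row_character:
  assumes "prime p" "p \<ge> 29" "dirichlet_character p chi" "even_character chi" "even k" "k \<ge> 16"
  obtains V where "row_character p k chi V"
proof -
  define A where "A = {q :: nat. 3 * q\<^sup>2 + 24 \<le> p}"
  have A_le: "A \<subseteq> {..p}"
  proof
    fix q assume "q \<in> A"
    moreover have "q \<le> q\<^sup>2" by (simp add: power2_eq_square)
    ultimately show "q \<in> {..p}" by (simp add: A_def)
  qed
  then have fin: "finite A" by (rule finite_subset) simp
  \<comment> \<open>1 lies in \<open>A\<close> because 3 + 24 <= p. So Q exists and is at least 1,
    and the largest such Q covers all d allowed in \<open>V_small\<close>.\<close>
  have one: "1 \<in> A" using assms(2) by (simp add: A_def)
  define Q where "Q = Max A"
  have "Q \<in> A" unfolding Q_def using fin one by (intro Max_in) auto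
  then have Q: "3 * Q\<^sup>2 + 24 \<le> p" by (simp add: A_def)
  have Q1: "Q \<ge> 1" unfolding Q_def by (rule Max_ge[OF fin one])
  obtain H :: "int \<Rightarrow> int \<Rightarrow> real" where
    H1: "\<And>c d. H (- c) (- d) = H c d" and
    H2: "\<And>a b c d x y. a * d - b * c = 1 \<Longrightarrow> int p dvd c \<Longrightarrow> coprime x y \<Longrightarrow>
       H (x * a + y * c) (x * b + y * d) = H x y + H c d" and
    H3: "\<And>a b c d. a * d - b * c = 1 \<Longrightarrow> int p dvd c \<Longrightarrow> 1 \<le> d \<Longrightarrow> d \<le> int Q \<Longrightarrow> H c d = 0" and
    H4: "\<exists>a b c d. a * d - b * c = 1 \<and> int p dvd c \<and> H c d \<noteq> 0"
    by (rule exists_cusp_integral[OF assms(1) Q Q1]) (rule that; assumption)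
  obtain a0 b0 c0 d0 where h0: "a0 * d0 - b0 * c0 = 1" "int p dvd c0" "H c0 d0 \<noteq> 0" using H4 by blast
  \<comment> \<open>Normalised to the value sqrt 2 at the chosen row, so that the n-th power of
    \<open>V\<close> there is e (n sqrt 2), which is 1 only for n = 0.\<close>
  define \<theta> where "\<theta> c d = sqrt 2 * H c d / H c0 d0" for c d
  define V where "V c d = e (of_real (\<theta> c d))" for c d
  have "row_character p k chi V"
  proof
    show "prime p" "dirichlet_character p chi" "even k" "16 \<le> k" using assms by auto
    show "27 \<le> p" using assms(2) by simp
    show "chi (- 1) = 1" using assms(4) by (simp add: even_character_def)
    show "cmod (V c d) = 1" for c d by (simp add: V_def norm_e)
    show "V (- c) (- d) = V c d" for c d by (simp add: V_def \<theta>_def H1)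
    show "V (x * a + y * c) (x * b + y * d) = V x y * V c d"
      if "a * d - b * c = 1" "int p dvd c" "coprime x y" for a b c d x y
    proof -
      have "\<theta> (x * a + y * c) (x * b + y * d) = \<theta> x y + \<theta> c d"
        unfolding \<theta>_def H2[OF that] by (simp add: distrib_left add_divide_distrib)
      then show ?thesis by (simp add: V_def e_add)
    qed
    show "V c d = 1" if "a * d - b * c = 1" "int p dvd c" "1 \<le> d" "3 * d\<^sup>2 + 24 \<le> int p" for a b c d
    proof -
      have "int (3 * (nat d)\<^sup>2 + 24) \<le> int p" using that(3,4) by simp
      then have "nat d \<in> A" unfolding A_def by (simp only: mem_Collect_eq of_nat_le_iff)
      then have "nat d \<le> Q" unfolding Q_def by (rule Max_ge[OF fin])
      then have "d \<le> int Q" by simp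
      then have "H c d = 0" by (rule H3[OF that(1-3)])
      then show ?thesis by (simp add: V_def \<theta>_def e_def)
    qed
    have "V c0 d0 ^ n \<noteq> 1" if "n > 0" for n :: nat
    proof
      assume "V c0 d0 ^ n = 1"
      then have "e (of_nat n * of_real (\<theta> c0 d0)) = 1" by (simp only: V_def e_of_nat_mult)
      then obtain m :: int where "(of_nat n * of_real (\<theta> c0 d0) :: complex) = of_int m" unfolding e_eq_1_iff by blast
      then have "complex_of_real (real n * \<theta> c0 d0) = complex_of_real (of_int m)" by simp
      then have "real n * \<theta> c0 d0 = of_int m" by (simp only: of_real_eq_iff)
      then have "real n * sqrt 2 = of_int m" using h0(3) by (simp add: \<theta>_def)
      then show False using sqrt_2_mult_ne_int[OF that] by blast
    qed
    then show "\<exists>a b c d. a * d - b * c = 1 \<and> int p dvd c \<and> (\<forall>n>0. V c d ^ n \<noteq> 1)" using h0(1,2) by blast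
  qed
  then show ?thesis by (rule that)
qed

lemma bigo_power:
  fixes a :: "nat \<Rightarrow> complex"
  assumes "\<And>n. n \<ge> 1 \<Longrightarrow> cmod (a n) \<le> B * real n ^ k"
  shows "(\<lambda>m. cmod (a m)) \<in> O(\<lambda>m. real m powr real k)"
proof (rule bigoI[of _ B])
  show "eventually (\<lambda>m. norm (cmod (a m)) \<le> B * norm (real m powr real k)) at_top"
    using eventually_ge_at_top[of 1]
    by eventually_elim (use assms in \<open>simp add: powr_realpow\<close>)
qed

theorem theorem1:
  fixes p k :: nat and chi :: "int \<Rightarrow> complex"
  assumes "prime p" and "p \<ge> 29"
    and "dirichlet_character p chi" and "even_character chi"
    and "even k" and "k \<ge> 16"
  shows "\<exists>(a :: nat \<Rightarrow> complex) (b :: nat \<Rightarrow> complex) (\<sigma> :: real).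
    \<sigma> > 0 \<and>
    (\<lambda>m. cmod (a m)) \<in> O(\<lambda>m. real m powr \<sigma>) \<and>
    (\<lambda>m. cmod (b m)) \<in> O(\<lambda>m. real m powr \<sigma>) \<and>
    fourier_series a \<notin> (\<Union>l. \<Union>N\<in>{1..}. cusp_forms l N) \<and>
    fourier_series b \<notin> (\<Union>l. \<Union>N\<in>{1..}. cusp_forms l N) \<and>
    (\<exists>\<Lambda>\<^sub>f \<Lambda>\<^sub>g :: (int \<Rightarrow> complex) \<Rightarrow> complex \<Rightarrow> complex.
      \<forall>q \<psi>. primitive_character q \<psi> \<and> coprime q p \<longrightarrow>
        entire_continuation (\<sigma> + 1) (completed_L a \<psi>) (\<Lambda>\<^sub>f \<psi>) \<and>
        entire_continuation (\<sigma> + 1) (completed_L b \<psi>) (\<Lambda>\<^sub>g \<psi>) \<and>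
        bounded_in_vertical_strips (\<Lambda>\<^sub>f \<psi>) \<and>
        bounded_in_vertical_strips (\<Lambda>\<^sub>g \<psi>) \<and>
        (real q \<le> sqrt ((real p - 24) / 3) \<longrightarrow>
          (\<forall>s. \<Lambda>\<^sub>f \<psi> s =
             \<i> ^ k * chi (int q) * \<psi> (int p) * ((gauss_sum q \<psi>)\<^sup>2 / of_nat q) *
             of_nat (p * q\<^sup>2) powr (of_nat k / 2 - s) *
             \<Lambda>\<^sub>g (\<lambda>n. cnj (\<psi> n)) (of_nat k - s))))"
proof -
  obtain V where V: "row_character p k chi V" using exists_row_character[OF assms] .
  interpret row_character p k chi V by (rule V)
  obtain a b B D where a: "\<And>z. Im z > 0 \<Longrightarrow> (\<lambda>n. a (Suc n) * e (of_nat (Suc n) * z)) sums f z"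
    "\<And>n. n \<ge> 1 \<Longrightarrow> cmod (a n) \<le> B * real n ^ k"
    and b: "\<And>z. Im z > 0 \<Longrightarrow> (\<lambda>n. b (Suc n) * e (of_nat (Suc n) * z)) sums g z"
    "\<And>n. n \<ge> 1 \<Longrightarrow> cmod (b n) \<le> B * real n ^ k"
    and pair: "fricke_pair p k f g D"
    by (rule fourier_data) (rule that; assumption)
  have pair': "fricke_pair p k g f D"
    using f_g_holomorphic(2) by (intro fricke_pair.swapped[OF pair assms(5)] holomorphic_on_imp_continuous_on)
  have fs: "fourier_series a z = f z" "fourier_series b z = g z" if "Im z > 0" for z
    unfolding fourier_series_def using a(1)[OF that] b(1)[OF that] by (simp_all add: sums_iff)
  have small: "3 * q\<^sup>2 + 24 \<le> p" if "real q \<le> sqrt ((real p - 24) / 3)" for q :: nat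
  proof -
    have "(real q)\<^sup>2 \<le> (sqrt ((real p - 24) / 3))\<^sup>2" using that by (intro power_mono) auto
    then have "real (3 * q\<^sup>2 + 24) \<le> real p" using assms(2) by simp
    then show ?thesis by (simp only: of_nat_le_iff)
  qed
  show ?thesis
  \<comment> \<open>The exponent \<open>\<sigma>\<close> = k is the order of growth of the forms
    near the real axis, passed on to the coefficients by Cauchy's inequality.\<close>
  proof (rule exI[of _ a], rule exI[of _ b], rule exI[of _ "real k"], intro conjI)
    show "real k > 0" using assms(6) by simp
    show "(\<lambda>m. cmod (a m)) \<in> O(\<lambda>m. real m powr real k)" by (rule bigo_power[OF a(2)])
    show "(\<lambda>m. cmod (b m)) \<in> O(\<lambda>m. real m powr real k)" by (rule bigo_power[OF b(2)])
    show "fourier_series a \<notin> (\<Union>l. \<Union>N\<in>{1..}. cusp_forms l N)"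
      using not_cusp_form_if_agree(1)[OF _ fs(1)] by auto
    show "fourier_series b \<notin> (\<Union>l. \<Union>N\<in>{1..}. cusp_forms l N)"
      using not_cusp_form_if_agree(2)[OF _ fs(2)] by auto
    show "\<exists>\<Lambda>\<^sub>f \<Lambda>\<^sub>g :: (int \<Rightarrow> complex) \<Rightarrow> complex \<Rightarrow> complex.
      \<forall>q \<psi>. primitive_character q \<psi> \<and> coprime q p \<longrightarrow>
        entire_continuation (real k + 1) (completed_L a \<psi>) (\<Lambda>\<^sub>f \<psi>) \<and>
        entire_continuation (real k + 1) (completed_L b \<psi>) (\<Lambda>\<^sub>g \<psi>) \<and>
        bounded_in_vertical_strips (\<Lambda>\<^sub>f \<psi>) \<and>
        bounded_in_vertical_strips (\<Lambda>\<^sub>g \<psi>) \<and>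
        (real q \<le> sqrt ((real p - 24) / 3) \<longrightarrow>
          (\<forall>s. \<Lambda>\<^sub>f \<psi> s =
             \<i> ^ k * chi (int q) * \<psi> (int p) * ((gauss_sum q \<psi>)\<^sup>2 / of_nat q) *
             of_nat (p * q\<^sup>2) powr (of_nat k / 2 - s) *
             \<Lambda>\<^sub>g (\<lambda>n. cnj (\<psi> n)) (of_nat k - s)))"
    proof (rule exI[of _ "\<lambda>\<psi>. mellin (twisted_series a \<psi>)"], rule exI[of _ "\<lambda>\<psi>. mellin (twisted_series b \<psi>)"],
        intro allI impI)
      fix q \<psi> assume "primitive_character q \<psi> \<and> coprime q p"
      then have prim: "primitive_character q \<psi>" and qp: "coprime q p" by auto
      note cont_a = fricke_pair.twisted_series_continuation[OF pair a prim qp]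
      note cont_b = fricke_pair.twisted_series_continuation[OF pair' b prim qp]
      note eq = twisted_functional_equation[OF pair prim qp small a(1) b(1)]
      show "entire_continuation (real k + 1) (completed_L a \<psi>) (mellin (twisted_series a \<psi>)) \<and>
        entire_continuation (real k + 1) (completed_L b \<psi>) (mellin (twisted_series b \<psi>)) \<and>
        bounded_in_vertical_strips (mellin (twisted_series a \<psi>)) \<and>
        bounded_in_vertical_strips (mellin (twisted_series b \<psi>)) \<and>
        (real q \<le> sqrt ((real p - 24) / 3) \<longrightarrow>
          (\<forall>s. mellin (twisted_series a \<psi>) s =
             \<i> ^ k * chi (int q) * \<psi> (int p) * ((gauss_sum q \<psi>)\<^sup>2 / of_nat q) *
             of_nat (p * q\<^sup>2) powr (of_nat k / 2 - s) *
             mellin (twisted_series b (\<lambda>n. cnj (\<psi> n))) (of_nat k - s)))"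
        by (intro conjI impI allI cont_a cont_b eq)
    qed
  qed
qed

end
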